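(* Assume the setting in the context, and suppose that for some $\alpha>0$ and all $e\in U$, $$\int_\Omega |\log p(\omega,e)|^{d+\alpha}\,d\mathbb{P}(\omega)<\infty .$$ Then for every $\lambda\in\mathbb{R}^d$, for $\mathbb{P}$-almost every $\omega$, $$\lim_{n\to\infty}\frac1n\log E^{P_\omega}\left[\mathrm{e}^{\langle\lambda,X_n\rangle}\right]=\Lambda(\lambda).$$
   Context: Let $d\ge 1$ and $U=\{e\in\mathbb{Z}^d: |e|=1\}$, where $|x|=|x_1|+\dots+|x_d|$ is the $\ell_1$ norm. Let $(\Omega,\mathcal{F},\mathbb{P})$ be a probability space with $\mathcal{F}$ countably generated, and let $\{T_e\}_{e\in U}$ be commuting $\mathbb{P}$-measure-preserving transformations of $\Omega$ with $T_{-e}=T_e^{-1}$, forming an ergodic family (every event invariant under all $T_e$ has probability $0$ or $1$). For $x\in\mathbb{Z}^d$ write $T_x=T_{e_1}^{x_1}\cdots T_{e_d}^{x_d}$ ($e_i$ the $i$-th unit vector). Let $p:\Omega\times U\to[0,1]$ be measurable with $\sum_{e\in U}p(\omega,e)=1$ for all $\omega$. For fixed $\omega$, $P_\omega$ denotes the law of the nearest-neighbour random walk $(X_n)_{n\ge0}$ on $\mathbb{Z}^d$ with $X_0=0$ and $P_\omega(X_{n+1}=X_n+e\mid X_0,\dots,X_n)=p(T_{X_n}\omega,e)$, $e\in U$; $E^{P_\omega}$ is expectation under $P_\omega$, and $\mathbb{E}$ is expectation under $\mathbb{P}$. A function $F:\Omega\times U\to\mathbb{R}$ is in class $\mathcal{K}$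 if: (i) there is $\alpha>0$ with $\mathbb{E}[|F(\cdot,e)|^{d+\alpha}]<\infty$ for every $e\in U$; (ii) $\mathbb{E}[F(\cdot,e)]=0$ for every $e\in U$; (iii) ($\mathbb{P}$-a.s.) for every finite sequence $x_0,\dots,x_n\in\mathbb{Z}^d$ with $x_{i+1}-x_i\in U$ and $x_0=x_n$, $\sum_{i=0}^{n-1}F(T_{x_i}\omega,x_{i+1}-x_i)=0$. Define $$\Lambda(\lambda)=\inf_{F\in\mathcal{K}}\ \operatorname*{ess\,sup}_{\omega}\ \log\sum_{e\in U}p(\omega,e)\,\mathrm{e}^{\langle\lambda,e\rangle+F(\omega,e)},$$ the essential supremum taken with respect to $\mathbb{P}$. *)

theory Defs
  imports "HOL-Probability.Probability"
begin

definition l1norm :: "int ^ 'd \<Rightarrow> int" where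
  "l1norm x = (\<Sum>i\<in>UNIV. \<bar>x $ i\<bar>)"

definition unit_steps :: "(int ^ 'd) set" where
  "unit_steps = {e. l1norm e = 1}"

definition countably_generated_measure :: "'w measure \<Rightarrow> bool" where
  "countably_generated_measure M \<longleftrightarrow>
     (\<exists>G. countable G \<and> G \<subseteq> Pow (space M) \<and> sets M = sigma_sets (space M) G)"

definition measure_preserving :: "'w measure \<Rightarrow> ('w \<Rightarrow> 'w) \<Rightarrow> bool" where
  "measure_preserving M f \<longleftrightarrow> f \<in> M \<rightarrow>\<^sub>M M \<and> distr M M f = M"

definition to_real_vec :: "int ^ 'd \<Rightarrow> real ^ 'd" where
  "to_real_vec x = (\<chi> i. real_of_int (x $ i))"

definition walk_pos :: "(int ^ 'd) list \<Rightarrow> nat \<Rightarrow> int ^ 'd" where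
  "walk_pos es k = sum_list (take k es)"

definition path_prob ::
  "(int ^ 'd \<Rightarrow> 'w \<Rightarrow> 'w) \<Rightarrow> ('w \<Rightarrow> int ^ 'd \<Rightarrow> real) \<Rightarrow> 'w \<Rightarrow> (int ^ 'd) list \<Rightarrow> real" where
  "path_prob T p \<omega> es = (\<Prod>i<length es. p (T (walk_pos es i) \<omega>) (es ! i))"

text \<open>E^{P_omega}[exp <lambda, X_n>], written out as the sum over all n-step nearest-neighbour paths.\<close>
definition quenched_mgf ::
  "(int ^ 'd \<Rightarrow> 'w \<Rightarrow> 'w) \<Rightarrow> ('w \<Rightarrow> int ^ 'd \<Rightarrow> real) \<Rightarrow> 'w \<Rightarrow> real ^ 'd \<Rightarrow> nat \<Rightarrow> real" where
  "quenched_mgf T p \<omega> lam n =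
     (\<Sum>es\<in>{es. length es = n \<and> set es \<subseteq> unit_steps}.
        path_prob T p \<omega> es * exp (lam \<bullet> to_real_vec (walk_pos es n)))"

definition classK ::
  "'w measure \<Rightarrow> (int ^ 'd \<Rightarrow> 'w \<Rightarrow> 'w) \<Rightarrow> ('w \<Rightarrow> int ^ 'd \<Rightarrow> real) set" where
  "classK M T = {F.
     (\<forall>e\<in>unit_steps. (\<lambda>\<omega>. F \<omega> e) \<in> borel_measurable M) \<and>
     (\<exists>\<alpha>>0. \<forall>e\<in>unit_steps.
        integrable M (\<lambda>\<omega>. \<bar>F \<omega> e\<bar> powr (real CARD('d) + \<alpha>))) \<and>
     (\<forall>e\<in>unit_steps. integral\<^sup>L M (\<lambda>\<omega>. F \<omega> e) = 0) \<and>
     (AE \<omega> in M. \<forall>xs::(int ^ 'd) list. xs \<noteq> [] \<longrightarrow> hd xs = last xs \<longrightarrow>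
         (\<forall>i. Suc i < length xs \<longrightarrow> xs ! Suc i - xs ! i \<in> unit_steps) \<longrightarrow>
         (\<Sum>i<length xs - 1. F (T (xs ! i) \<omega>) (xs ! Suc i - xs ! i)) = 0)}"

definition Lambda ::
  "'w measure \<Rightarrow> (int ^ 'd \<Rightarrow> 'w \<Rightarrow> 'w) \<Rightarrow> ('w \<Rightarrow> int ^ 'd \<Rightarrow> real) \<Rightarrow> real ^ 'd \<Rightarrow> ereal" where
  "Lambda M T p lam =
     (INF F\<in>classK M T. esssup M (\<lambda>\<omega>. ereal (ln (\<Sum>e\<in>unit_steps.
         p \<omega> e * exp (lam \<bullet> to_real_vec e + F \<omega> e)))))"

end

theory Submission
  imports Defs
begin

text \<open>
  Upper bound: the potential of a field in \<open>\<K>\<close> is sublinear, so \<open>exp\<close> of the potential is a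
  supersolution whose fluctuations over the range of the walk are subexponential. Sublinearity holds
  because the field is, modulo the gradient of a function in \<open>L\<^sup>q\<close>, arbitrarily small in \<open>L\<^sup>q\<close>; a
  discrete Morrey inequality (\<open>q > d\<close>) bounds the oscillation of a potential by spatial averages of
  the \<open>q\<close>-th power of its gradient, and a maximal inequality controls these averages almost surely.

  Lower bound: let \<open>Z\<^sub>n\<close> be the expectation of \<open>exp \<langle>\<lambda>, X\<^sub>n\<rangle>\<close>. If \<open>inf\<^sub>n exp (- t n) Z\<^sub>n = 0\<close> almost
  surely, then the gradients of the logarithms of the running minima of \<open>exp (- t n) Z\<^sub>n\<close> are mean-zero
  cocycles, dominated by one function in \<open>L\<^sup>q\<close>, that satisfy the inequality \<open>\<Lambda> \<le> t\<close> asks for on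
  events increasing to the whole space. These constraints are convex, so near-minimizers of a weighted
  \<open>L\<^sup>2\<close> norm converge to a field in \<open>\<K>\<close> that satisfies the inequality almost everywhere. Ergodicity
  gives the zero-one alternative for the event \<open>inf\<^sub>n exp (- t n) Z\<^sub>n = 0\<close>.
\<close>

section \<open>Lattice cubes and a discrete Morrey inequality\<close>

text \<open>The constraints on a field, closed loops and the inequality under the essential
  supremum, are pointwise. Near-minimizers converge almost surely, so these constraints pass to the
  limit term by term. Running minima appear for the following reason. Put
  \<open>u_n = exp (- t n) Z_n\<close>. Summing the tilted weights against \<open>u_n\<close> at the
  neighbours gives \<open>exp t * u_(n+1)\<close>, so \<open>u_n\<close> is a supersolution only
  where \<open>u_(n+1) <= u_n\<close>. The minimum over \<open>n <= N\<close> is one wherever some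
  \<open>u_n\<close> with \<open>1 <= n <= N\<close> is at most \<open>u_0 = 1\<close>, and if the
  infimum over all \<open>n\<close> is 0 almost surely, these events exhaust the space. Moreover the
  gradient of its logarithm is bounded independently of \<open>N\<close>, because
  \<open>Z_(n+1)\<close> and \<open>Z_n\<close> differ by a bounded factor. In the upper bound the
  obstacle is that smallness in \<open>L^q\<close> must become a bound at every single site of a
  large cube. This is where \<open>q > d\<close> enters, twice: in the Morrey inequality for the
  small remainder, and in the fact that an \<open>L^q\<close> function along an orbit grows slower
  than the side of the cube.\<close>

definition ibox :: "int ^ 'd \<Rightarrow> ('d \<Rightarrow> nat) \<Rightarrow> (int ^ 'd) set" where
  "ibox c m = {x. \<forall>i. c $ i \<le> x $ i \<and> x $ i < c $ i + int (m i)}"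

abbreviation icube :: "int ^ 'd \<Rightarrow> nat \<Rightarrow> (int ^ 'd) set" where
  "icube c n \<equiv> ibox c (\<lambda>_. n)"

lemma ibox_bij:
  "bij_betw vec_nth (ibox c m) (PiE UNIV (\<lambda>i. {c $ i..<c $ i + int (m i)}))"
proof (rule bij_betwI[where g = vec_lambda])
  show "vec_nth \<in> ibox c m \<rightarrow> PiE UNIV (\<lambda>i. {c $ i..<c $ i + int (m i)})"
    by (auto simp: ibox_def)
  show "vec_lambda \<in> PiE UNIV (\<lambda>i. {c $ i..<c $ i + int (m i)}) \<rightarrow> ibox c m"
    by (auto simp: ibox_def PiE_def Pi_def)
qed (auto simp: vec_lambda_inverse)

lemma finite_ibox [simp, intro]: "finite (ibox (c :: int ^ 'd) m)"
proof -
  have "finite (PiE UNIV (\<lambda>i. {c $ i..<c $ i + int (m i)}))"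
    by (intro finite_PiE) auto
  then show ?thesis
    using bij_betw_finite[OF ibox_bij[of c m]] by simp
qed

lemma card_ibox: "card (ibox (c :: int ^ 'd) m) = (\<Prod>i\<in>UNIV. m i)"
proof -
  have "card (ibox c m) = card (PiE UNIV (\<lambda>i. {c $ i..<c $ i + int (m i)}))"
    by (rule bij_betw_same_card[OF ibox_bij])
  also have "\<dots> = (\<Prod>i\<in>UNIV. m i)"
    by (subst card_PiE) auto
  finally show ?thesis .
qed

lemma card_icube: "card (icube (c :: int ^ 'd) n) = n ^ CARD('d)"
  by (simp add: card_ibox)

lemma ibox_split:
  "x \<in> ibox c m \<longleftrightarrow> (c $ i \<le> x $ i \<and> x $ i < c $ i + int (m i)) \<and>
     (\<forall>j. j \<noteq> i \<longrightarrow> c $ j \<le> x $ j \<and> x $ j < c $ j + int (m j))"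
proof
  assume *: "(c $ i \<le> x $ i \<and> x $ i < c $ i + int (m i)) \<and>
     (\<forall>j. j \<noteq> i \<longrightarrow> c $ j \<le> x $ j \<and> x $ j < c $ j + int (m j))"
  have "c $ j \<le> x $ j \<and> x $ j < c $ j + int (m j)" for j
    using * by (cases "j = i") auto
  then show "x \<in> ibox c m" by (simp add: ibox_def)
qed (simp add: ibox_def)

lemma axis_nth': "axis i a $ j = (if j = i then a else 0)"
  by (simp add: axis_def)

section \<open>Averages over boxes and the oscillation of functions with controlled gradient\<close>

definition avg :: "('a \<Rightarrow> real) \<Rightarrow> 'a set \<Rightarrow> real" where
  "avg \<phi> B = sum \<phi> B / real (card B)"

lemma shift_diff_le:
  fixes \<phi> D :: "int ^ 'd \<Rightarrow> real"
  assumes "\<And>s. s < n \<Longrightarrow> \<bar>\<phi> (y + axis i (int s) + axis i 1) - \<phi> (y + axis i (int s))\<bar> \<le> D (y + axis i (int s))"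
  shows "\<bar>\<phi> (y + axis i (int n)) - \<phi> y\<bar> \<le> (\<Sum>s<n. D (y + axis i (int s)))"
  using assms
proof (induction n)
  case 0
  have "y + axis i (int 0) = y" by (simp add: vec_eq_iff axis_nth')
  then show ?case by (simp only: diff_self) simp
next
  case (Suc n)
  have eq: "y + axis i (int (Suc n)) = y + axis i (int n) + axis i 1"
    by (auto simp: vec_eq_iff axis_def)
  have "\<bar>\<phi> (y + axis i (int n)) - \<phi> y\<bar> \<le> (\<Sum>s<n. D (y + axis i (int s)))"
    using Suc by auto
  moreover have "\<bar>\<phi> (y + axis i (int n) + axis i 1) - \<phi> (y + axis i (int n))\<bar> \<le> D (y + axis i (int n))"
    using Suc.prems[of n] by simp
  ultimately show ?case unfolding eq by simp
qed

text \<open>The two halves in direction \<open>i\<close> are translates of each other by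
  \<open>n\<close> unit steps, and the average over the box is the mean of their averages, so it
  differs from either by half the difference of the two. That difference telescopes into increments
  over \<open>n\<close> shifted copies of one half; each copy stays inside the box and costs at most
  \<open>sum D (ibox c m)\<close>.\<close>

lemma halving:
  fixes \<phi> D :: "int ^ 'd \<Rightarrow> real" and m :: "'d \<Rightarrow> nat"
  assumes mi: "m i = 2 * n" and mpos: "\<And>j. m j > 0"
    and D0: "\<And>y. y \<in> ibox c m \<Longrightarrow> 0 \<le> D y"
    and grad: "\<And>y. y \<in> ibox c m \<Longrightarrow> \<bar>\<phi> (y + axis i 1) - \<phi> y\<bar> \<le> D y"
    and P: "P = ibox c (m(i := n)) \<or> P = ibox (c + axis i (int n)) (m(i := n))"
  shows "\<bar>avg \<phi> (ibox c m) - avg \<phi> P\<bar> \<le> real n / (2 * real (card P)) * sum D (ibox c m)"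
proof -
  define P1 where "P1 = ibox c (m(i := n))"
  define P2 where "P2 = ibox (c + axis i (int n)) (m(i := n))"
  have n0: "n > 0" using mi mpos[of i] by simp
  have in1: "x \<in> P1 \<longleftrightarrow> x \<in> ibox c m \<and> x $ i < c $ i + int n" for x
    using mi n0 unfolding P1_def ibox_split[of x _ _ i] by auto
  have in2: "x \<in> P2 \<longleftrightarrow> x \<in> ibox c m \<and> x $ i \<ge> c $ i + int n" for x
    using mi n0 unfolding P2_def ibox_split[of x _ _ i] by (auto simp: axis_nth')
  have un: "ibox c m = P1 \<union> P2" and dis: "P1 \<inter> P2 = {}"
    using in1 in2 by (auto simp: not_less)
  have fin: "finite P1" "finite P2" by (auto simp: P1_def P2_def)
  have img: "P2 = (\<lambda>y. y + axis i (int n)) ` P1"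
  proof (intro set_eqI iffI)
    fix x assume "x \<in> P2"
    then have "x - axis i (int n) \<in> P1"
      unfolding P1_def P2_def ibox_split[of _ _ _ i] by (auto simp: axis_nth')
    then show "x \<in> (\<lambda>y. y + axis i (int n)) ` P1" by (intro image_eqI[of _ _ "x - axis i (int n)"]) auto
  qed (auto simp: P1_def P2_def ibox_split[of _ _ _ i] axis_nth')
  have inj: "inj_on (\<lambda>y. y + axis i (int n)) P1" by (auto simp: inj_on_def)
  have cd: "card P2 = card P1" unfolding img by (rule card_image[OF inj])
  have cpos: "card P1 > 0"
    unfolding P1_def card_ibox using mpos n0 by (auto intro!: prod_pos)
  have cb: "card (ibox c m) = 2 * card P1"
    unfolding un using card_Un_disjoint[OF fin dis] cd by simp
  have s2: "sum \<phi> P2 = (\<Sum>y\<in>P1. \<phi> (y + axis i (int n)))"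
    unfolding img by (subst sum.reindex[OF inj]) simp
  have sb: "sum \<phi> (ibox c m) = sum \<phi> P1 + sum \<phi> P2"
    unfolding un by (rule sum.union_disjoint[OF fin dis])
  have diff: "\<bar>sum \<phi> P2 - sum \<phi> P1\<bar> \<le> real n * sum D (ibox c m)"
  proof -
    have inb: "y + axis i (int s) \<in> ibox c m" if "y \<in> P1" "s < n" for y s
      using that mi n0 unfolding P1_def ibox_split[of _ _ _ i] by (auto simp: axis_nth')
    have "\<bar>sum \<phi> P2 - sum \<phi> P1\<bar> = \<bar>\<Sum>y\<in>P1. \<phi> (y + axis i (int n)) - \<phi> y\<bar>"
      by (simp add: s2 sum_subtractf)
    also have "\<dots> \<le> (\<Sum>y\<in>P1. \<bar>\<phi> (y + axis i (int n)) - \<phi> y\<bar>)" by (rule sum_abs)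
    also have "\<dots> \<le> (\<Sum>y\<in>P1. \<Sum>s<n. D (y + axis i (int s)))"
      by (intro sum_mono shift_diff_le grad inb) auto
    also have "\<dots> = (\<Sum>s<n. \<Sum>y\<in>P1. D (y + axis i (int s)))" by (rule sum.swap)
    also have "\<dots> \<le> (\<Sum>s<n. sum D (ibox c m))"
    proof (rule sum_mono)
      fix s assume s: "s \<in> {..<n}"
      have "(\<Sum>y\<in>P1. D (y + axis i (int s))) = sum D ((\<lambda>y. y + axis i (int s)) ` P1)"
        by (subst sum.reindex) (auto simp: inj_on_def)
      also have "\<dots> \<le> sum D (ibox c m)"
        using s inb D0 by (intro sum_mono2) auto
      finally show "(\<Sum>y\<in>P1. D (y + axis i (int s))) \<le> sum D (ibox c m)" .
    qed
    finally show ?thesis by simp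
  qed
  have a: "avg \<phi> (ibox c m) = (sum \<phi> P1 + sum \<phi> P2) / (2 * real (card P1))"
    by (simp add: avg_def sb cb)
  have e1: "avg \<phi> (ibox c m) - avg \<phi> P1 = (sum \<phi> P2 - sum \<phi> P1) / (2 * real (card P1))"
    unfolding a using cpos by (simp add: avg_def field_simps)
  have e2: "avg \<phi> (ibox c m) - avg \<phi> P2 = - (sum \<phi> P2 - sum \<phi> P1) / (2 * real (card P1))"
    unfolding a using cpos cd by (simp add: avg_def field_simps)
  have "\<bar>sum \<phi> P2 - sum \<phi> P1\<bar> / (2 * real (card P1)) \<le> real n * sum D (ibox c m) / (2 * real (card P1))"
    using diff cpos by (intro divide_right_mono) auto
  then have "\<bar>avg \<phi> (ibox c m) - avg \<phi> P1\<bar> \<le> real n / (2 * real (card P1)) * sum D (ibox c m)"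
    and "\<bar>avg \<phi> (ibox c m) - avg \<phi> P2\<bar> \<le> real n / (2 * real (card P1)) * sum D (ibox c m)"
    unfolding e1 e2 by (simp_all add: abs_minus_commute)
  then show ?thesis using P cd by (auto simp: P1_def[symmetric] P2_def[symmetric])
qed

text \<open>The cube is cut in half once per direction, keeping the half that contains the subcube.
  Boxes with unequal sides occur on the way, which is why \<open>ibox\<close> carries one length per
  coordinate.\<close>

lemma avg_subcube:
  fixes \<phi> D :: "int ^ 'd \<Rightarrow> real" and n :: nat
  assumes n0: "n > 0"
    and D0: "\<And>y. y \<in> icube c (2 * n) \<Longrightarrow> 0 \<le> D y"
    and grad: "\<And>y i. y \<in> icube c (2 * n) \<Longrightarrow> \<bar>\<phi> (y + axis i 1) - \<phi> y\<bar> \<le> D y"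
    and c': "\<And>i. c' $ i = c $ i \<or> c' $ i = c $ i + int n"
  shows "\<bar>avg \<phi> (icube c (2 * n)) - avg \<phi> (icube c' n)\<bar>
     \<le> real CARD('d) * (real n / (2 * real n ^ CARD('d)) * sum D (icube c (2 * n)))"
proof -
  \<comment> \<open>Interpolates between the two cubes: directions in \<open>I\<close> have the long
    side \<open>2 * n\<close> and the corner of \<open>c\<close>, the others the side
    \<open>n\<close> and the corner of \<open>c'\<close>.\<close>
  define cc where "cc I = (\<chi> i. if i \<in> I then c $ i else c' $ i)" for I
  define mm where "mm I = (\<lambda>i. if i \<in> I then 2 * n else n)" for I :: "'d set"
  define K where "K = real n / (2 * real n ^ CARD('d)) * sum D (icube c (2 * n))"
  have sub: "ibox (cc I) (mm I) \<subseteq> icube c (2 * n)" for I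
  proof
    fix x assume x: "x \<in> ibox (cc I) (mm I)"
    have "c $ i \<le> x $ i \<and> x $ i < c $ i + int (2 * n)" for i
    proof -
      have "cc I $ i \<le> x $ i \<and> x $ i < cc I $ i + int (mm I i)"
        using x unfolding ibox_def by blast
      then show ?thesis using c'[of i] by (auto simp: cc_def mm_def split: if_splits)
    qed
    then show "x \<in> icube c (2 * n)" by (simp add: ibox_def)
  qed
  have main: "\<bar>avg \<phi> (ibox (cc I) (mm I)) - avg \<phi> (icube c' n)\<bar> \<le> real (card I) * K" if "finite I" for I
    using that
  proof (induction I)
    case empty
    have "cc {} = c'" by (simp add: cc_def vec_eq_iff)
    moreover have "mm {} = (\<lambda>_. n)" by (simp add: mm_def)
    ultimately show ?case by simp
  next
    case (insert i I)
    define P where "P = ibox (cc I) (mm I)"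
    have m: "(mm (insert i I))(i := n) = mm I"
      using insert by (auto simp: mm_def fun_eq_iff)
    have Peq: "P = ibox (cc (insert i I)) ((mm (insert i I))(i := n)) \<or>
      P = ibox (cc (insert i I) + axis i (int n)) ((mm (insert i I))(i := n))"
    proof (cases "c' $ i = c $ i")
      case True
      then have "cc (insert i I) = cc I" using insert by (auto simp: cc_def vec_eq_iff)
      then show ?thesis using m by (simp add: P_def)
    next
      case False
      then have "cc (insert i I) + axis i (int n) = cc I"
        using insert c'[of i] by (auto simp: cc_def vec_eq_iff axis_def)
      then show ?thesis using m by (simp add: P_def)
    qed
    have "\<bar>avg \<phi> (ibox (cc (insert i I)) (mm (insert i I))) - avg \<phi> P\<bar>
      \<le> real n / (2 * real (card P)) * sum D (ibox (cc (insert i I)) (mm (insert i I)))"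
    proof (rule halving[OF _ _ _ _ Peq])
      show "mm (insert i I) i = 2 * n" by (simp add: mm_def)
      show "\<And>j. 0 < mm (insert i I) j" using n0 by (auto simp: mm_def)
    qed (use sub D0 grad in blast)+
    \<comment> \<open>The intermediate box \<open>P\<close> has at least as many points as the small
      cube, so the small cube gives the worst constant.\<close>
    also have "\<dots> \<le> K" unfolding K_def
    proof (rule mult_mono)
      have "n ^ CARD('d) \<le> card P" unfolding P_def card_ibox
        using prod_mono[of UNIV "\<lambda>_. n" "mm I"] by (auto simp: mm_def)
      then have "real n ^ CARD('d) \<le> real (card P)" by (metis of_nat_le_iff of_nat_power)
      moreover have "0 < real n ^ CARD('d)" using n0 by simp
      ultimately have "real n ^ CARD('d) \<le> real (card P)" "0 < real (card P)" "0 < real n ^ CARD('d)" by linarith+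
      then show "real n / (2 * real (card P)) \<le> real n / (2 * real n ^ CARD('d))"
        using n0 by (intro divide_left_mono mult_left_mono mult_pos_pos) auto
      show "sum D (ibox (cc (insert i I)) (mm (insert i I))) \<le> sum D (icube c (2 * n))"
        using sub D0 by (intro sum_mono2) auto
      show "0 \<le> sum D (ibox (cc (insert i I)) (mm (insert i I)))"
        using sub D0 by (intro sum_nonneg) blast
    qed auto
    finally show ?case using insert unfolding P_def by (simp add: algebra_simps)
  qed
  have "cc UNIV = c" by (simp add: cc_def vec_eq_iff)
  moreover have "mm UNIV = (\<lambda>_. 2 * n)" by (simp add: mm_def)
  ultimately show ?thesis using main[of UNIV] by (simp add: K_def)
qed

text \<open>At each level the dyadic subcube of half the side that contains \<open>x\<close> is
  selected, until the cube is the single point \<open>x\<close>. The hypothesis on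
  \<open>\<delta>\<close> is uniform in the position of the cube because the selected cubes depend
  on \<open>x\<close>.\<close>

lemma dyadic_chain:
  fixes \<phi> D :: "int ^ 'd \<Rightarrow> real"
  assumes D0: "\<And>y. y \<in> Q \<Longrightarrow> 0 \<le> D y"
    and grad: "\<And>y i. y \<in> Q \<Longrightarrow> \<bar>\<phi> (y + axis i 1) - \<phi> y\<bar> \<le> D y"
    and \<delta>: "\<And>j c. icube c (2 ^ Suc j) \<subseteq> Q \<Longrightarrow> j < K \<Longrightarrow>
      real CARD('d) * (2 ^ j / (2 * (2 ^ j) ^ CARD('d)) * sum D (icube c (2 ^ Suc j))) \<le> \<delta> j"
    and "k \<le> K" "icube c (2 ^ k) \<subseteq> Q" "x \<in> icube c (2 ^ k)"
  shows "\<bar>avg \<phi> (icube c (2 ^ k)) - \<phi> x\<bar> \<le> (\<Sum>j<k. \<delta> j)"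
  using assms(4-6)
proof (induction k arbitrary: c)
  case 0
  have e: "icube c (2 ^ 0) = {c}"
    by (auto simp: ibox_def vec_eq_iff) (smt (verit))
  then have "x = c" using 0 by auto
  then show ?case unfolding e by (simp add: avg_def)
next
  case (Suc k)
  define c' where "c' = (\<chi> i. if x $ i < c $ i + 2 ^ k then c $ i else c $ i + 2 ^ k)"
  have xc: "c $ i \<le> x $ i \<and> x $ i < c $ i + 2 ^ Suc k" for i
    using Suc.prems(3) by (auto simp: ibox_def)
  have xin: "x \<in> icube c' (2 ^ k)"
    unfolding ibox_def mem_Collect_eq
  proof
    fix i show "c' $ i \<le> x $ i \<and> x $ i < c' $ i + int (2 ^ k)"
      using xc[of i] by (auto simp: c'_def)
  qed
  have sub: "icube c' (2 ^ k) \<subseteq> icube c (2 ^ Suc k)"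
  proof
    fix y assume y: "y \<in> icube c' (2 ^ k)"
    have "c $ i \<le> y $ i \<and> y $ i < c $ i + int (2 ^ Suc k)" for i
    proof -
      have "c' $ i \<le> y $ i \<and> y $ i < c' $ i + int (2 ^ k)"
        using y unfolding ibox_def by blast
      moreover have "(0::int) < 2 ^ k" by simp
      ultimately show ?thesis by (auto simp: c'_def split: if_splits)
    qed
    then show "y \<in> icube c (2 ^ Suc k)" by (simp add: ibox_def)
  qed
  have "\<bar>avg \<phi> (icube c' (2 ^ k)) - \<phi> x\<bar> \<le> (\<Sum>j<k. \<delta> j)"
    using Suc sub xin by (intro Suc.IH) auto
  moreover have "\<bar>avg \<phi> (icube c (2 ^ Suc k)) - avg \<phi> (icube c' (2 ^ k))\<bar> \<le> \<delta> k"
  proof -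
    have "\<bar>avg \<phi> (icube c (2 * 2 ^ k)) - avg \<phi> (icube c' (2 ^ k))\<bar>
     \<le> real CARD('d) * (real (2 ^ k) / (2 * real (2 ^ k) ^ CARD('d)) * sum D (icube c (2 * 2 ^ k)))"
      by (rule avg_subcube) (use Suc.prems D0 grad in \<open>auto simp: c'_def subset_iff\<close>)
    also have "\<dots> \<le> \<delta> k" using \<delta>[of c k] Suc.prems by simp
    finally show ?thesis by simp
  qed
  ultimately show ?case by simp
qed

lemma sum_geometric_rev_le:
  fixes r :: real
  assumes "0 < r" "r < 1"
  shows "(\<Sum>j<K. r ^ (K - j)) \<le> r / (1 - r)"
proof (induction K)
  case (Suc K)
  have "(\<Sum>j<Suc K. r ^ (Suc K - j)) = r * (\<Sum>j<K. r ^ (K - j)) + r"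
    by (simp add: sum_distrib_left Suc_diff_le)
  also have "\<dots> \<le> r * (r / (1 - r)) + r"
    using Suc assms by (intro add_right_mono mult_left_mono) auto
  also have "\<dots> = r / (1 - r)" using assms by (simp add: field_simps)
  finally show ?case .
qed (use assms in simp)

text \<open>Stands in for Hoelder's inequality: a first power is split at a threshold
  \<open>t\<close>, and \<open>t\<close> can be chosen anew at every scale.\<close>

lemma le_threshold_powr:
  fixes D t q :: real
  assumes "0 \<le> D" "0 < t" "1 \<le> q"
  shows "D \<le> t + t / t powr q * D powr q"
proof (cases "D \<le> t")
  case True
  then show ?thesis using assms by (simp add: add_increasing2)
next
  case False
  then have D: "t < D" "0 < D" using assms by auto
  have "t / t powr q * D powr q = D * (D / t) powr (q - 1)"
    using D assms by (simp add: powr_divide powr_diff field_simps)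
  moreover have "1 \<le> (D / t) powr (q - 1)" using D assms by (intro ge_one_powr_ge_zero) auto
  ultimately show ?thesis using D assms
    by (smt (verit) mult_le_cancel_left1)
qed

text \<open>The averages over nested dyadic cubes form a chain from the value at a point to the average over
  the whole cube, and for \<open>q\<close> above the dimension the increments of the chain sum geometrically.\<close>

lemma discrete_Morrey:
  fixes q \<eta> :: real
  assumes q: "real CARD('d) < q" and \<eta>: "0 < \<eta>"
  shows "\<exists>\<epsilon>>0. \<forall>K c. \<forall>\<phi> D :: int ^ 'd \<Rightarrow> real.
    (\<forall>y\<in>icube c (2 ^ K). 0 \<le> D y) \<longrightarrow>
    (\<forall>y\<in>icube c (2 ^ K). \<forall>i. \<bar>\<phi> (y + axis i 1) - \<phi> y\<bar> \<le> D y) \<longrightarrow>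
    (\<Sum>y\<in>icube c (2 ^ K). D y powr q) \<le> \<epsilon> * (2 ^ K) ^ CARD('d) \<longrightarrow>
    (\<forall>x\<in>icube c (2 ^ K). \<forall>y\<in>icube c (2 ^ K). \<bar>\<phi> x - \<phi> y\<bar> \<le> \<eta> * 2 ^ K)"
proof -
  define d where "d = CARD('d)"
  have d1: "1 \<le> d" by (simp add: d_def Suc_le_eq)
  have q1: "1 < q" "0 < q" using q d1 unfolding d_def by linarith+
  \<comment> \<open>Since \<open>q\<close> exceeds the dimension, \<open>b < 2\<close>. The
    thresholds \<open>\<tau> * b ^ (K - j)\<close> therefore grow slower towards small cubes than
    \<open>2 ^ (K - j)\<close>, and the gap is the ratio \<open>r = b / 2\<close> of the geometric
    series.\<close>
  define b where "b = (2::real) powr (real d / q)"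
  have b0: "0 < b" by (simp add: b_def)
  have b2: "b < 2" using q q1 by (simp add: b_def d_def powr_less_cancel_iff[of 2 _ 1, simplified])
  have bq: "b powr q = 2 ^ d" using q1 by (simp add: b_def powr_powr powr_realpow)
  define r where "r = b / 2"
  have r: "0 < r" "r < 1" using b0 b2 by (auto simp: r_def)
  \<comment> \<open>\<open>A\<close> collects the constants of the geometric sum. The choice of
    \<open>\<tau>\<close> brings the sum down to half of the allowed oscillation, because each of
    the two points is compared with the average over the cube.\<close>
  define A where "A = real d * (2 ^ d + 1) / 2 * (r / (1 - r))"
  have A0: "0 < A" using d1 r by (auto simp: A_def intro!: mult_pos_pos divide_pos_pos add_pos_pos)
  define \<tau> where "\<tau> = \<eta> / (2 * A)"
  have \<tau>: "0 < \<tau>" using \<eta> A0 by (simp add: \<tau>_def)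
  have main: "\<bar>\<phi> x - \<phi> y\<bar> \<le> \<eta> * 2 ^ K"
    if D0: "\<forall>y\<in>icube c (2 ^ K). 0 \<le> D y"
      and grad: "\<forall>y\<in>icube c (2 ^ K). \<forall>i. \<bar>\<phi> (y + axis i 1) - \<phi> y\<bar> \<le> D y"
      and E: "(\<Sum>y\<in>icube c (2 ^ K). D y powr q) \<le> \<tau> powr q * (2 ^ K) ^ d"
      and x: "x \<in> icube c (2 ^ K)" and y: "y \<in> icube c (2 ^ K)"
    for K and c x y :: "int ^ 'd" and \<phi> D
  proof -
    \<comment> \<open>Balances the two terms of \<open>le_threshold_powr\<close> on a cube of side
      \<open>2 ^ Suc j\<close>: by \<open>E\<close>, each sums to at most a constant times
      \<open>t j * (2 ^ j) ^ d\<close>.\<close>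
    define t where "t j = \<tau> * b ^ (K - j)" for j
    have t0: "0 < t j" for j using \<tau> b0 by (simp add: t_def)
    define \<delta> where "\<delta> j = real d * (2 ^ d + 1) / 2 * \<tau> * 2 ^ K * r ^ (K - j)" for j
    have \<delta>: "real d * (2 ^ j / (2 * (2 ^ j) ^ d) * sum D (icube c' (2 ^ Suc j))) \<le> \<delta> j"
      if sub: "icube c' (2 ^ Suc j) \<subseteq> icube c (2 ^ K)" and j: "j < K" for j c'
    proof -
      have tq: "t j powr q = \<tau> powr q * (2 ^ d) ^ (K - j)"
        using \<tau> b0 by (simp add: t_def powr_mult bq[symmetric] powr_realpow[symmetric] powr_powr mult.commute)
      have pw: "((2::real) ^ K) ^ d = (2 ^ d) ^ (K - j) * (2 ^ j) ^ d"
        using j by (simp add: power_mult[symmetric] power_add[symmetric] algebra_simps)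
      have "sum D (icube c' (2 ^ Suc j)) \<le> (\<Sum>y\<in>icube c' (2 ^ Suc j). t j + t j / t j powr q * D y powr q)"
        using sub D0 t0 q1 by (intro sum_mono le_threshold_powr) auto
      also have "\<dots> = (2 ^ Suc j) ^ d * t j + t j / t j powr q * (\<Sum>y\<in>icube c' (2 ^ Suc j). D y powr q)"
        by (simp add: sum.distrib sum_distrib_left card_icube d_def)
      also have "\<dots> \<le> (2 ^ Suc j) ^ d * t j + t j / t j powr q * (\<tau> powr q * (2 ^ K) ^ d)"
      proof (intro add_left_mono mult_left_mono)
        have "(\<Sum>y\<in>icube c' (2 ^ Suc j). D y powr q) \<le> (\<Sum>y\<in>icube c (2 ^ K). D y powr q)"
          using sub by (intro sum_mono2) auto
        with E show "(\<Sum>y\<in>icube c' (2 ^ Suc j). D y powr q) \<le> \<tau> powr q * (2 ^ K) ^ d" by linarith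
      qed (use t0 in \<open>auto simp: less_imp_le\<close>)
      also have "t j / t j powr q * (\<tau> powr q * (2 ^ K) ^ d) = t j * (2 ^ j) ^ d"
        unfolding tq pw using \<tau> by simp
      also have "(2 ^ Suc j) ^ d * t j + t j * (2 ^ j) ^ d = (2 ^ d + 1) * t j * (2 ^ j) ^ d"
        by (simp add: power_mult_distrib algebra_simps)
      finally have S: "sum D (icube c' (2 ^ Suc j)) \<le> (2 ^ d + 1) * t j * (2 ^ j) ^ d" .
      have "real d * (2 ^ j / (2 * (2 ^ j) ^ d) * sum D (icube c' (2 ^ Suc j)))
        \<le> real d * (2 ^ j / (2 * (2 ^ j) ^ d) * ((2 ^ d + 1) * t j * (2 ^ j) ^ d))"
        by (intro mult_left_mono S) auto
      also have "\<dots> = real d * (2 ^ d + 1) / 2 * (2 ^ j * t j)" by simp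
      also have "2 ^ j * t j = \<tau> * (2 ^ K * r ^ (K - j))"
      proof -
        have "(2::real) ^ K = 2 ^ j * 2 ^ (K - j)" using j by (simp add: power_add[symmetric])
        then show ?thesis by (simp add: t_def r_def power_divide)
      qed
      finally show ?thesis by (simp add: \<delta>_def mult.assoc)
    qed
    have "(\<Sum>j<K. \<delta> j) = real d * (2 ^ d + 1) / 2 * \<tau> * 2 ^ K * (\<Sum>j<K. r ^ (K - j))"
      by (simp add: \<delta>_def sum_distrib_left)
    also have "\<dots> \<le> real d * (2 ^ d + 1) / 2 * \<tau> * 2 ^ K * (r / (1 - r))"
      using \<tau> by (intro mult_left_mono sum_geometric_rev_le r) auto
    also have "\<dots> = A * \<tau> * 2 ^ K" by (simp add: A_def)
    also have "\<dots> = \<eta> / 2 * 2 ^ K" using A0 by (simp add: \<tau>_def)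
    finally have sd: "(\<Sum>j<K. \<delta> j) \<le> \<eta> / 2 * 2 ^ K" .
    have *: "\<bar>avg \<phi> (icube c (2 ^ K)) - \<phi> z\<bar> \<le> (\<Sum>j<K. \<delta> j)" if "z \<in> icube c (2 ^ K)" for z
      by (rule dyadic_chain[where Q = "icube c (2 ^ K)" and D = D and K = K])
        (use D0 grad \<delta> that in \<open>auto simp: d_def[symmetric]\<close>)
    from *[OF x] *[OF y] sd show ?thesis by linarith
  qed
  show ?thesis
    by (rule exI[of _ "\<tau> powr q"]) (use \<tau> main in \<open>auto simp: d_def\<close>)
qed

section \<open>Centred dyadic cubes and a covering bound\<close>

text \<open>Half-open, so that the side is exactly the power \<open>2 ^ Suc n\<close> and a centred
  cube is itself admissible in the Morrey inequality.\<close>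

definition ccube :: "nat \<Rightarrow> (int ^ 'd) set" where
  "ccube n = icube (\<chi> i. - (2 ^ n)) (2 ^ Suc n)"

lemma mem_ccube: "x \<in> ccube n \<longleftrightarrow> (\<forall>i. - (2 ^ n) \<le> x $ i \<and> x $ i < 2 ^ n)"
  by (simp add: ccube_def ibox_def)

lemma finite_ccube [simp, intro]: "finite (ccube n :: (int ^ 'd) set)"
  by (simp add: ccube_def)

lemma zero_mem_ccube: "0 \<in> ccube n"
  by (simp add: mem_ccube)

text \<open>Greedy selection: a point \<open>x0\<close> with a largest cube is removed together with
  all points whose cubes meet that cube. The removed points lie in a cube of side
  \<open>4 * 2 ^ k x0\<close>, so the sum of \<open>f\<close> over the cube of \<open>x0\<close>
  pays for all of them up to the factor \<open>4 ^ CARD('d)\<close>. The remaining cubes are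
  disjoint from it, so the induction hypothesis adds without overlap.\<close>

lemma Vitali_counting:
  fixes f :: "int ^ 'd \<Rightarrow> real"
  assumes f0: "\<And>y. 0 \<le> f y" and s: "0 \<le> s" and "finite X"
    and "\<And>x. x \<in> X \<Longrightarrow> s * (2 ^ k x) ^ CARD('d) \<le> sum f ((+) x ` ccube (k x))"
  shows "s * real (card X) \<le> 4 ^ CARD('d) * sum f (\<Union>x\<in>X. (+) x ` ccube (k x))"
  using assms(3,4)
proof (induction "card X" arbitrary: X rule: less_induct)
  case less
  show ?case
  proof (cases "X = {}")
    case False
    then have "Max (k ` X) \<in> k ` X" using less.prems(1) by (intro Max_in) auto
    then obtain x0 where x0: "x0 \<in> X" and x0_max: "Max (k ` X) = k x0" by auto
    have max: "k x \<le> k x0" if "x \<in> X" for x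
      using that less.prems(1) unfolding x0_max[symmetric] by (intro Max_ge) auto
    define B where "B x = (+) x ` (ccube (k x) :: (int ^ 'd) set)" for x
    define X' where "X' = {x \<in> X. B x \<inter> B x0 \<noteq> {}}"
    define Y where "Y = X - X'"
    have finB: "finite (B x)" for x by (simp add: B_def)
    have B0: "B x0 \<noteq> {}" using zero_mem_ccube by (auto simp: B_def)
    then have x0': "x0 \<in> X'" using x0 by (auto simp: X'_def)
    have cY: "card Y < card X" unfolding Y_def
      using less.prems(1) x0' x0 by (intro psubset_card_mono) auto
    have IH: "s * real (card Y) \<le> 4 ^ CARD('d) * sum f (\<Union>x\<in>Y. B x)"
      unfolding B_def by (rule less.hyps[OF cY]) (use less.prems in \<open>auto simp: Y_def\<close>)
    have "X' \<subseteq> icube (x0 - (\<chi> i. 2 * 2 ^ k x0)) (4 * 2 ^ k x0)"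
    proof
      fix x assume "x \<in> X'"
      then have xX: "x \<in> X" and "B x \<inter> B x0 \<noteq> {}" by (auto simp: X'_def)
      then obtain u v where uv: "x + u = x0 + v" and u: "u \<in> ccube (k x)" and v: "v \<in> ccube (k x0)"
        by (auto simp: B_def)
      have "(x0 - (\<chi> i. 2 * 2 ^ k x0)) $ i \<le> x $ i \<and> x $ i < (x0 - (\<chi> i. 2 * 2 ^ k x0)) $ i + int (4 * 2 ^ k x0)" for i
      proof -
        have "x $ i + u $ i = x0 $ i + v $ i" using uv by (metis vector_add_component)
        moreover have "- (2 ^ k x) \<le> u $ i \<and> u $ i < 2 ^ k x" "- (2 ^ k x0) \<le> v $ i \<and> v $ i < 2 ^ k x0"
          using u v unfolding mem_ccube by blast+
        moreover have "(2::int) ^ k x \<le> 2 ^ k x0" using max[OF xX] by simp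
        ultimately have "x0 $ i - 2 * 2 ^ k x0 \<le> x $ i \<and> x $ i < x0 $ i + 2 * 2 ^ k x0" by linarith
        then show ?thesis by simp
      qed
      then show "x \<in> icube (x0 - (\<chi> i. 2 * 2 ^ k x0)) (4 * 2 ^ k x0)" by (simp add: ibox_def)
    qed
    then have "card X' \<le> (4 * 2 ^ k x0) ^ CARD('d)"
      using card_mono[OF finite_ibox] by (metis card_icube)
    then have "real (card X') \<le> (4 * 2 ^ k x0) ^ CARD('d)"
      using of_nat_mono[of "card X'" "(4 * 2 ^ k x0) ^ CARD('d)", where 'a = real] by simp
    then have "s * real (card X') \<le> s * (4 * 2 ^ k x0) ^ CARD('d)" using s by (intro mult_left_mono)
    also have "\<dots> = 4 ^ CARD('d) * (s * (2 ^ k x0) ^ CARD('d))" by (simp add: power_mult_distrib)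
    also have "\<dots> \<le> 4 ^ CARD('d) * sum f (B x0)"
      using less.prems(2)[OF x0] by (intro mult_left_mono) (auto simp: B_def)
    finally have 2: "s * real (card X') \<le> 4 ^ CARD('d) * sum f (B x0)" .
    have "X = Y \<union> X'" "Y \<inter> X' = {}" by (auto simp: Y_def X'_def)
    then have "card X = card Y + card X'"
      using less.prems(1) by (metis card_Un_disjoint finite_Un)
    then have "s * real (card X) \<le> 4 ^ CARD('d) * (sum f (\<Union>x\<in>Y. B x) + sum f (B x0))"
      using IH 2 by (simp add: algebra_simps)
    also have "sum f (\<Union>x\<in>Y. B x) + sum f (B x0) = sum f ((\<Union>x\<in>Y. B x) \<union> B x0)"
    proof (rule sum.union_disjoint[symmetric])
      show "finite (\<Union>x\<in>Y. B x)" using less.prems(1) finB by (auto simp: Y_def)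
      show "(\<Union>x\<in>Y. B x) \<inter> B x0 = {}" by (auto simp: Y_def X'_def)
    qed (rule finB)
    also have "\<dots> \<le> sum f (\<Union>x\<in>X. B x)"
      using less.prems(1) finB x0 f0 by (intro sum_mono2) (auto simp: Y_def)
    finally show ?thesis by (simp add: B_def mult_left_mono)
  qed simp
qed

section \<open>Near-minimizers of a quadratic functional\<close>

lemma (in prob_space) AE_bounded_integrable:
  fixes f :: "'a \<Rightarrow> real"
  assumes "f \<in> borel_measurable M" "AE \<omega> in M. \<bar>f \<omega>\<bar> \<le> b"
  shows "integrable M f"
  using assms by (intro integrable_const_bound[where B = b]) auto

lemma AE_summable_if_integrals_summable:
  fixes f :: "nat \<Rightarrow> 'a \<Rightarrow> real"
  assumes int: "\<And>j. integrable M (f j)" and pos: "\<And>j \<omega>. 0 \<le> f j \<omega>"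
    and le: "\<And>j. (\<integral>\<omega>. f j \<omega> \<partial>M) \<le> c j" and c: "summable c"
  shows "AE \<omega> in M. summable (\<lambda>j. f j \<omega>)"
proof -
  have c0: "0 \<le> c j" for j
    using le[of j] pos by (meson Bochner_Integration.integral_nonneg order_trans)
  have "(\<integral>\<^sup>+\<omega>. (\<Sum>j. ennreal (f j \<omega>)) \<partial>M) = (\<Sum>j. \<integral>\<^sup>+\<omega>. ennreal (f j \<omega>) \<partial>M)"
    using int by (intro nn_integral_suminf) auto
  also have "\<dots> = (\<Sum>j. ennreal (\<integral>\<omega>. f j \<omega> \<partial>M))"
    using int pos by (simp add: nn_integral_eq_integral)
  also have "\<dots> \<le> (\<Sum>j. ennreal (c j))"
    using le by (intro suminf_le ennreal_leI) auto
  also have "\<dots> = ennreal (suminf c)" using c c0 by (simp add: suminf_ennreal2)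
  also have "\<dots> < \<top>" by simp
  finally have "AE \<omega> in M. (\<Sum>j. ennreal (f j \<omega>)) \<noteq> \<infinity>"
    using int by (intro nn_integral_noteq_infinite) auto
  then show ?thesis
    by eventually_elim (use pos in \<open>auto intro!: summable_suminf_not_top\<close>)
qed

lemma strict_mono_selection:
  assumes "\<And>j. eventually (P j) sequentially"
  shows "\<exists>r::nat \<Rightarrow> nat. strict_mono r \<and> (\<forall>j. P j (r j))"
proof -
  have "\<exists>r. \<forall>j. P j (r j) \<and> r j < r (Suc j)"
  proof (rule dependent_nat_choice)
    show "\<exists>x. P 0 x" using assms[of 0] by (auto simp: eventually_sequentially)
    fix x j
    have "eventually (\<lambda>y. P (Suc j) y \<and> x < y) sequentially"
      using assms eventually_gt_at_top by (rule eventually_conj)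
    then show "\<exists>y. P (Suc j) y \<and> x < y" by (auto simp: eventually_sequentially)
  qed
  then show ?thesis by (auto simp: strict_mono_Suc_iff)
qed

lemma parallelogram_integral:
  fixes Y Z :: "'a \<Rightarrow> 'e \<Rightarrow> real"
  assumes "\<And>e. e \<in> U \<Longrightarrow> integrable M (\<lambda>\<omega>. (Y \<omega> e)\<^sup>2)"
    and "\<And>e. e \<in> U \<Longrightarrow> integrable M (\<lambda>\<omega>. (Z \<omega> e)\<^sup>2)"
    and "\<And>e. e \<in> U \<Longrightarrow> integrable M (\<lambda>\<omega>. Y \<omega> e * Z \<omega> e)"
  shows "(\<integral>\<omega>. (\<Sum>e\<in>U. (Y \<omega> e - Z \<omega> e)\<^sup>2) \<partial>M) = 2 * (\<integral>\<omega>. (\<Sum>e\<in>U. (Y \<omega> e)\<^sup>2) \<partial>M)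
    + 2 * (\<integral>\<omega>. (\<Sum>e\<in>U. (Z \<omega> e)\<^sup>2) \<partial>M) - 4 * (\<integral>\<omega>. (\<Sum>e\<in>U. ((Y \<omega> e + Z \<omega> e) / 2)\<^sup>2) \<partial>M)"
proof -
  define A where "A = (\<lambda>\<omega>. \<Sum>e\<in>U. (Y \<omega> e)\<^sup>2)"
  define B where "B = (\<lambda>\<omega>. \<Sum>e\<in>U. (Z \<omega> e)\<^sup>2)"
  define P where "P = (\<lambda>\<omega>. \<Sum>e\<in>U. Y \<omega> e * Z \<omega> e)"
  have i: "integrable M A" "integrable M B" "integrable M P"
    unfolding A_def B_def P_def by (auto intro!: Bochner_Integration.integrable_sum assms)
  have 1: "(\<lambda>\<omega>. \<Sum>e\<in>U. (Y \<omega> e - Z \<omega> e)\<^sup>2) = (\<lambda>\<omega>. A \<omega> + B \<omega> - 2 * P \<omega>)"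
    by (simp add: A_def B_def P_def power2_diff sum.distrib sum_subtractf sum_distrib_left mult.assoc)
  have 2: "(\<lambda>\<omega>. \<Sum>e\<in>U. ((Y \<omega> e + Z \<omega> e) / 2)\<^sup>2) = (\<lambda>\<omega>. (A \<omega> + B \<omega> + 2 * P \<omega>) / 4)"
    by (simp add: A_def B_def P_def power2_sum power_divide sum.distrib sum_distrib_left mult.assoc
        sum_divide_distrib[symmetric])
  show ?thesis unfolding 1 2 A_def[symmetric] B_def[symmetric] using i by (simp add: field_simps)
qed

text \<open>Near-minimizers of a quadratic functional on a midpoint-convex set are close to each other by
  the parallelogram identity; along a decreasing sequence of such sets the infima increase to a
  finite limit, so suitable near-minimizers form a Cauchy sequence.\<close>

lemma (in prob_space) near_minimizers_converge:
  fixes C :: "nat \<Rightarrow> ('a \<Rightarrow> 'e \<Rightarrow> real) set" and U :: "'e set"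
  defines "Q \<equiv> \<lambda>Y. \<integral>\<omega>. (\<Sum>e\<in>U. (Y \<omega> e)\<^sup>2) \<partial>M"
  assumes U: "finite U"
    and ne: "\<And>k. C k \<noteq> {}" and dec: "decseq C"
    and meas: "\<And>k Y e. Y \<in> C k \<Longrightarrow> e \<in> U \<Longrightarrow> (\<lambda>\<omega>. Y \<omega> e) \<in> borel_measurable M"
    and bd: "\<And>k Y e. Y \<in> C k \<Longrightarrow> e \<in> U \<Longrightarrow> AE \<omega> in M. \<bar>Y \<omega> e\<bar> \<le> b"
    and mid: "\<And>k Y Z. Y \<in> C k \<Longrightarrow> Z \<in> C k \<Longrightarrow> (\<lambda>\<omega> e. (Y \<omega> e + Z \<omega> e) / 2) \<in> C k"
  shows "\<exists>Y r. strict_mono (r :: nat \<Rightarrow> nat) \<and>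
    (\<forall>k. Y k \<in> C (r k) \<and> (\<forall>Z\<in>C (r k). Q (Y k) \<le> Q Z + 1 / 4 ^ k)) \<and>
    (\<forall>e\<in>U. AE \<omega> in M. convergent (\<lambda>k. Y k \<omega> e))"
proof -
  have intprod: "integrable M (\<lambda>\<omega>. Y \<omega> e * Z \<omega> e)" if "Y \<in> C k" "Z \<in> C l" "e \<in> U" for Y Z k l e
  proof (rule AE_bounded_integrable)
    show "(\<lambda>\<omega>. Y \<omega> e * Z \<omega> e) \<in> borel_measurable M"
      using meas[OF that(1,3)] meas[OF that(2,3)] by measurable
    show "AE \<omega> in M. \<bar>Y \<omega> e * Z \<omega> e\<bar> \<le> b * b"
      using bd[OF that(1,3)] bd[OF that(2,3)]
      by eventually_elim (auto simp: abs_mult intro!: mult_mono)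
  qed
  have intsq: "integrable M (\<lambda>\<omega>. (Y \<omega> e)\<^sup>2)" if "Y \<in> C k" "e \<in> U" for Y k e
    using intprod[OF that(1,1,2)] by (simp add: power2_eq_square)
  have Q0: "0 \<le> Q Y" for Y unfolding Q_def by (intro Bochner_Integration.integral_nonneg sum_nonneg) auto
  have Qb: "Q Y \<le> real (card U) * b\<^sup>2" if Y: "Y \<in> C k" for Y k
  proof -
    have "Q Y = (\<Sum>e\<in>U. \<integral>\<omega>. (Y \<omega> e)\<^sup>2 \<partial>M)" unfolding Q_def
      by (rule Bochner_Integration.integral_sum) (use intsq[OF Y] in auto)
    also have "\<dots> \<le> (\<Sum>e\<in>U. b\<^sup>2)"
    proof (rule sum_mono)
      fix e assume e: "e \<in> U"
      have "(\<integral>\<omega>. (Y \<omega> e)\<^sup>2 \<partial>M) \<le> (\<integral>\<omega>. b\<^sup>2 \<partial>M)"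
      proof (rule integral_mono_AE[OF intsq[OF Y e]])
        show "AE \<omega> in M. (Y \<omega> e)\<^sup>2 \<le> b\<^sup>2"
          using bd[OF Y e] by eventually_elim (metis abs_ge_zero power2_abs power_mono)
      qed simp
      then show "(\<integral>\<omega>. (Y \<omega> e)\<^sup>2 \<partial>M) \<le> b\<^sup>2" by (simp add: prob_space)
    qed
    finally show ?thesis by simp
  qed
  define q where "q k = (INF Y\<in>C k. Q Y)" for k
  have bdd: "bdd_below (Q ` C k)" for k using Q0 by (auto intro!: bdd_belowI[of _ 0])
  have q_le: "q k \<le> Q Y" if "Y \<in> C k" for k Y
    unfolding q_def using bdd that by (rule cINF_lower)
  have mono: "C l \<subseteq> C k" if "k \<le> l" for k l using dec that by (auto simp: decseq_def)
  have incq: "incseq q"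
    unfolding incseq_def q_def
    using ne bdd subsetD[OF mono] by (intro allI impI cINF_superset_mono) auto
  have qb: "q k \<le> real (card U) * b\<^sup>2" for k
    using ne[of k] q_le Qb by (meson all_not_in_conv order_trans)
  obtain L where L: "q \<longlonglongrightarrow> L" "\<And>k. q k \<le> L"
    using incseq_convergent[OF incq, of "real (card U) * b\<^sup>2"] qb by auto
  have "\<exists>Y. Y \<in> C k \<and> Q Y < q k + 1 / 4 ^ k" for k
  proof -
    have "\<exists>Y\<in>C k. Q Y < q k + 1 / 4 ^ k"
      using cINF_less_iff[OF ne bdd, of k "q k + 1 / 4 ^ k"] by (simp add: q_def)
    then show ?thesis by blast
  qed
  then obtain W where W: "\<And>k. W k \<in> C k" and QW: "\<And>k. Q (W k) < q k + 1 / 4 ^ k" by metis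
  have para: "Q (\<lambda>\<omega> e. W k \<omega> e - W l \<omega> e) = 2 * Q (W k) + 2 * Q (W l) - 4 * Q (\<lambda>\<omega> e. (W k \<omega> e + W l \<omega> e) / 2)" for k l
    unfolding Q_def by (rule parallelogram_integral) (auto intro: intsq[OF W] intprod[OF W W])
  \<comment> \<open>The larger index belongs to the smaller set, so the midpoint lies in
    \<open>C k\<close> and its functional is at least \<open>q k\<close>. What the parallelogram
    identity leaves is the remaining increase \<open>L - q k\<close> of the infima and the
    near-minimality errors.\<close>
  have close: "Q (\<lambda>\<omega> e. W k \<omega> e - W l \<omega> e) \<le> 2 * (L - q k) + 4 / 4 ^ k" if "k \<le> l" for k l
  proof -
    have "q k \<le> Q (\<lambda>\<omega> e. (W k \<omega> e + W l \<omega> e) / 2)"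
      using W mono[OF that] by (intro q_le mid) auto
    moreover have "(1::real) / 4 ^ l \<le> 1 / 4 ^ k" using that by (simp add: frac_le)
    ultimately show ?thesis unfolding para using QW[of k] QW[of l] L(2)[of l] L(2)[of k] by simp
  qed
  \<comment> \<open>Indices so late that both the remaining increase of the infima and the
    near-minimality error are at most \<open>1 / 4 ^ j\<close>.\<close>
  have "eventually (\<lambda>k. j \<le> k \<and> L - q k \<le> 1 / 4 ^ j) sequentially" for j
  proof -
    have "eventually (\<lambda>k. L - 1 / 4 ^ j < q k) sequentially"
      using L(1) by (rule order_tendstoD) simp
    with eventually_ge_at_top[of j] show ?thesis by eventually_elim auto
  qed
  from strict_mono_selection[of "\<lambda>j k. j \<le> k \<and> L - q k \<le> 1 / 4 ^ j", OF this]
  obtain r where r: "strict_mono r" and rj: "\<And>j. j \<le> r j" "\<And>j. L - q (r j) \<le> 1 / 4 ^ j"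
    by auto
  have "AE \<omega> in M. convergent (\<lambda>k. W (r k) \<omega> e)" if e: "e \<in> U" for e
  proof -
    define f where "f j \<omega> = \<bar>W (r (Suc j)) \<omega> e - W (r j) \<omega> e\<bar>" for j \<omega>
    have dsq: "integrable M (\<lambda>\<omega>. (W k \<omega> e' - W l \<omega> e')\<^sup>2)" if "e' \<in> U" for k l e'
      unfolding power2_diff using that
      by (intro Bochner_Integration.integrable_diff Bochner_Integration.integrable_add
          intsq[OF W]) (auto simp: mult.assoc intro!: intprod[OF W W])
    have fm: "f j \<in> borel_measurable M" for j
      using meas[OF W e] unfolding f_def by measurable
    have fi: "integrable M (f j)" for j
    proof (rule AE_bounded_integrable[OF fm])
      show "AE \<omega> in M. \<bar>f j \<omega>\<bar> \<le> b + b"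
        using bd[OF W[of "r j"] e] bd[OF W[of "r (Suc j)"] e] by eventually_elim (auto simp: f_def)
    qed
    have "AE \<omega> in M. summable (\<lambda>j. f j \<omega>)"
    proof (rule AE_summable_if_integrals_summable[OF fi])
      show "0 \<le> f j \<omega>" for j \<omega> by (simp add: f_def)
      show "summable (\<lambda>j. 4 * (1 / 2) ^ j :: real)" by (intro summable_mult summable_geometric) simp
      fix j
      have "(\<integral>\<omega>. (f j \<omega>)\<^sup>2 \<partial>M) \<le> Q (\<lambda>\<omega> e. W (r j) \<omega> e - W (r (Suc j)) \<omega> e)"
        unfolding Q_def
      proof (rule integral_mono)
        show "integrable M (\<lambda>\<omega>. (f j \<omega>)\<^sup>2)" unfolding f_def power2_abs by (rule dsq[OF e])
        show "integrable M (\<lambda>\<omega>. \<Sum>e\<in>U. (W (r j) \<omega> e - W (r (Suc j)) \<omega> e)\<^sup>2)"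
          by (intro Bochner_Integration.integrable_sum dsq)
        fix \<omega>
        have "(f j \<omega>)\<^sup>2 = (W (r j) \<omega> e - W (r (Suc j)) \<omega> e)\<^sup>2"
          unfolding f_def power2_abs by (rule power2_commute)
        also have "\<dots> \<le> (\<Sum>e\<in>U. (W (r j) \<omega> e - W (r (Suc j)) \<omega> e)\<^sup>2)"
          using U e by (intro member_le_sum) auto
        finally show "(f j \<omega>)\<^sup>2 \<le> (\<Sum>e\<in>U. (W (r j) \<omega> e - W (r (Suc j)) \<omega> e)\<^sup>2)" .
      qed
      also have "\<dots> \<le> 2 * (L - q (r j)) + 4 / 4 ^ r j"
        using r by (intro close) (simp add: strict_mono_less_eq)
      also have "\<dots> \<le> 6 / 4 ^ j"
      proof -
        have "(1::real) / 4 ^ r j \<le> 1 / 4 ^ j" using rj(1) by (simp add: frac_le)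
        then show ?thesis using rj(2)[of j] by simp
      qed
      finally have sq: "(\<integral>\<omega>. (f j \<omega>)\<^sup>2 \<partial>M) \<le> 6 / 4 ^ j" .
      have fsq: "integrable M (\<lambda>\<omega>. (f j \<omega>)\<^sup>2)" unfolding f_def power2_abs by (rule dsq[OF e])
      \<comment> \<open>The inequality \<open>2 x <= 2^j x^2 + 1 / 2^j\<close> turns a second moment
        of order \<open>4^(-j)\<close> into a first moment of order \<open>2^(-j)\<close>, which is
        summable.\<close>
      have "(\<integral>\<omega>. f j \<omega> \<partial>M) \<le> (\<integral>\<omega>. (2 ^ j * (f j \<omega>)\<^sup>2 + 1 / 2 ^ j) / 2 \<partial>M)"
      proof (rule integral_mono[OF fi])
        show "integrable M (\<lambda>\<omega>. (2 ^ j * (f j \<omega>)\<^sup>2 + 1 / 2 ^ j) / 2)" using fsq by simp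
        fix \<omega>
        have "0 \<le> (2 ^ j * f j \<omega> - 1)\<^sup>2 / 2 ^ j" by simp
        also have "\<dots> = 2 ^ j * (f j \<omega>)\<^sup>2 - 2 * f j \<omega> + 1 / 2 ^ j"
          by (simp add: power2_diff field_simps power2_eq_square)
        finally show "f j \<omega> \<le> (2 ^ j * (f j \<omega>)\<^sup>2 + 1 / 2 ^ j) / 2" by simp
      qed
      also have "\<dots> = (2 ^ j * (\<integral>\<omega>. (f j \<omega>)\<^sup>2 \<partial>M) + 1 / 2 ^ j) / 2"
        using fsq by (simp add: prob_space)
      also have "\<dots> \<le> (2 ^ j * (6 / 4 ^ j) + 1 / 2 ^ j) / 2"
        by (intro divide_right_mono add_right_mono mult_left_mono sq) auto
      also have "\<dots> = 7 / 2 * (1 / 2) ^ j"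
      proof -
        have "(4::real) ^ j = 2 ^ j * 2 ^ j" by (simp add: power_mult_distrib[symmetric])
        then show ?thesis by (simp add: field_simps)
      qed
      also have "\<dots> \<le> 4 * (1 / 2) ^ j" by simp
      finally show "(\<integral>\<omega>. f j \<omega> \<partial>M) \<le> 4 * (1 / 2) ^ j" .
    qed
    then show ?thesis
    proof eventually_elim
      case (elim \<omega>)
      then have "summable (\<lambda>j. W (r (Suc j)) \<omega> e - W (r j) \<omega> e)"
        unfolding f_def by (rule summable_rabs_cancel)
      then have "convergent (\<lambda>n. \<Sum>j<n. W (r (Suc j)) \<omega> e - W (r j) \<omega> e)"
        by (simp add: summable_iff_convergent)
      then have "convergent (\<lambda>n. W (r n) \<omega> e - W (r 0) \<omega> e)"
        using sum_lessThan_telescope[of "\<lambda>j. W (r j) \<omega> e"] by simp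
      then obtain l where "(\<lambda>n. W (r n) \<omega> e - W (r 0) \<omega> e) \<longlonglongrightarrow> l"
        by (auto simp: convergent_def)
      from tendsto_add[OF this tendsto_const[of "W (r 0) \<omega> e"]]
      show ?case by (auto simp: convergent_def)
    qed
  qed
  moreover have "Q (W (r k)) \<le> Q Z + 1 / 4 ^ k" if "Z \<in> C (r k)" for k Z
  proof -
    have "(1::real) / 4 ^ r k \<le> 1 / 4 ^ k" using rj(1) by (simp add: frac_le)
    then show ?thesis using QW[of "r k"] q_le[OF that] by linarith
  qed
  ultimately show ?thesis using r W by (intro exI[of _ "\<lambda>k. W (r k)"] exI[of _ r]) auto
qed

section \<open>Ergodic lattice actions\<close>

lemma l1norm_axis: "l1norm (axis i a) = \<bar>a\<bar>"
  unfolding l1norm_def by (subst sum.remove[of _ i]) (auto simp: axis_nth' intro!: sum.neutral)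

lemma axis_in_unit_steps [simp, intro]: "axis i 1 \<in> unit_steps" "axis i (-1) \<in> unit_steps"
  by (simp_all add: unit_steps_def l1norm_axis)

lemma abs_nth_le_l1norm: "\<bar>x $ i\<bar> \<le> l1norm x"
  unfolding l1norm_def by (rule member_le_sum) auto

lemma finite_unit_steps [simp, intro]: "finite (unit_steps :: (int ^ 'd) set)"
proof (rule finite_subset)
  show "(unit_steps :: (int ^ 'd) set) \<subseteq> icube (\<chi> i. - (1::int)) 3"
  proof
    fix e :: "int ^ 'd" assume "e \<in> unit_steps"
    then have "\<bar>e $ i\<bar> \<le> 1" for i using abs_nth_le_l1norm[of e i] by (simp add: unit_steps_def)
    then have "- 1 \<le> e $ i \<and> e $ i < 2" for i by (smt (verit))
    then show "e \<in> icube (\<chi> i. - (1::int)) 3" by (simp add: ibox_def)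
  qed
qed simp

lemma unit_steps_nonempty: "unit_steps \<noteq> {}"
  using axis_in_unit_steps by blast

lemma uminus_unit_steps: "e \<in> unit_steps \<Longrightarrow> - e \<in> unit_steps"
  by (simp add: unit_steps_def l1norm_def)

lemma exists_lattice_path: "\<exists>es. set es \<subseteq> unit_steps \<and> sum_list es = (x :: int ^ 'd)"
proof (induction "nat (l1norm x)" arbitrary: x rule: less_induct)
  case less
  show ?case
  proof (cases "x = 0")
    case True
    then show ?thesis by (intro exI[of _ "[]"]) auto
  next
    case False
    then obtain i where i: "x $ i \<noteq> 0" by (auto simp: vec_eq_iff)
    define e where "e = axis i (sgn (x $ i))"
    have e: "e \<in> unit_steps" using i by (simp add: e_def unit_steps_def l1norm_axis abs_sgn_eq)
    have "l1norm (x - e) = l1norm x - 1"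
      unfolding l1norm_def
      using i by (simp add: sum.remove[of UNIV i] e_def axis_nth' sgn_if)
    moreover have "0 < l1norm x" using i abs_nth_le_l1norm[of x i] by linarith
    ultimately obtain es where "set es \<subseteq> unit_steps" "sum_list es = x - e"
      using less[of "x - e"] by auto
    then show ?thesis using e by (intro exI[of _ "e # es"]) auto
  qed
qed

locale ergodic_lattice_action = prob_space M for M :: "'w measure" +
  fixes T :: "int ^ 'd \<Rightarrow> 'w \<Rightarrow> 'w"
  assumes T_mp: "e \<in> unit_steps \<Longrightarrow> measure_preserving M (T e)"
    and T_zero: "\<omega> \<in> space M \<Longrightarrow> T 0 \<omega> = \<omega>"
    and T_add: "\<omega> \<in> space M \<Longrightarrow> T (x + y) \<omega> = T x (T y \<omega>)"
    and ergodic: "A \<in> sets M \<Longrightarrow> (\<forall>e\<in>unit_steps. T e -` A \<inter> space M = A) \<Longrightarrow> prob A = 0 \<or> prob A = 1"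
begin

lemma measure_preserving_T: "measure_preserving M (T x)"
proof -
  obtain es where "set es \<subseteq> unit_steps" "sum_list es = x" using exists_lattice_path by blast
  then show ?thesis
  proof (induction es arbitrary: x)
    case Nil
    have "T 0 \<in> M \<rightarrow>\<^sub>M M"
      using measurable_cong[of M "T 0" "\<lambda>\<omega>. \<omega>" M] T_zero by simp
    moreover have "distr M M (T 0) = distr M M (\<lambda>\<omega>. \<omega>)"
      by (rule distr_cong) (auto simp: T_zero)
    ultimately show ?case using Nil by (simp add: measure_preserving_def)
  next
    case (Cons e es)
    define y where "y = sum_list es"
    have y: "measure_preserving M (T y)" using Cons by (auto simp: y_def)
    have e: "measure_preserving M (T e)" using Cons T_mp by auto
    have eq: "T x \<omega> = T e (T y \<omega>)" if "\<omega> \<in> space M" for \<omega>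
      using T_add[OF that, of e y] Cons by (simp add: y_def)
    have m: "(\<lambda>\<omega>. T e (T y \<omega>)) \<in> M \<rightarrow>\<^sub>M M"
      using e y by (auto simp: measure_preserving_def)
    have "T x \<in> M \<rightarrow>\<^sub>M M" by (subst measurable_cong[OF eq]) (auto intro: m)
    moreover have "distr M M (T x) = M"
    proof -
      have "distr M M (T x) = distr M M (T e \<circ> T y)" by (rule distr_cong) (auto simp: eq)
      also have "\<dots> = distr (distr M M (T y)) M (T e)"
        using e y by (subst distr_distr) (auto simp: measure_preserving_def)
      finally show ?thesis using e y by (simp add: measure_preserving_def)
    qed
    ultimately show ?case by (simp add: measure_preserving_def)
  qed
qed

lemma T_measurable [measurable]: "T x \<in> M \<rightarrow>\<^sub>M M"
  and distr_T: "distr M M (T x) = M"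
  using measure_preserving_T by (auto simp: measure_preserving_def)

lemma T_space: "\<omega> \<in> space M \<Longrightarrow> T x \<omega> \<in> space M"
  using T_measurable by (rule measurable_space)

lemma AE_T: "AE \<omega> in M. P \<omega> \<Longrightarrow> AE \<omega> in M. P (T x \<omega>)"
  using AE_distrD[OF T_measurable[of x], of P] unfolding distr_T .

lemma AE_T_all:
  assumes "AE \<omega> in M. P \<omega>"
  shows "AE \<omega> in M. \<forall>x. P (T x \<omega>)"
  using AE_T[OF assms] by (simp add: AE_all_countable)

lemma integral_T:
  fixes f :: "'w \<Rightarrow> real"
  assumes "f \<in> borel_measurable M"
  shows "(\<integral>\<omega>. f (T x \<omega>) \<partial>M) = (\<integral>\<omega>. f \<omega> \<partial>M)"
  using integral_distr[OF T_measurable[of x] assms] distr_T by simp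

lemma integrable_T:
  fixes f :: "'w \<Rightarrow> real"
  assumes "integrable M f"
  shows "integrable M (\<lambda>\<omega>. f (T x \<omega>))"
  using integrable_distr[OF T_measurable[of x], of f] distr_T assms by simp

section \<open>Zero-one law and constancy of invariant functions\<close>

text \<open>Meant for events such as \<open>steep t\<close>, whose invariance rests on the almost
  sure positivity of the transition probabilities and so holds only up to null sets.\<close>

lemma prob_AE_invariant:
  assumes A: "A \<in> sets M"
    and inv: "\<And>e. e \<in> unit_steps \<Longrightarrow> AE \<omega> in M. T e \<omega> \<in> A \<longleftrightarrow> \<omega> \<in> A"
  shows "(AE \<omega> in M. \<omega> \<in> A) \<or> (AE \<omega> in M. \<omega> \<notin> A)"
proof -
  \<comment> \<open>\<open>ergodic\<close> speaks of strictly invariant events only, so pass to the largest one inside \<open>A\<close>.\<close>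
  define A' where "A' = {\<omega> \<in> space M. \<forall>x. T x \<omega> \<in> A}"
  have A'm: "A' \<in> sets M"
  proof -
    have "A' = (\<Inter>x\<in>UNIV. T x -` A \<inter> space M)" by (auto simp: A'_def)
    also have "\<dots> \<in> sets M"
      using A by (intro sets.countable_INT') (auto intro: measurable_sets[OF T_measurable])
    finally show ?thesis .
  qed
  have "T e -` A' \<inter> space M = A'" for e
  proof (intro set_eqI iffI)
    fix \<omega> assume "\<omega> \<in> T e -` A' \<inter> space M"
    then have sp: "\<omega> \<in> space M" and *: "\<And>x. T (x + e) \<omega> \<in> A" by (auto simp: A'_def T_add)
    have "T x \<omega> \<in> A" for x using *[of "x - e"] by simp
    then show "\<omega> \<in> A'" using sp by (simp add: A'_def)
  next
    fix \<omega> assume "\<omega> \<in> A'"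
    then show "\<omega> \<in> T e -` A' \<inter> space M"
      by (auto simp: A'_def T_space T_add[symmetric])
  qed
  with ergodic[OF A'm] have "prob A' = 0 \<or> prob A' = 1" by blast
  moreover have "AE \<omega> in M. \<omega> \<in> A' \<longleftrightarrow> \<omega> \<in> A"
  proof -
    have "AE \<omega> in M. \<forall>e\<in>unit_steps. T e \<omega> \<in> A \<longleftrightarrow> \<omega> \<in> A"
      using inv by (intro AE_finite_allI) auto
    from AE_T_all[OF this] AE_space show ?thesis
    proof eventually_elim
      case (elim \<omega>)
      have "T (sum_list es) \<omega> \<in> A \<longleftrightarrow> \<omega> \<in> A" if "set es \<subseteq> unit_steps" for es
        using that
      proof (induction es)
        case (Cons e es)
        have "T (sum_list (e # es)) \<omega> \<in> A \<longleftrightarrow> T e (T (sum_list es) \<omega>) \<in> A"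
          using elim by (simp add: T_add)
        also have "\<dots> \<longleftrightarrow> T (sum_list es) \<omega> \<in> A" using elim Cons by auto
        finally show ?case using Cons by auto
      qed (use elim T_zero in simp)
      then have "T x \<omega> \<in> A \<longleftrightarrow> \<omega> \<in> A" for x using exists_lattice_path[of x] by metis
      then show ?case using elim by (auto simp: A'_def)
    qed
  qed
  ultimately show ?thesis
  proof (elim disjE)
    assume eq: "AE \<omega> in M. \<omega> \<in> A' \<longleftrightarrow> \<omega> \<in> A" and "prob A' = 1"
    then have "AE \<omega> in M. \<omega> \<in> A'" using A'm by (simp add: AE_in_set_eq_1)
    with eq have "AE \<omega> in M. \<omega> \<in> A" by eventually_elim simp
    then show ?thesis by simp
  next
    assume eq: "AE \<omega> in M. \<omega> \<in> A' \<longleftrightarrow> \<omega> \<in> A" and "prob A' = 0"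
    then have "AE \<omega> in M. \<omega> \<notin> A'"
      using A'm by (intro AE_not_in) (auto simp: null_sets_def emeasure_eq_measure)
    with eq have "AE \<omega> in M. \<omega> \<notin> A" by eventually_elim simp
    then show ?thesis by simp
  qed
qed

text \<open>The set where \<open>f\<close> lies below its mean is almost invariant, hence null or of
  full measure. In either case \<open>f\<close> minus its mean has one sign and integral
  zero.\<close>

lemma AE_invariant_eq_mean:
  fixes f :: "'w \<Rightarrow> real"
  assumes f: "integrable M f"
    and inv: "\<And>e. e \<in> unit_steps \<Longrightarrow> AE \<omega> in M. f (T e \<omega>) = f \<omega>"
  shows "AE \<omega> in M. f \<omega> = (\<integral>\<omega>. f \<omega> \<partial>M)"
proof -
  define m where "m = (\<integral>\<omega>. f \<omega> \<partial>M)"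
  have [measurable]: "f \<in> borel_measurable M" using f by auto
  define A where "A = {\<omega> \<in> space M. f \<omega> < m}"
  have "A \<in> sets M" unfolding A_def by measurable
  moreover have "AE \<omega> in M. T e \<omega> \<in> A \<longleftrightarrow> \<omega> \<in> A" if "e \<in> unit_steps" for e
    using inv[OF that] AE_space by eventually_elim (auto simp: A_def T_space)
  ultimately consider "AE \<omega> in M. \<omega> \<in> A" | "AE \<omega> in M. \<omega> \<notin> A"
    using prob_AE_invariant by blast
  then show ?thesis unfolding m_def[symmetric]
  proof cases
    case 1
    then have "AE \<omega> in M. 0 \<le> m - f \<omega>" by eventually_elim (auto simp: A_def)
    moreover have "(\<integral>\<omega>. m - f \<omega> \<partial>M) = 0" using f by (simp add: m_def prob_space)
    ultimately have "AE \<omega> in M. m - f \<omega> = 0"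
      using f by (subst (asm) integral_nonneg_eq_0_iff_AE) auto
    then show "AE \<omega> in M. f \<omega> = m" by eventually_elim simp
  next
    case 2
    with AE_space have "AE \<omega> in M. 0 \<le> f \<omega> - m" by eventually_elim (auto simp: A_def)
    moreover have "(\<integral>\<omega>. f \<omega> - m \<partial>M) = 0" using f by (simp add: m_def prob_space)
    ultimately have "AE \<omega> in M. f \<omega> - m = 0"
      using f by (subst (asm) integral_nonneg_eq_0_iff_AE) auto
    then show "AE \<omega> in M. f \<omega> = m" by eventually_elim simp
  qed
qed

text \<open>By transference: the Vitali counting bound is applied along the orbit, to the good points of a
  cube as large as the largest scale, and integrated.\<close>

lemma maximal_inequality_upto:
  fixes f :: "'w \<Rightarrow> real"
  assumes f: "integrable M f" and f0: "\<And>\<omega>. 0 \<le> f \<omega>" and s: "0 < s"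
  shows "prob {\<omega> \<in> space M. \<exists>k\<le>K. s * (2 ^ k) ^ CARD('d) \<le> (\<Sum>y\<in>ccube k. f (T y \<omega>))}
    \<le> 12 ^ CARD('d) * (\<integral>\<omega>. f \<omega> \<partial>M) / s"
proof -
  have [measurable]: "f \<in> borel_measurable M" using f by auto
  define E where "E = {\<omega> \<in> space M. \<exists>k\<le>K. s * (2 ^ k) ^ CARD('d) \<le> (\<Sum>y\<in>ccube k. f (T y \<omega>))}"
  have E[measurable]: "E \<in> sets M" unfolding E_def by measurable
  \<comment> \<open>\<open>Q\<close> holds the base points, and \<open>R\<close> extends it by
    \<open>2 ^ K\<close> on every side, enough for all cubes of scale at most \<open>K\<close>
    centred in \<open>Q\<close>. The ratio \<open>3 ^ CARD('d)\<close> of their sizes and the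
    covering factor \<open>4 ^ CARD('d)\<close> combine to a constant independent of
    \<open>K\<close>.\<close>
  define Q where "Q = icube (0 :: int ^ 'd) (2 ^ K)"
  define R where "R = icube ((\<chi> i. - (2 ^ K)) :: int ^ 'd) (3 * 2 ^ K)"
  have pt: "s * (\<Sum>x\<in>Q. indicator E (T x \<omega>)) \<le> 4 ^ CARD('d) * (\<Sum>y\<in>R. f (T y \<omega>))"
    if \<omega>: "\<omega> \<in> space M" for \<omega>
  proof -
    define X where "X = {x \<in> Q. T x \<omega> \<in> E}"
    have finX: "finite X" by (simp add: X_def Q_def)
    have "\<exists>k\<le>K. s * (2 ^ k) ^ CARD('d) \<le> (\<Sum>y\<in>(+) x ` ccube k. f (T y \<omega>))" if xX: "x \<in> X" for x
    proof -
      obtain k where k: "k \<le> K" "s * (2 ^ k) ^ CARD('d) \<le> (\<Sum>y\<in>ccube k. f (T y (T x \<omega>)))"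
        using xX by (auto simp: X_def E_def)
      have "(\<Sum>y\<in>ccube k. f (T y (T x \<omega>))) = (\<Sum>y\<in>(+) x ` ccube k. f (T y \<omega>))"
        by (subst sum.reindex) (auto simp: T_add[OF \<omega>, symmetric] add.commute)
      with k show ?thesis by auto
    qed
    then have "\<forall>x\<in>X. \<exists>k. k \<le> K \<and> s * (2 ^ k) ^ CARD('d) \<le> (\<Sum>y\<in>(+) x ` ccube k. f (T y \<omega>))" by blast
    then obtain k where k: "\<And>x. x \<in> X \<Longrightarrow> k x \<le> K"
      "\<And>x. x \<in> X \<Longrightarrow> s * (2 ^ k x) ^ CARD('d) \<le> (\<Sum>y\<in>(+) x ` ccube (k x). f (T y \<omega>))"
      unfolding bchoice_iff by auto
    have "s * real (card X) \<le> 4 ^ CARD('d) * (\<Sum>y\<in>(\<Union>x\<in>X. (+) x ` ccube (k x)). f (T y \<omega>))"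
      using s f0 finX k(2) by (intro Vitali_counting) auto
    also have "\<dots> \<le> 4 ^ CARD('d) * (\<Sum>y\<in>R. f (T y \<omega>))"
    proof (intro mult_left_mono sum_mono2)
      show "(\<Union>x\<in>X. (+) x ` ccube (k x)) \<subseteq> R"
      proof
        fix y assume "y \<in> (\<Union>x\<in>X. (+) x ` ccube (k x))"
        then obtain x u where x: "x \<in> X" and u: "u \<in> ccube (k x)" and y: "y = x + u" by auto
        have "- (2 ^ K) \<le> y $ i \<and> y $ i < - (2 ^ K) + int (3 * 2 ^ K)" for i
        proof -
          have "0 \<le> x $ i \<and> x $ i < 2 ^ K" using x by (simp add: X_def Q_def ibox_def)
          moreover have "- (2 ^ k x) \<le> u $ i \<and> u $ i < 2 ^ k x" using u unfolding mem_ccube by blast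
          moreover have "(2::int) ^ k x \<le> 2 ^ K" using k(1)[OF x] by simp
          ultimately have "- (2 ^ K) \<le> x $ i + u $ i \<and> x $ i + u $ i < - (2 ^ K) + 3 * 2 ^ K" by linarith
          then show ?thesis by (simp add: y)
        qed
        then show "y \<in> R" by (simp add: R_def ibox_def)
      qed
    qed (auto simp: R_def f0)
    also have "real (card X) = (\<Sum>x\<in>Q. indicator E (T x \<omega>))"
    proof -
      have "(\<Sum>x\<in>Q. indicator E (T x \<omega>)) = (\<Sum>x\<in>X. 1::real)"
        unfolding X_def by (rule sum.mono_neutral_cong_right) (auto simp: Q_def)
      then show ?thesis by simp
    qed
    finally show ?thesis .
  qed
  have iE: "integrable M (\<lambda>\<omega>. indicator E \<omega> :: real)" by (simp add: emeasure_eq_measure)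
  have "s * ((2 ^ K) ^ CARD('d) * prob E) = (\<integral>\<omega>. s * (\<Sum>x\<in>Q. indicator E (T x \<omega>)) \<partial>M)"
    using integrable_T[OF iE] integral_T[of "\<lambda>\<omega>. indicator E \<omega>"]
    by (simp add: Q_def card_icube)
  also have "\<dots> \<le> (\<integral>\<omega>. 4 ^ CARD('d) * (\<Sum>y\<in>R. f (T y \<omega>)) \<partial>M)"
    using integrable_T[OF iE] integrable_T[OF f] pt by (intro integral_mono) auto
  also have "\<dots> = 4 ^ CARD('d) * ((3 * 2 ^ K) ^ CARD('d) * (\<integral>\<omega>. f \<omega> \<partial>M))"
    using integrable_T[OF f] integral_T[of f] by (simp add: R_def card_icube)
  also have "\<dots> = (2 ^ K) ^ CARD('d) * (12 ^ CARD('d) * (\<integral>\<omega>. f \<omega> \<partial>M))"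
  proof -
    have "(12::real) ^ CARD('d) = 4 ^ CARD('d) * 3 ^ CARD('d)" by (simp flip: power_mult_distrib)
    then show ?thesis by (simp only: power_mult_distrib mult_ac)
  qed
  finally have "(2 ^ K) ^ CARD('d) * (s * prob E) \<le> (2 ^ K) ^ CARD('d) * (12 ^ CARD('d) * (\<integral>\<omega>. f \<omega> \<partial>M))"
    by (simp add: mult_ac)
  then have "s * prob E \<le> 12 ^ CARD('d) * (\<integral>\<omega>. f \<omega> \<partial>M)" by simp
  then show ?thesis using s by (simp add: E_def field_simps)
qed

lemma maximal_inequality:
  fixes f :: "'w \<Rightarrow> real"
  assumes f: "integrable M f" and f0: "\<And>\<omega>. 0 \<le> f \<omega>" and s: "0 < s"
  shows "prob {\<omega> \<in> space M. \<exists>k. s * (2 ^ k) ^ CARD('d) \<le> (\<Sum>y\<in>ccube k. f (T y \<omega>))}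
    \<le> 12 ^ CARD('d) * (\<integral>\<omega>. f \<omega> \<partial>M) / s"
proof -
  have [measurable]: "f \<in> borel_measurable M" using f by auto
  define E where "E K = {\<omega> \<in> space M. \<exists>k\<le>K. s * (2 ^ k) ^ CARD('d) \<le> (\<Sum>y\<in>ccube k. f (T y \<omega>))}" for K :: nat
  have "(\<lambda>K. prob (E K)) \<longlonglongrightarrow> prob (\<Union>K. E K)"
  proof (rule finite_Lim_measure_incseq)
    show "range E \<subseteq> sets M" unfolding E_def by auto
    show "incseq E" unfolding incseq_def E_def using order_trans by blast
  qed
  moreover have "prob (E K) \<le> 12 ^ CARD('d) * (\<integral>\<omega>. f \<omega> \<partial>M) / s" for K
    unfolding E_def by (rule maximal_inequality_upto[OF assms])
  ultimately have "prob (\<Union>K. E K) \<le> 12 ^ CARD('d) * (\<integral>\<omega>. f \<omega> \<partial>M) / s"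
    by (intro LIMSEQ_le_const2) auto
  also have "(\<Union>K. E K) = {\<omega> \<in> space M. \<exists>k. s * (2 ^ k) ^ CARD('d) \<le> (\<Sum>y\<in>ccube k. f (T y \<omega>))}"
    unfolding E_def by auto
  finally show ?thesis .
qed

end

section \<open>Sublinearity of the potential\<close>

lemma powr_midpoint_le:
  fixes x y q :: real
  assumes "0 \<le> x" "0 \<le> y" "1 \<le> q"
  shows "((x + y) / 2) powr q \<le> (x powr q + y powr q) / 2"
proof -
  have half: "(z / 2) powr q \<le> z powr q / 2" if "0 \<le> z" for z :: real
  proof -
    have "2 powr 1 \<le> (2::real) powr q" using assms by (intro powr_mono) auto
    then have "z powr q / 2 powr q \<le> z powr q / 2" by (intro divide_left_mono) auto
    then show ?thesis using that by (simp add: powr_divide)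
  qed
  consider "x = 0" | "y = 0" | "0 < x" "0 < y" using assms by linarith
  then show ?thesis
  proof cases
    case 3
    from convex_onD[OF powr_convex[OF assms(3)], of "1/2" x y] 3 show ?thesis
      by (simp add: add_divide_distrib)
  qed (use half assms in auto)
qed

lemma abs_add_powr_le:
  fixes a b q :: real
  assumes "0 \<le> q"
  shows "\<bar>a + b\<bar> powr q \<le> 2 powr q * (\<bar>a\<bar> powr q + \<bar>b\<bar> powr q)"
proof -
  have "\<bar>a + b\<bar> powr q \<le> (2 * max \<bar>a\<bar> \<bar>b\<bar>) powr q"
    using assms by (intro powr_mono2) auto
  also have "\<dots> = 2 powr q * (max \<bar>a\<bar> \<bar>b\<bar>) powr q" by (simp add: powr_mult)
  also have "\<dots> \<le> 2 powr q * (\<bar>a\<bar> powr q + \<bar>b\<bar> powr q)"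
    by (intro mult_left_mono) (auto simp: max_def)
  finally show ?thesis .
qed

lemma sum_powr_le:
  fixes a :: "'a \<Rightarrow> real"
  assumes "finite U" "0 \<le> q" "\<And>e. e \<in> U \<Longrightarrow> 0 \<le> a e"
  shows "(\<Sum>e\<in>U. a e) powr q \<le> real (card U) powr q * (\<Sum>e\<in>U. a e powr q)"
proof (cases "U = {}")
  case False
  have mem: "Max (a ` U) \<in> a ` U" using False assms by (intro Max_in) auto
  then obtain e where e: "e \<in> U" "Max (a ` U) = a e" by auto
  have "(\<Sum>e\<in>U. a e) \<le> real (card U) * a e"
    using assms unfolding e(2)[symmetric] by (intro sum_bounded_above) auto
  then have "(\<Sum>e\<in>U. a e) powr q \<le> (real (card U) * a e) powr q"
    using assms by (intro powr_mono2 sum_nonneg) auto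
  also have "\<dots> = real (card U) powr q * a e powr q" using e assms by (simp add: powr_mult)
  also have "\<dots> \<le> real (card U) powr q * (\<Sum>e\<in>U. a e powr q)"
    using e assms by (intro mult_left_mono member_le_sum) auto
  finally show ?thesis .
qed simp

definition Lq :: "'a measure \<Rightarrow> real \<Rightarrow> ('a \<Rightarrow> real) \<Rightarrow> bool" where
  "Lq M q f \<longleftrightarrow> f \<in> borel_measurable M \<and> integrable M (\<lambda>\<omega>. \<bar>f \<omega>\<bar> powr q)"

lemma Lq_measurable: "Lq M q f \<Longrightarrow> f \<in> borel_measurable M"
  and Lq_integrable_powr: "Lq M q f \<Longrightarrow> integrable M (\<lambda>\<omega>. \<bar>f \<omega>\<bar> powr q)"
  by (simp_all add: Lq_def)

lemma Lq_AE_bound: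
  assumes "integrable M h" "f \<in> borel_measurable M" "AE \<omega> in M. \<bar>f \<omega>\<bar> powr q \<le> h \<omega>"
  shows "Lq M q f"
  unfolding Lq_def using assms
  by (auto intro!: Bochner_Integration.integrable_bound[OF assms(1)] elim: eventually_mono)

lemma Lq_add:
  assumes "Lq M q f" "Lq M q g" "0 \<le> q"
  shows "Lq M q (\<lambda>\<omega>. f \<omega> + g \<omega>)"
  using assms abs_add_powr_le[OF assms(3)]
  by (intro Lq_AE_bound[of _ "\<lambda>\<omega>. 2 powr q * (\<bar>f \<omega>\<bar> powr q + \<bar>g \<omega>\<bar> powr q)"]) (auto simp: Lq_def)

lemma Lq_cmult:
  assumes "Lq M q f"
  shows "Lq M q (\<lambda>\<omega>. c * f \<omega>)"
  using assms by (auto simp: Lq_def abs_mult powr_mult)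

lemma Lq_diff:
  assumes "Lq M q f" "Lq M q g" "0 \<le> q"
  shows "Lq M q (\<lambda>\<omega>. f \<omega> - g \<omega>)"
  using Lq_add[OF assms(1) Lq_cmult[OF assms(2), of "-1"] assms(3)] by simp

lemma (in prob_space) Lq_bounded:
  assumes "f \<in> borel_measurable M" "AE \<omega> in M. \<bar>f \<omega>\<bar> \<le> b" "0 \<le> q"
  shows "Lq M q f"
  using assms by (intro Lq_AE_bound[of _ "\<lambda>_. b powr q"]) (auto elim!: eventually_mono intro: powr_mono2)

lemma (in prob_space) Lq_integrable:
  assumes "Lq M q f" "1 \<le> q"
  shows "integrable M f"
proof (rule Bochner_Integration.integrable_bound)
  show "integrable M (\<lambda>\<omega>. 1 + \<bar>f \<omega>\<bar> powr q)" using assms by (simp add: Lq_def)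
  show "f \<in> borel_measurable M" using assms by (simp add: Lq_def)
  show "AE \<omega> in M. norm (f \<omega>) \<le> norm (1 + \<bar>f \<omega>\<bar> powr q)"
    using le_threshold_powr[of "\<bar>f _\<bar>" 1 q] assms by (intro AE_I2) auto
qed

lemma (in ergodic_lattice_action) Lq_T: "Lq M q f \<Longrightarrow> Lq M q (\<lambda>\<omega>. f (T x \<omega>))"
  using integrable_T[of "\<lambda>\<omega>. \<bar>f \<omega>\<bar> powr q" x] by (auto simp: Lq_def)

text \<open>In the sublinearity proof the approximating gradient depends on \<open>\<delta>\<close>,
  so each choice only yields an exceptional set of small probability. The property \<open>P\<close>
  does not involve that choice, so it fails at most on the intersection of these sets.\<close>

lemma (in prob_space) AE_from_small_exceptions:
  assumes "\<And>\<delta>. 0 < \<delta> \<Longrightarrow> \<exists>N\<in>sets M. prob N \<le> \<delta> \<and> (\<forall>\<omega>\<in>space M - N. P \<omega>)"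
  shows "AE \<omega> in M. P \<omega>"
proof -
  have "\<forall>n. \<exists>N\<in>sets M. prob N \<le> 1 / real (Suc n) \<and> (\<forall>\<omega>\<in>space M - N. P \<omega>)"
    using assms by simp
  then obtain N where N: "\<And>n. N n \<in> sets M" "\<And>n. prob (N n) \<le> 1 / real (Suc n)"
    "\<And>n \<omega>. \<omega> \<in> space M - N n \<Longrightarrow> P \<omega>" by metis
  have m: "(\<Inter>n. N n) \<in> sets M" using N(1) by auto
  have "prob (\<Inter>n. N n) \<le> 1 / real (Suc n)" for n
    using finite_measure_mono[OF _ N(1)[of n], of "\<Inter>n. N n"] N(2)[of n] by (meson INF_lower UNIV_I order_trans)
  then have "prob (\<Inter>n. N n) \<le> 0"
    by (intro LIMSEQ_le_const[OF LIMSEQ_inverse_real_of_nat]) (auto simp: inverse_eq_divide)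
  then have "prob (\<Inter>n. N n) = 0" using measure_nonneg[of M "\<Inter>n. N n"] by linarith
  then have "(\<Inter>n. N n) \<in> null_sets M" using m by (auto simp: null_sets_def emeasure_eq_measure)
  from AE_not_in[OF this] AE_space show ?thesis
    by eventually_elim (use N(3) in auto)
qed

lemma path_sum_append:
  fixes F :: "'w \<Rightarrow> int ^ 'd \<Rightarrow> real" and T :: "int ^ 'd \<Rightarrow> 'w \<Rightarrow> 'w" and \<omega> :: 'w
  defines "S \<equiv> \<lambda>x es. \<Sum>i<length es. F (T (x + walk_pos es i) \<omega>) (es ! i)"
  shows "S x (es @ fs) = S x es + S (x + sum_list es) fs"
proof -
  have split: "sum f {..<m + n} = sum f {..<m} + (\<Sum>i<n. f (m + i))" for f :: "nat \<Rightarrow> real" and m n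
    by (induction n) simp_all
  have "S x (es @ fs) = (\<Sum>i<length es. F (T (x + walk_pos (es @ fs) i) \<omega>) ((es @ fs) ! i)) +
      (\<Sum>i<length fs. F (T (x + walk_pos (es @ fs) (length es + i)) \<omega>) ((es @ fs) ! (length es + i)))"
    unfolding S_def length_append by (rule split)
  also have "(\<Sum>i<length es. F (T (x + walk_pos (es @ fs) i) \<omega>) ((es @ fs) ! i)) = S x es"
    unfolding S_def by (intro sum.cong) (auto simp: walk_pos_def nth_append)
  also have "(\<Sum>i<length fs. F (T (x + walk_pos (es @ fs) (length es + i)) \<omega>) ((es @ fs) ! (length es + i))) =
      S (x + sum_list es) fs"
    unfolding S_def by (intro sum.cong) (auto simp: walk_pos_def add.assoc)
  finally show ?thesis .
qed

text \<open>The value at \<open>x\<close> is the sum of the field along one chosen path from the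
  origin. Two paths with the same end give the same sum because a common return path closes each of
  them into a loop, so the path chosen for \<open>x + e\<close> may be replaced by the one for
  \<open>x\<close> followed by \<open>e\<close>.\<close>

lemma (in ergodic_lattice_action) classK_potential:
  assumes F: "F \<in> classK M T"
  shows "AE \<omega> in M. \<exists>\<phi>. \<forall>x. \<forall>e\<in>unit_steps. \<phi> (x + e) - \<phi> x = F (T x \<omega>) e"
proof -
  have "AE \<omega> in M. \<forall>xs::(int ^ 'd) list. xs \<noteq> [] \<longrightarrow> hd xs = last xs \<longrightarrow>
         (\<forall>i. Suc i < length xs \<longrightarrow> xs ! Suc i - xs ! i \<in> unit_steps) \<longrightarrow>
         (\<Sum>i<length xs - 1. F (T (xs ! i) \<omega>) (xs ! Suc i - xs ! i)) = 0"
    using F by (simp add: classK_def)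
  then show ?thesis
  proof eventually_elim
    case (elim \<omega>)
    define S where "S x es = (\<Sum>i<length es. F (T (x + walk_pos es i) \<omega>) (es ! i))"
      for x :: "int ^ 'd" and es
    have app: "S x (es @ fs) = S x es + S (x + sum_list es) fs" for x es fs
      unfolding S_def by (rule path_sum_append)
    have loop: "S 0 es = 0" if es: "set es \<subseteq> unit_steps" and s0: "sum_list es = 0" for es
    proof -
      \<comment> \<open>The class is phrased with vertices, \<open>S\<close> with steps;
        \<open>xs\<close> lists the vertices visited by \<open>es\<close>, one more than there are
        steps.\<close>
      define xs where "xs = map (walk_pos es) [0..<Suc (length es)]"
      have len: "length xs = Suc (length es)" by (simp add: xs_def)
      have nth: "xs ! i = walk_pos es i" if "i \<le> length es" for i
        using that unfolding xs_def by (subst nth_map) (auto simp del: upt_Suc)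
      have step: "xs ! Suc i - xs ! i = es ! i" if "i < length es" for i
        using that by (simp add: nth walk_pos_def take_Suc_conv_app_nth)
      have "hd xs = xs ! 0" using len by (metis hd_conv_nth length_0_conv nat.distinct(1))
      also have "\<dots> = xs ! length es" by (simp add: nth walk_pos_def s0)
      also have "\<dots> = last xs" using len by (metis diff_Suc_1 last_conv_nth length_0_conv nat.distinct(1))
      finally have "(\<Sum>i<length xs - 1. F (T (xs ! i) \<omega>) (xs ! Suc i - xs ! i)) = 0"
        using len es step by (intro elim[rule_format]) auto
      also have "(\<Sum>i<length xs - 1. F (T (xs ! i) \<omega>) (xs ! Suc i - xs ! i)) = S 0 es"
        unfolding S_def
      proof (rule sum.cong)
        fix i assume "i \<in> {..<length es}"
        then have i: "i < length es" by simp
        show "F (T (xs ! i) \<omega>) (xs ! Suc i - xs ! i) = F (T (0 + walk_pos es i) \<omega>) (es ! i)"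
          using step[OF i] nth[OF less_imp_le[OF i]] by (metis add_0)
      qed (simp add: len)
      finally show ?thesis .
    qed
    have indep: "S 0 es = S 0 es'"
      if "set es \<subseteq> unit_steps" "set es' \<subseteq> unit_steps" "sum_list es = sum_list es'" for es es'
    proof -
      obtain \<rho> where \<rho>: "set \<rho> \<subseteq> unit_steps" "sum_list \<rho> = - sum_list es" using exists_lattice_path by blast
      have "S 0 (es @ \<rho>) = 0" "S 0 (es' @ \<rho>) = 0" using that \<rho> by (auto intro!: loop)
      then show ?thesis using that(3) by (simp add: app)
    qed
    obtain \<pi> where \<pi>: "\<And>x. set (\<pi> x) \<subseteq> unit_steps" "\<And>x. sum_list (\<pi> x) = (x :: int ^ 'd)"
      using exists_lattice_path by metis
    have "S 0 (\<pi> (x + e)) - S 0 (\<pi> x) = F (T x \<omega>) e" if e: "e \<in> unit_steps" for x e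
    proof -
      have "S 0 (\<pi> (x + e)) = S 0 (\<pi> x @ [e])" using \<pi> e by (intro indep) auto
      also have "\<dots> = S 0 (\<pi> x) + S x [e]" by (simp add: app \<pi>)
      also have "S x [e] = F (T x \<omega>) e" by (simp add: S_def walk_pos_def)
      finally show ?thesis by simp
    qed
    then show ?case by (intro exI[of _ "\<lambda>x. S 0 (\<pi> x)"]) auto
  qed
qed

section \<open>Cocycles modulo gradients\<close>

context ergodic_lattice_action
begin

definition cgrad :: "('w \<Rightarrow> real) \<Rightarrow> 'w \<Rightarrow> int ^ 'd \<Rightarrow> real" where
  "cgrad g \<omega> e = g (T e \<omega>) - g \<omega>"

lemma Lq_cgrad: "Lq M q g \<Longrightarrow> 0 \<le> q \<Longrightarrow> Lq M q (\<lambda>\<omega>. cgrad g \<omega> e)"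
  unfolding cgrad_def by (intro Lq_diff Lq_T)

text \<open>Dominated convergence for large cutoffs: values beyond the cutoff become 0, so the error
  is dominated by the field itself. The truncated field is the bounded starting point of the
  minimization; its mean may differ from that of \<open>F\<close>, and the second bound keeps this
  shift small.\<close>

lemma truncation_approx:
  fixes F :: "'w \<Rightarrow> int ^ 'd \<Rightarrow> real"
  assumes q: "1 \<le> q" and F: "\<And>e. e \<in> unit_steps \<Longrightarrow> Lq M q (\<lambda>\<omega>. F \<omega> e)" and \<delta>: "0 < \<delta>" "0 < \<delta>'"
  shows "\<exists>b>0. \<forall>e\<in>unit_steps.
    (\<integral>\<omega>. \<bar>F \<omega> e - (if \<bar>F \<omega> e\<bar> \<le> b then F \<omega> e else 0)\<bar> powr q \<partial>M) < \<delta> \<and>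
    \<bar>\<integral>\<omega>. F \<omega> e - (if \<bar>F \<omega> e\<bar> \<le> b then F \<omega> e else 0) \<partial>M\<bar> < \<delta>'"
proof -
  define D where "D n \<omega> e = F \<omega> e - (if \<bar>F \<omega> e\<bar> \<le> real n then F \<omega> e else 0)" for n :: nat and \<omega> and e :: "int ^ 'd"
  have ev: "\<forall>\<^sub>F n in sequentially. D n \<omega> e = 0" for \<omega> e
  proof -
    have "\<forall>\<^sub>F n in sequentially. \<bar>F \<omega> e\<bar> \<le> real n"
      using filterlim_real_sequentially unfolding filterlim_at_top by blast
    then show ?thesis by eventually_elim (simp add: D_def)
  qed
  have D_lim: "(\<lambda>n. D n \<omega> e) \<longlonglongrightarrow> 0" for \<omega> e
    by (rule tendsto_eventually[OF ev])
  have "\<forall>\<^sub>F n in sequentially. (\<integral>\<omega>. \<bar>D n \<omega> e\<bar> powr q \<partial>M) < \<delta> \<and> \<bar>\<integral>\<omega>. D n \<omega> e \<partial>M\<bar> < \<delta>'"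
    if e: "e \<in> unit_steps" for e
  proof (rule eventually_conj)
    have [measurable]: "(\<lambda>\<omega>. F \<omega> e) \<in> borel_measurable M" using F[OF e] by (rule Lq_measurable)
    have "(\<lambda>n. \<integral>\<omega>. \<bar>D n \<omega> e\<bar> powr q \<partial>M) \<longlonglongrightarrow> (\<integral>\<omega>. 0 \<partial>M)"
    proof (rule integral_dominated_convergence[where w = "\<lambda>\<omega>. \<bar>F \<omega> e\<bar> powr q"])
      show "integrable M (\<lambda>\<omega>. \<bar>F \<omega> e\<bar> powr q)" using F[OF e] by (rule Lq_integrable_powr)
      show "AE \<omega> in M. (\<lambda>n. \<bar>D n \<omega> e\<bar> powr q) \<longlonglongrightarrow> 0"
      proof (rule AE_I2)
        fix \<omega>
        show "(\<lambda>n. \<bar>D n \<omega> e\<bar> powr q) \<longlonglongrightarrow> 0"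
          using ev[of \<omega> e] by (intro tendsto_eventually) (auto elim: eventually_mono)
      qed
      show "AE \<omega> in M. norm (\<bar>D n \<omega> e\<bar> powr q) \<le> \<bar>F \<omega> e\<bar> powr q" for n
        by (auto simp: D_def)
    qed (auto simp: D_def)
    then have "(\<lambda>n. \<integral>\<omega>. \<bar>D n \<omega> e\<bar> powr q \<partial>M) \<longlonglongrightarrow> 0" by simp
    then show "\<forall>\<^sub>F n in sequentially. (\<integral>\<omega>. \<bar>D n \<omega> e\<bar> powr q \<partial>M) < \<delta>"
      using \<delta>(1) by (rule order_tendstoD)
    have "(\<lambda>n. \<integral>\<omega>. D n \<omega> e \<partial>M) \<longlonglongrightarrow> (\<integral>\<omega>. 0 \<partial>M)"
    proof (rule integral_dominated_convergence[where w = "\<lambda>\<omega>. \<bar>F \<omega> e\<bar>"])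
      show "integrable M (\<lambda>\<omega>. \<bar>F \<omega> e\<bar>)" using Lq_integrable[OF F[OF e] q] by simp
    qed (auto simp: D_lim, auto simp: D_def)
    then have "(\<lambda>n. \<bar>\<integral>\<omega>. D n \<omega> e \<partial>M\<bar>) \<longlonglongrightarrow> 0" using tendsto_rabs_zero by fastforce
    then show "\<forall>\<^sub>F n in sequentially. \<bar>\<integral>\<omega>. D n \<omega> e \<partial>M\<bar> < \<delta>'"
      using \<delta>(2) by (rule order_tendstoD)
  qed
  then have "\<forall>\<^sub>F n in sequentially. \<forall>e\<in>unit_steps. (\<integral>\<omega>. \<bar>D n \<omega> e\<bar> powr q \<partial>M) < \<delta> \<and> \<bar>\<integral>\<omega>. D n \<omega> e \<partial>M\<bar> < \<delta>'"
    by (intro eventually_ball_finite) auto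
  from eventually_conj[OF this eventually_gt_at_top[of 0]]
  obtain n where "0 < n" "\<forall>e\<in>unit_steps. (\<integral>\<omega>. \<bar>D n \<omega> e\<bar> powr q \<partial>M) < \<delta> \<and> \<bar>\<integral>\<omega>. D n \<omega> e \<partial>M\<bar> < \<delta>'"
    by (auto simp: eventually_sequentially)
  then show ?thesis by (intro exI[of _ "real n"]) (auto simp: D_def)
qed

text \<open>Modulo gradients, a cocycle equals each of its translates. Hence the bounded fields that are
  close to the cocycle modulo gradients form a translation invariant, midpoint-convex set, whose
  near-minimizers of the \<open>L\<^sup>2\<close> norm converge to an invariant, that is constant, field.\<close>

lemma cocycle_decomposition:
  fixes F :: "'w \<Rightarrow> int ^ 'd \<Rightarrow> real"
  assumes q: "1 \<le> q" and F: "\<And>e. e \<in> unit_steps \<Longrightarrow> Lq M q (\<lambda>\<omega>. F \<omega> e)"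
    and mean: "\<And>e. e \<in> unit_steps \<Longrightarrow> (\<integral>\<omega>. F \<omega> e \<partial>M) = 0"
    and comm: "\<And>e e'. e \<in> unit_steps \<Longrightarrow> e' \<in> unit_steps \<Longrightarrow>
      AE \<omega> in M. F \<omega> e' + F (T e' \<omega>) e = F \<omega> e + F (T e \<omega>) e'"
    and \<delta>: "0 < \<delta>"
  shows "\<exists>g. Lq M q g \<and> (\<forall>e\<in>unit_steps. (\<integral>\<omega>. \<bar>F \<omega> e + cgrad g \<omega> e\<bar> powr q \<partial>M) \<le> \<delta>)"
proof -
  have q0: "0 \<le> q" using q by simp
  \<comment> \<open>Three errors of size \<open>\<delta>'\<close> are added at the end, under the
    factor \<open>4 powr q\<close> of a triangle inequality applied twice.\<close>
  define \<delta>' where "\<delta>' = \<delta> / (3 * 4 powr q)"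
  have \<delta>': "0 < \<delta>'" using \<delta> by (simp add: \<delta>'_def)
  obtain b where b: "0 < b" and
    b1: "\<And>e. e \<in> unit_steps \<Longrightarrow> (\<integral>\<omega>. \<bar>F \<omega> e - (if \<bar>F \<omega> e\<bar> \<le> b then F \<omega> e else 0)\<bar> powr q \<partial>M) < \<delta>'" and
    b2: "\<And>e. e \<in> unit_steps \<Longrightarrow> \<bar>\<integral>\<omega>. F \<omega> e - (if \<bar>F \<omega> e\<bar> \<le> b then F \<omega> e else 0) \<partial>M\<bar> < \<delta>' powr (1 / q)"
    using truncation_approx[of q F \<delta>' "\<delta>' powr (1 / q)", OF q] F \<delta>' by auto
  define X0 where "X0 \<omega> e = (if \<bar>F \<omega> e\<bar> \<le> b then F \<omega> e else 0)" for \<omega> e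
  define m where "m e = (\<integral>\<omega>. X0 \<omega> e \<partial>M)" for e
  have X0m: "(\<lambda>\<omega>. X0 \<omega> e) \<in> borel_measurable M" if "e \<in> unit_steps" for e
    using Lq_measurable[OF F[OF that]] unfolding X0_def by measurable
  have X0b: "\<bar>X0 \<omega> e\<bar> \<le> b" for \<omega> e using b by (simp add: X0_def)
  have m_small: "\<bar>m e\<bar> powr q \<le> \<delta>'" if e: "e \<in> unit_steps" for e
  proof -
    have "(\<integral>\<omega>. F \<omega> e - X0 \<omega> e \<partial>M) = - m e"
      using mean[OF e] Lq_integrable[OF F[OF e] q] AE_bounded_integrable[OF X0m[OF e], of b] X0b
      by (simp add: m_def)
    then have "\<bar>m e\<bar> \<le> \<delta>' powr (1 / q)" using b2[OF e] by (simp add: X0_def)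
    then have "\<bar>m e\<bar> powr q \<le> (\<delta>' powr (1 / q)) powr q" using q0 by (intro powr_mono2) auto
    then show ?thesis using q \<delta>' by (simp add: powr_powr)
  qed
  \<comment> \<open>Besides closeness to \<open>F\<close> modulo a gradient, the mean is prescribed.
    It survives translations, midpoints and bounded limits, and so identifies the constant limit as
    the small vector \<open>m\<close>.\<close>
  define C where "C = {X. \<forall>e\<in>unit_steps. (\<lambda>\<omega>. X \<omega> e) \<in> borel_measurable M \<and>
      (AE \<omega> in M. \<bar>X \<omega> e\<bar> \<le> b) \<and> (\<integral>\<omega>. X \<omega> e \<partial>M) = m e} \<inter>
    {X. \<exists>g. Lq M q g \<and> (\<forall>e\<in>unit_steps. (\<integral>\<omega>. \<bar>F \<omega> e + cgrad g \<omega> e - X \<omega> e\<bar> powr q \<partial>M) \<le> \<delta>')}"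
  have CM: "(\<lambda>\<omega>. X \<omega> e) \<in> borel_measurable M" "AE \<omega> in M. \<bar>X \<omega> e\<bar> \<le> b" "(\<integral>\<omega>. X \<omega> e \<partial>M) = m e"
    "integrable M (\<lambda>\<omega>. X \<omega> e)" "Lq M q (\<lambda>\<omega>. X \<omega> e)"
    if "X \<in> C" "e \<in> unit_steps" for X e
  proof -
    show 1: "(\<lambda>\<omega>. X \<omega> e) \<in> borel_measurable M" "AE \<omega> in M. \<bar>X \<omega> e\<bar> \<le> b" "(\<integral>\<omega>. X \<omega> e \<partial>M) = m e"
      using that by (auto simp: C_def)
    show "integrable M (\<lambda>\<omega>. X \<omega> e)" using 1 by (intro AE_bounded_integrable)
    show "Lq M q (\<lambda>\<omega>. X \<omega> e)" using 1 q0 by (intro Lq_bounded)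
  qed
  have X0C: "X0 \<in> C"
  proof -
    have "Lq M q (\<lambda>\<omega>. 0)" by (simp add: Lq_def)
    moreover have "(\<integral>\<omega>. \<bar>F \<omega> e + cgrad (\<lambda>\<omega>. 0) \<omega> e - X0 \<omega> e\<bar> powr q \<partial>M) \<le> \<delta>'" if "e \<in> unit_steps" for e
      using b1[OF that] by (simp add: cgrad_def X0_def)
    ultimately show ?thesis using X0m X0b unfolding C_def
      by (intro IntI CollectI ballI conjI exI[of _ "\<lambda>\<omega>. 0"]) (auto simp: m_def)
  qed
  have mid: "(\<lambda>\<omega> e. (X \<omega> e + Y \<omega> e) / 2) \<in> C" if X: "X \<in> C" and Y: "Y \<in> C" for X Y
  proof -
    obtain g h where g: "Lq M q g" "\<And>e. e \<in> unit_steps \<Longrightarrow> (\<integral>\<omega>. \<bar>F \<omega> e + cgrad g \<omega> e - X \<omega> e\<bar> powr q \<partial>M) \<le> \<delta>'"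
      and h: "Lq M q h" "\<And>e. e \<in> unit_steps \<Longrightarrow> (\<integral>\<omega>. \<bar>F \<omega> e + cgrad h \<omega> e - Y \<omega> e\<bar> powr q \<partial>M) \<le> \<delta>'"
      using X Y unfolding C_def by blast
    define k where "k \<omega> = 1 / 2 * (g \<omega> + h \<omega>)" for \<omega>
    have k: "Lq M q k" unfolding k_def by (intro Lq_cmult Lq_add g h q0)
    have "(\<integral>\<omega>. \<bar>F \<omega> e + cgrad k \<omega> e - (X \<omega> e + Y \<omega> e) / 2\<bar> powr q \<partial>M) \<le> \<delta>'" if e: "e \<in> unit_steps" for e
    proof -
      have LX: "Lq M q (\<lambda>\<omega>. F \<omega> e + cgrad g \<omega> e - X \<omega> e)" "Lq M q (\<lambda>\<omega>. F \<omega> e + cgrad h \<omega> e - Y \<omega> e)"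
        "Lq M q (\<lambda>\<omega>. F \<omega> e + cgrad k \<omega> e - 1 / 2 * (X \<omega> e + Y \<omega> e))"
        by (intro Lq_diff Lq_add Lq_cmult Lq_cgrad F e g h k CM X Y q0)+
      have "(\<integral>\<omega>. \<bar>F \<omega> e + cgrad k \<omega> e - (X \<omega> e + Y \<omega> e) / 2\<bar> powr q \<partial>M) \<le>
        (\<integral>\<omega>. (\<bar>F \<omega> e + cgrad g \<omega> e - X \<omega> e\<bar> powr q + \<bar>F \<omega> e + cgrad h \<omega> e - Y \<omega> e\<bar> powr q) / 2 \<partial>M)"
      proof (rule integral_mono)
        fix \<omega>
        define a where "a = F \<omega> e + cgrad g \<omega> e - X \<omega> e"
        define c where "c = F \<omega> e + cgrad h \<omega> e - Y \<omega> e"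
        have eq: "F \<omega> e + cgrad k \<omega> e - (X \<omega> e + Y \<omega> e) / 2 = (a + c) / 2"
          by (simp add: a_def c_def cgrad_def k_def field_simps)
        have "\<bar>(a + c) / 2\<bar> powr q \<le> ((\<bar>a\<bar> + \<bar>c\<bar>) / 2) powr q"
          using q0 by (intro powr_mono2) auto
        also have "\<dots> \<le> (\<bar>a\<bar> powr q + \<bar>c\<bar> powr q) / 2" using q by (intro powr_midpoint_le) auto
        finally show "\<bar>F \<omega> e + cgrad k \<omega> e - (X \<omega> e + Y \<omega> e) / 2\<bar> powr q
          \<le> (\<bar>F \<omega> e + cgrad g \<omega> e - X \<omega> e\<bar> powr q + \<bar>F \<omega> e + cgrad h \<omega> e - Y \<omega> e\<bar> powr q) / 2"
          unfolding eq by (simp add: a_def c_def)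
      qed (use LX in \<open>auto simp: Lq_def\<close>)
      also have "\<dots> \<le> \<delta>'" using LX(1,2) g(2)[OF e] h(2)[OF e] by (simp add: Lq_def)
      finally show ?thesis .
    qed
    moreover have "AE \<omega> in M. \<bar>(X \<omega> e + Y \<omega> e) / 2\<bar> \<le> b" if "e \<in> unit_steps" for e
      using CM(2)[OF X that] CM(2)[OF Y that] by eventually_elim auto
    moreover have "(\<lambda>\<omega>. (X \<omega> e + Y \<omega> e) / 2) \<in> borel_measurable M" if "e \<in> unit_steps" for e
      using CM(1)[OF X that] CM(1)[OF Y that] by measurable
    moreover have "(\<integral>\<omega>. (X \<omega> e + Y \<omega> e) / 2 \<partial>M) = m e" if "e \<in> unit_steps" for e
      using CM(3,4)[OF X that] CM(3,4)[OF Y that] by simp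
    ultimately show ?thesis using k unfolding C_def by blast
  qed
  have trans: "(\<lambda>\<omega> e. X (T e' \<omega>) e) \<in> C" if X: "X \<in> C" and e': "e' \<in> unit_steps" for X e'
  proof -
    obtain g where g: "Lq M q g" "\<And>e. e \<in> unit_steps \<Longrightarrow> (\<integral>\<omega>. \<bar>F \<omega> e + cgrad g \<omega> e - X \<omega> e\<bar> powr q \<partial>M) \<le> \<delta>'"
      using X unfolding C_def by blast
    \<comment> \<open>By the cocycle relation, the translate of \<open>F\<close> by
      \<open>e'\<close> is \<open>F\<close> plus the gradient of its \<open>e'\<close>-component.
      Adding this component to the translated \<open>g\<close> gives the function that serves the
      translated field.\<close>
    define h where "h \<omega> = g (T e' \<omega>) + F \<omega> e'" for \<omega>
    have h: "Lq M q h" unfolding h_def by (intro Lq_add Lq_T g F e' q0)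
    have "(\<integral>\<omega>. \<bar>F \<omega> e + cgrad h \<omega> e - X (T e' \<omega>) e\<bar> powr q \<partial>M) \<le> \<delta>'" if e: "e \<in> unit_steps" for e
    proof -
      define f where "f \<omega> = \<bar>F \<omega> e + cgrad g \<omega> e - X \<omega> e\<bar> powr q" for \<omega>
      have f: "f \<in> borel_measurable M"
        using Lq_measurable[OF F[OF e]] Lq_measurable[OF Lq_cgrad[OF g(1) q0, of e]] CM(1)[OF X e]
        unfolding f_def by measurable
      have "Lq M q (\<lambda>\<omega>. F \<omega> e + cgrad h \<omega> e - X (T e' \<omega>) e)"
        using Lq_T[OF CM(5)[OF X e]] by (intro Lq_diff Lq_add Lq_cgrad F e h q0)
      then have m2: "(\<lambda>\<omega>. \<bar>F \<omega> e + cgrad h \<omega> e - X (T e' \<omega>) e\<bar> powr q) \<in> borel_measurable M"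
        by (auto simp: Lq_def)
      have "(\<integral>\<omega>. \<bar>F \<omega> e + cgrad h \<omega> e - X (T e' \<omega>) e\<bar> powr q \<partial>M) = (\<integral>\<omega>. f (T e' \<omega>) \<partial>M)"
      proof (rule integral_cong_AE[OF m2])
        show "(\<lambda>\<omega>. f (T e' \<omega>)) \<in> borel_measurable M" using f by measurable
        show "AE \<omega> in M. \<bar>F \<omega> e + cgrad h \<omega> e - X (T e' \<omega>) e\<bar> powr q = f (T e' \<omega>)"
          using comm[OF e e'] AE_space
        proof eventually_elim
          case (elim \<omega>)
          have "T e' (T e \<omega>) = T e (T e' \<omega>)"
            using elim by (simp add: T_add[symmetric] add.commute)
          then have "F \<omega> e + cgrad h \<omega> e = F (T e' \<omega>) e + cgrad g (T e' \<omega>) e"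
            using elim(1) by (simp add: cgrad_def h_def)
          then show ?case by (simp add: f_def)
        qed
      qed
      also have "\<dots> = (\<integral>\<omega>. f \<omega> \<partial>M)" by (rule integral_T[OF f])
      also have "\<dots> \<le> \<delta>'" unfolding f_def by (rule g(2)[OF e])
      finally show ?thesis .
    qed
    moreover have "AE \<omega> in M. \<bar>X (T e' \<omega>) e\<bar> \<le> b" if "e \<in> unit_steps" for e
      using AE_T[OF CM(2)[OF X that]] .
    moreover have "(\<lambda>\<omega>. X (T e' \<omega>) e) \<in> borel_measurable M" if "e \<in> unit_steps" for e
      using measurable_compose[OF T_measurable CM(1)[OF X that]] .
    moreover have "(\<integral>\<omega>. X (T e' \<omega>) e \<partial>M) = m e" if "e \<in> unit_steps" for e
      using integral_T[OF CM(1)[OF X that], of e'] CM(3)[OF X that] by simp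
    ultimately show ?thesis using h unfolding C_def by blast
  qed
  define Q where "Q Y = (\<integral>\<omega>. (\<Sum>e\<in>unit_steps. (Y \<omega> e)\<^sup>2) \<partial>M)" for Y :: "'w \<Rightarrow> int ^ 'd \<Rightarrow> real"
  have "\<exists>Y r. strict_mono (r :: nat \<Rightarrow> nat) \<and>
    (\<forall>k. Y k \<in> C \<and> (\<forall>Z\<in>C. Q (Y k) \<le> Q Z + 1 / 4 ^ k)) \<and>
    (\<forall>e\<in>unit_steps. AE \<omega> in M. convergent (\<lambda>k. Y k \<omega> e))"
    unfolding Q_def using X0C
    by (intro near_minimizers_converge[where C = "\<lambda>_. C" and b = b])
      (auto intro: CM mid simp: decseq_def)
  then obtain Y where YC: "\<And>k. Y k \<in> C" and Ymin: "\<And>k Z. Z \<in> C \<Longrightarrow> Q (Y k) \<le> Q Z + 1 / 4 ^ k"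
    and Yconv: "\<And>e. e \<in> unit_steps \<Longrightarrow> AE \<omega> in M. convergent (\<lambda>k. Y k \<omega> e)" by blast
  define L where "L e \<omega> = lim (\<lambda>k. Y k \<omega> e)" for e \<omega>
  have Ylim: "AE \<omega> in M. (\<lambda>k. Y k \<omega> e) \<longlonglongrightarrow> L e \<omega>" if "e \<in> unit_steps" for e
    using Yconv[OF that] by eventually_elim (simp add: L_def convergent_LIMSEQ_iff)
  have Lm: "L e \<in> borel_measurable M" if "e \<in> unit_steps" for e
    unfolding L_def using CM(1)[OF YC that] by (intro borel_measurable_lim_metric)
  have Yb: "AE \<omega> in M. \<forall>k. \<bar>Y k \<omega> e\<bar> \<le> b" if "e \<in> unit_steps" for e
    using CM(2)[OF YC that] by (simp add: AE_all_countable)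
  have Lb: "AE \<omega> in M. \<bar>L e \<omega>\<bar> \<le> b" if e: "e \<in> unit_steps" for e
    using Ylim[OF e] Yb[OF e]
  proof eventually_elim
    case (elim \<omega>)
    then show ?case by (intro LIMSEQ_le_const2[OF tendsto_rabs[OF elim(1)]]) auto
  qed
  have Li: "integrable M (L e)" if "e \<in> unit_steps" for e
    using Lm[OF that] Lb[OF that] by (rule AE_bounded_integrable)
  have Lmean: "(\<integral>\<omega>. L e \<omega> \<partial>M) = m e" if e: "e \<in> unit_steps" for e
  proof -
    have "(\<lambda>k. \<integral>\<omega>. Y k \<omega> e \<partial>M) \<longlonglongrightarrow> (\<integral>\<omega>. L e \<omega> \<partial>M)"
      using Lm[OF e] CM(1,2)[OF YC e] Ylim[OF e]
      by (intro integral_dominated_convergence[where w = "\<lambda>_. b"]) auto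
    then show ?thesis by (simp add: CM(3)[OF YC e] LIMSEQ_const_iff)
  qed
  \<comment> \<open>The translate of a near-minimizer lies in \<open>C\<close> and has the same
    functional. Since the midpoint is in \<open>C\<close> as well, the parallelogram identity bounds
    the squared \<open>L^2\<close> distance of the two by \<open>4 / 4^k\<close>, so they have the
    same limit.\<close>
  have Linv: "AE \<omega> in M. L e (T e' \<omega>) = L e \<omega>" if e: "e \<in> unit_steps" and e': "e' \<in> unit_steps" for e e'
  proof -
    define Z where "Z k \<omega> e = Y k (T e' \<omega>) e" for k \<omega> e
    have ZC: "Z k \<in> C" for k unfolding Z_def by (rule trans[OF YC e'])
    have prod: "integrable M (\<lambda>\<omega>. A \<omega> e * B \<omega> e)" if "A \<in> C" "B \<in> C" "e \<in> unit_steps" for A B e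
    proof (rule AE_bounded_integrable)
      show "(\<lambda>\<omega>. A \<omega> e * B \<omega> e) \<in> borel_measurable M"
        using CM(1)[OF that(1,3)] CM(1)[OF that(2,3)] by measurable
      show "AE \<omega> in M. \<bar>A \<omega> e * B \<omega> e\<bar> \<le> b * b"
        using CM(2)[OF that(1,3)] CM(2)[OF that(2,3)]
        by eventually_elim (auto simp: abs_mult intro!: mult_mono)
    qed
    have sq: "integrable M (\<lambda>\<omega>. (A \<omega> e)\<^sup>2)" if "A \<in> C" "e \<in> unit_steps" for A e
      using prod[OF that(1,1,2)] by (simp add: power2_eq_square)
    have dsq: "integrable M (\<lambda>\<omega>. (Y k \<omega> e - Z k \<omega> e)\<^sup>2)" if "e \<in> unit_steps" for k e
    proof -
      have "integrable M (\<lambda>\<omega>. (Y k \<omega> e)\<^sup>2 + (Z k \<omega> e)\<^sup>2 - 2 * (Y k \<omega> e * Z k \<omega> e))"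
        using sq[OF YC that] sq[OF ZC that] prod[OF YC ZC that] by simp
      then show ?thesis by (simp add: power2_diff mult.assoc)
    qed
    have QZ: "Q (Z k) = Q (Y k)" for k
    proof -
      have "(\<lambda>\<omega>. \<Sum>e\<in>unit_steps. (Y k \<omega> e)\<^sup>2) \<in> borel_measurable M"
        using CM(1)[OF YC] by measurable
      from integral_T[OF this, of e'] show ?thesis by (simp add: Q_def Z_def)
    qed
    have small: "(\<integral>\<omega>. (Y k \<omega> e - Z k \<omega> e)\<^sup>2 \<partial>M) \<le> 4 * (1 / 4) ^ k" for k
    proof -
      have "(\<integral>\<omega>. (Y k \<omega> e - Z k \<omega> e)\<^sup>2 \<partial>M) \<le> (\<integral>\<omega>. (\<Sum>e\<in>unit_steps. (Y k \<omega> e - Z k \<omega> e)\<^sup>2) \<partial>M)"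
        using e dsq by (intro integral_mono Bochner_Integration.integrable_sum member_le_sum) auto
      also have "\<dots> = 2 * Q (Y k) + 2 * Q (Z k) - 4 * Q (\<lambda>\<omega> e. (Y k \<omega> e + Z k \<omega> e) / 2)"
        unfolding Q_def by (rule parallelogram_integral) (auto intro: sq prod YC ZC)
      also have "\<dots> \<le> 4 * (1 / 4) ^ k"
        using Ymin[OF mid[OF YC ZC], of k k k] by (simp add: QZ power_divide)
      finally show ?thesis .
    qed
    have "AE \<omega> in M. summable (\<lambda>k. (Y k \<omega> e - Z k \<omega> e)\<^sup>2)"
      by (rule AE_summable_if_integrals_summable[OF dsq[OF e] _ small])
        (auto intro!: summable_mult summable_geometric)
    with Ylim[OF e] AE_T[OF Ylim[OF e], of e'] show ?thesis
    proof eventually_elim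
      case (elim \<omega>)
      have "(\<lambda>k. (Y k \<omega> e - Z k \<omega> e)\<^sup>2) \<longlonglongrightarrow> 0" using elim(3) by (rule summable_LIMSEQ_zero)
      moreover have "(\<lambda>k. (Y k \<omega> e - Z k \<omega> e)\<^sup>2) \<longlonglongrightarrow> (L e \<omega> - L e (T e' \<omega>))\<^sup>2"
        using elim(1,2) unfolding Z_def by (intro tendsto_power tendsto_diff)
      ultimately have "(L e \<omega> - L e (T e' \<omega>))\<^sup>2 = 0" by (rule LIMSEQ_unique[symmetric])
      then show ?case by simp
    qed
  qed
  have Lconst: "AE \<omega> in M. L e \<omega> = m e" if e: "e \<in> unit_steps" for e
    using AE_invariant_eq_mean[OF Li[OF e] Linv[OF e]] Lmean[OF e] by simp
  have "\<forall>\<^sub>F k in sequentially. (\<integral>\<omega>. \<bar>Y k \<omega> e - m e\<bar> powr q \<partial>M) < \<delta>'" if e: "e \<in> unit_steps" for e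
  proof -
    have "(\<lambda>k. \<integral>\<omega>. \<bar>Y k \<omega> e - m e\<bar> powr q \<partial>M) \<longlonglongrightarrow> (\<integral>\<omega>. 0 \<partial>M)"
    proof (rule integral_dominated_convergence[where w = "\<lambda>_. (b + \<bar>m e\<bar>) powr q"])
      show "(\<lambda>\<omega>. \<bar>Y k \<omega> e - m e\<bar> powr q) \<in> borel_measurable M" for k
        using CM(1)[OF YC e] by measurable
      show "AE \<omega> in M. (\<lambda>k. \<bar>Y k \<omega> e - m e\<bar> powr q) \<longlonglongrightarrow> 0"
        using Ylim[OF e] Lconst[OF e]
      proof eventually_elim
        case (elim \<omega>)
        have "(\<lambda>k. \<bar>Y k \<omega> e - m e\<bar>) \<longlonglongrightarrow> \<bar>m e - m e\<bar>"
          using elim by (intro tendsto_intros) simp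
        then have "(\<lambda>k. \<bar>Y k \<omega> e - m e\<bar> powr q) \<longlonglongrightarrow> 0 powr q"
          using q by (intro tendsto_powr2) auto
        then show ?case by simp
      qed
      show "AE \<omega> in M. norm (\<bar>Y k \<omega> e - m e\<bar> powr q) \<le> (b + \<bar>m e\<bar>) powr q" for k
        using CM(2)[OF YC[of k] e] by eventually_elim (use q0 in \<open>auto intro!: powr_mono2\<close>)
    qed auto
    then have "(\<lambda>k. \<integral>\<omega>. \<bar>Y k \<omega> e - m e\<bar> powr q \<partial>M) \<longlonglongrightarrow> 0" by simp
    then show ?thesis using \<delta>' by (rule order_tendstoD)
  qed
  then have "\<forall>\<^sub>F k in sequentially. \<forall>e\<in>unit_steps. (\<integral>\<omega>. \<bar>Y k \<omega> e - m e\<bar> powr q \<partial>M) < \<delta>'"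
    by (intro eventually_ball_finite) auto
  then obtain k where k: "\<And>e. e \<in> unit_steps \<Longrightarrow> (\<integral>\<omega>. \<bar>Y k \<omega> e - m e\<bar> powr q \<partial>M) < \<delta>'"
    by (auto simp: eventually_sequentially)
  \<comment> \<open>At this index \<open>Y k\<close> is already close to the small constant
    \<open>m\<close>, so the gradient attached to \<open>Y k\<close> is the one sought.\<close>
  obtain g where g: "Lq M q g" "\<And>e. e \<in> unit_steps \<Longrightarrow> (\<integral>\<omega>. \<bar>F \<omega> e + cgrad g \<omega> e - Y k \<omega> e\<bar> powr q \<partial>M) \<le> \<delta>'"
    using YC[of k] unfolding C_def by blast
  have "(\<integral>\<omega>. \<bar>F \<omega> e + cgrad g \<omega> e\<bar> powr q \<partial>M) \<le> \<delta>" if e: "e \<in> unit_steps" for e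
  proof -
    have L1: "Lq M q (\<lambda>\<omega>. F \<omega> e + cgrad g \<omega> e - Y k \<omega> e)" "Lq M q (\<lambda>\<omega>. F \<omega> e + cgrad g \<omega> e)"
      by (intro Lq_diff Lq_add Lq_cgrad F e g CM YC q0)+
    have L2: "Lq M q (\<lambda>\<omega>. Y k \<omega> e - m e)"
      by (rule Lq_diff[OF CM(5)[OF YC e] _ q0]) (simp add: Lq_def)
    have "(\<integral>\<omega>. \<bar>F \<omega> e + cgrad g \<omega> e\<bar> powr q \<partial>M) \<le>
      (\<integral>\<omega>. 4 powr q * (\<bar>F \<omega> e + cgrad g \<omega> e - Y k \<omega> e\<bar> powr q + (\<bar>Y k \<omega> e - m e\<bar> powr q + \<bar>m e\<bar> powr q)) \<partial>M)"
    proof (rule integral_mono)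
      fix \<omega>
      define a where "a = F \<omega> e + cgrad g \<omega> e - Y k \<omega> e"
      define c where "c = Y k \<omega> e - m e"
      have four: "4 powr q = 2 powr q * (2::real) powr q" by (simp add: powr_mult[symmetric])
      have two: "(1::real) \<le> 2 powr q" using q0 by (intro ge_one_powr_ge_zero) auto
      have "\<bar>a + (c + m e)\<bar> powr q \<le> 2 powr q * (\<bar>a\<bar> powr q + \<bar>c + m e\<bar> powr q)"
        by (rule abs_add_powr_le[OF q0])
      also have "\<dots> \<le> 2 powr q * (2 powr q * \<bar>a\<bar> powr q + 2 powr q * (\<bar>c\<bar> powr q + \<bar>m e\<bar> powr q))"
        using two by (intro mult_left_mono add_mono abs_add_powr_le[OF q0]) (auto simp: mult_le_cancel_right1)
      also have "\<dots> = 4 powr q * (\<bar>a\<bar> powr q + (\<bar>c\<bar> powr q + \<bar>m e\<bar> powr q))"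
        unfolding four by (simp add: algebra_simps)
      finally show "\<bar>F \<omega> e + cgrad g \<omega> e\<bar> powr q \<le> 4 powr q *
        (\<bar>F \<omega> e + cgrad g \<omega> e - Y k \<omega> e\<bar> powr q + (\<bar>Y k \<omega> e - m e\<bar> powr q + \<bar>m e\<bar> powr q))"
        by (simp add: a_def c_def)
    qed (use L1 L2 in \<open>auto simp: Lq_def\<close>)
    also have "\<dots> = 4 powr q * ((\<integral>\<omega>. \<bar>F \<omega> e + cgrad g \<omega> e - Y k \<omega> e\<bar> powr q \<partial>M) +
        ((\<integral>\<omega>. \<bar>Y k \<omega> e - m e\<bar> powr q \<partial>M) + \<bar>m e\<bar> powr q))"
      using L1 L2 by (simp add: Lq_def prob_space)
    also have "\<dots> \<le> 4 powr q * (\<delta>' + (\<delta>' + \<delta>'))"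
      using g(2)[OF e] k[OF e] m_small[OF e] by (intro mult_left_mono add_mono) auto
    also have "\<dots> = \<delta>" by (simp add: \<delta>'_def)
    finally show ?thesis .
  qed
  then show ?thesis using g(1) by blast
qed

end

section \<open>Sublinear growth along orbits\<close>

lemma powr_eventually_dominates:
  fixes s \<eta> q :: real
  assumes "0 < \<eta>" "real d < q" "0 \<le> s"
  shows "\<exists>k0. \<forall>k\<ge>k0. s * (2 ^ k) ^ d \<le> (\<eta> * 2 ^ k) powr q"
proof -
  have one: "(1::real) < 2 powr (q - real d)" using assms by (intro gr_one_powr) auto
  obtain k0 where k0: "s / \<eta> powr q < (2 powr (q - real d)) ^ k0"
    using real_arch_pow[OF one] by blast
  have "s * (2 ^ k) ^ d \<le> (\<eta> * 2 ^ k) powr q" if "k \<ge> k0" for k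
  proof -
    have "s / \<eta> powr q \<le> (2 powr (q - real d)) ^ k"
      using k0 power_increasing[OF that, of "2 powr (q - real d)"] one by linarith
    then have "s \<le> \<eta> powr q * (2 powr (q - real d)) ^ k"
      using assms by (simp add: field_simps)
    then have "s * (2 ^ k) ^ d \<le> \<eta> powr q * (2 powr (q - real d)) ^ k * (2 ^ k) ^ d"
      by (intro mult_right_mono) auto
    also have "\<dots> = \<eta> powr q * ((2 powr (q - real d) * 2 powr real d) ^ k)"
      by (simp add: powr_realpow power_mult_distrib power_mult[symmetric] mult.commute)
    also have "2 powr (q - real d) * 2 powr real d = (2::real) powr q"
      by (simp add: powr_add[symmetric])
    also have "\<eta> powr q * (2 powr q) ^ k = (\<eta> * 2 ^ k) powr q"
      using assms by (simp add: powr_mult powr_powr powr_realpow[symmetric] mult.commute)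
    finally show ?thesis .
  qed
  then show ?thesis by blast
qed

context ergodic_lattice_action
begin

text \<open>Off the exceptional set of the maximal inequality, the sum of the \<open>q\<close>-th
  powers over the cube of scale \<open>k\<close> is below \<open>s * (2 ^ k) ^ CARD('d)\<close>.
  Every single value is therefore of order at most \<open>2^(k d / q)\<close>, which is small
  against \<open>2^k\<close>.\<close>

lemma Lq_sublinear:
  fixes g :: "'w \<Rightarrow> real"
  assumes q: "real CARD('d) < q" and g: "Lq M q g" and \<eta>: "0 < \<eta>" and \<delta>: "0 < \<delta>"
  shows "\<exists>N\<in>sets M. prob N \<le> \<delta> \<and> (\<forall>\<omega>\<in>space M - N. \<exists>k0. \<forall>k\<ge>k0. \<forall>x\<in>ccube k. \<bar>g (T x \<omega>)\<bar> \<le> \<eta> * 2 ^ k)"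
proof -
  define f where "f \<omega> = \<bar>g \<omega>\<bar> powr q" for \<omega>
  have f: "integrable M f" unfolding f_def using g by (rule Lq_integrable_powr)
  have [measurable]: "f \<in> borel_measurable M" using f by auto
  have f0: "0 \<le> f \<omega>" for \<omega> by (simp add: f_def)
  \<comment> \<open>The level at which the maximal inequality yields probability at most
    \<open>\<delta>\<close>; the summand 1 keeps it positive when \<open>g\<close> vanishes almost
    everywhere.\<close>
  define s where "s = 12 ^ CARD('d) * (\<integral>\<omega>. f \<omega> \<partial>M) / \<delta> + 1"
  have i0: "0 \<le> (\<integral>\<omega>. f \<omega> \<partial>M)" using f0 by simp
  then have s: "0 < s" using \<delta> by (auto simp: s_def intro!: add_nonneg_pos)
  define N where "N = {\<omega> \<in> space M. \<exists>k. s * (2 ^ k) ^ CARD('d) \<le> (\<Sum>y\<in>ccube k. f (T y \<omega>))}"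
  have Nm: "N \<in> sets M" unfolding N_def by measurable
  have "prob N \<le> 12 ^ CARD('d) * (\<integral>\<omega>. f \<omega> \<partial>M) / s"
    unfolding N_def using f f0 s by (rule maximal_inequality)
  also have "\<dots> \<le> \<delta>"
  proof -
    have "12 ^ CARD('d) * (\<integral>\<omega>. f \<omega> \<partial>M) = (s - 1) * \<delta>" using \<delta> by (simp add: s_def)
    also have "\<dots> \<le> \<delta> * s" using \<delta> by (simp add: algebra_simps)
    finally show ?thesis using s by (simp add: field_simps)
  qed
  finally have "prob N \<le> \<delta>" .
  moreover obtain k0 where k0: "\<And>k. k \<ge> k0 \<Longrightarrow> s * (2 ^ k) ^ CARD('d) \<le> (\<eta> * 2 ^ k) powr q"
    using powr_eventually_dominates[OF \<eta> q, of s] s by auto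
  have "\<bar>g (T x \<omega>)\<bar> \<le> \<eta> * 2 ^ k" if \<omega>: "\<omega> \<in> space M - N" and k: "k \<ge> k0" and x: "x \<in> ccube k" for \<omega> k x
  proof (rule ccontr)
    assume "\<not> ?thesis"
    then have "(\<eta> * 2 ^ k) powr q \<le> \<bar>g (T x \<omega>)\<bar> powr q"
      using \<eta> q by (intro powr_mono2) auto
    also have "\<dots> \<le> (\<Sum>y\<in>ccube k. f (T y \<omega>))"
      unfolding f_def using x by (intro member_le_sum) auto
    finally have "s * (2 ^ k) ^ CARD('d) \<le> (\<Sum>y\<in>ccube k. f (T y \<omega>))" using k0[OF k] by linarith
    then show False using \<omega> by (auto simp: N_def)
  qed
  ultimately show ?thesis using Nm by blast
qed

text \<open>Adding \<open>g\<close> along the orbit to a potential gives a function whose gradient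
  is the small field \<open>F + cgrad g\<close>. Outside \<open>N1\<close> the Morrey inequality
  bounds its oscillation, and outside \<open>N2\<close> the values of \<open>g\<close> are
  themselves small on large cubes. All potentials are treated at once, so none has to be chosen
  measurably.\<close>

lemma classK_sublinear_at_scale:
  assumes F: "F \<in> classK M T" and \<eta>: "0 < \<eta>"
  shows "AE \<omega> in M. \<exists>k0. \<forall>k\<ge>k0. \<forall>\<phi>. (\<forall>x. \<forall>e\<in>unit_steps. \<phi> (x + e) - \<phi> x = F (T x \<omega>) e) \<longrightarrow>
    (\<forall>x\<in>ccube k. \<bar>\<phi> x - \<phi> 0\<bar> \<le> \<eta> * 2 ^ k)"
proof (rule AE_from_small_exceptions)
  fix \<delta> :: real assume \<delta>: "0 < \<delta>"
  obtain \<alpha> where \<alpha>: "0 < \<alpha>" "\<And>e. e \<in> unit_steps \<Longrightarrow> integrable M (\<lambda>\<omega>. \<bar>F \<omega> e\<bar> powr (real CARD('d) + \<alpha>))"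
    and Fm: "\<And>e. e \<in> unit_steps \<Longrightarrow> (\<lambda>\<omega>. F \<omega> e) \<in> borel_measurable M"
    and mean: "\<And>e. e \<in> unit_steps \<Longrightarrow> (\<integral>\<omega>. F \<omega> e \<partial>M) = 0"
    using F unfolding classK_def by blast
  define q where "q = real CARD('d) + \<alpha>"
  have qd: "real CARD('d) < q" using \<alpha> by (simp add: q_def)
  have "1 \<le> real CARD('d)" by (simp add: Suc_le_eq)
  then have q1: "1 \<le> q" and q0: "0 \<le> q" using qd by linarith+
  have FL: "Lq M q (\<lambda>\<omega>. F \<omega> e)" if "e \<in> unit_steps" for e
    using \<alpha>(2) Fm that by (simp add: Lq_def q_def)
  have comm: "AE \<omega> in M. F \<omega> e' + F (T e' \<omega>) e = F \<omega> e + F (T e \<omega>) e'"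
    if "e \<in> unit_steps" "e' \<in> unit_steps" for e e'
    using classK_potential[OF F] AE_space
  proof eventually_elim
    case (elim \<omega>)
    then obtain \<phi> where \<phi>: "\<And>x e. e \<in> unit_steps \<Longrightarrow> F (T x \<omega>) e = \<phi> (x + e) - \<phi> x" by metis
    show ?case
      using \<phi>[OF that(1), of 0] \<phi>[OF that(2), of 0] \<phi>[OF that(1), of e'] \<phi>[OF that(2), of e] elim
      by (simp add: T_zero add.commute)
  qed
  \<comment> \<open>Morrey is applied on a cube of side \<open>2 ^ Suc k\<close> and contributes
    \<open>\<eta> / 2\<close> times \<open>2 ^ k\<close>; the two values of \<open>g\<close>
    contribute \<open>\<eta> / 8\<close> each.\<close>
  have "\<eta> / 4 > 0" "\<eta> / 8 > 0" using \<eta> by auto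
  from discrete_Morrey[OF qd this(1)] obtain \<epsilon> where \<epsilon>: "0 < \<epsilon>" and Morrey:
    "\<And>K c. \<And>\<phi> D :: int ^ 'd \<Rightarrow> real. (\<And>y. y \<in> icube c (2 ^ K) \<Longrightarrow> 0 \<le> D y) \<Longrightarrow>
      (\<And>y i. y \<in> icube c (2 ^ K) \<Longrightarrow> \<bar>\<phi> (y + axis i 1) - \<phi> y\<bar> \<le> D y) \<Longrightarrow>
      (\<Sum>y\<in>icube c (2 ^ K). D y powr q) \<le> \<epsilon> * (2 ^ K) ^ CARD('d) \<Longrightarrow>
      (\<forall>x\<in>icube c (2 ^ K). \<forall>y\<in>icube c (2 ^ K). \<bar>\<phi> x - \<phi> y\<bar> \<le> \<eta> / 4 * 2 ^ K)"
    by metis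
  \<comment> \<open>The factor \<open>2 ^ CARD('d)\<close> accounts for the side
    \<open>2 ^ Suc k\<close> of \<open>ccube k\<close>.\<close>
  define s where "s = \<epsilon> * 2 ^ CARD('d)"
  have s: "0 < s" using \<epsilon> by (simp add: s_def)
  define u where "u = real (card (unit_steps :: (int ^ 'd) set))"
  have u: "0 < u" using unit_steps_nonempty by (simp add: u_def card_gt_0_iff)
  \<comment> \<open>Solved so that the maximal inequality for \<open>f\<close> gives
    \<open>\<delta> / 2\<close>. The factor \<open>u powr q\<close> comes from bounding the power of
    a sum over the unit steps by the sum of powers, the other \<open>u\<close> from the number of
    terms.\<close>
  define \<delta>1 where "\<delta>1 = \<delta> / 2 * s / (12 ^ CARD('d) * u powr q * u)"
  have \<delta>1: "0 < \<delta>1" using \<delta> s u by (simp add: \<delta>1_def)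
  obtain g where g: "Lq M q g" and gs: "\<And>e. e \<in> unit_steps \<Longrightarrow> (\<integral>\<omega>. \<bar>F \<omega> e + cgrad g \<omega> e\<bar> powr q \<partial>M) \<le> \<delta>1"
    using cocycle_decomposition[of q F \<delta>1, OF q1] FL mean comm \<delta>1 by auto
  define R where "R \<omega> e = \<bar>F \<omega> e + cgrad g \<omega> e\<bar>" for \<omega> e
  have RL: "integrable M (\<lambda>\<omega>. R \<omega> e powr q)" if "e \<in> unit_steps" for e
    using Lq_add[OF FL[OF that] Lq_cgrad[OF g q0, of e] q0] by (simp add: R_def Lq_def)
  define f where "f \<omega> = u powr q * (\<Sum>e\<in>unit_steps. R \<omega> e powr q)" for \<omega>
  have f: "integrable M f" unfolding f_def using RL by auto
  have [measurable]: "f \<in> borel_measurable M" using f by auto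
  have f0: "0 \<le> f \<omega>" for \<omega> unfolding f_def by (intro mult_nonneg_nonneg sum_nonneg) auto
  have fint: "(\<integral>\<omega>. f \<omega> \<partial>M) \<le> u powr q * (u * \<delta>1)"
  proof -
    have "(\<integral>\<omega>. f \<omega> \<partial>M) = u powr q * (\<Sum>e\<in>unit_steps. \<integral>\<omega>. R \<omega> e powr q \<partial>M)"
      unfolding f_def using RL by simp
    also have "\<dots> \<le> u powr q * (\<Sum>e\<in>(unit_steps :: (int ^ 'd) set). \<delta>1)"
      using gs by (intro mult_left_mono sum_mono) (auto simp: R_def)
    finally show ?thesis by (simp add: u_def)
  qed
  define N1 where "N1 = {\<omega> \<in> space M. \<exists>k. s * (2 ^ k) ^ CARD('d) \<le> (\<Sum>y\<in>ccube k. f (T y \<omega>))}"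
  have N1m: "N1 \<in> sets M" unfolding N1_def by measurable
  have "prob N1 \<le> 12 ^ CARD('d) * (\<integral>\<omega>. f \<omega> \<partial>M) / s"
    unfolding N1_def using f f0 s by (rule maximal_inequality)
  also have "\<dots> \<le> 12 ^ CARD('d) * (u powr q * (u * \<delta>1)) / s"
    using s by (intro divide_right_mono mult_left_mono fint) auto
  also have "\<dots> = \<delta> / 2" using s u by (simp add: \<delta>1_def)
  finally have N1: "prob N1 \<le> \<delta> / 2" .
  obtain N2 where N2m: "N2 \<in> sets M" and N2: "prob N2 \<le> \<delta> / 2"
    and N2g: "\<And>\<omega>. \<omega> \<in> space M - N2 \<Longrightarrow> \<exists>k0. \<forall>k\<ge>k0. \<forall>x\<in>ccube k. \<bar>g (T x \<omega>)\<bar> \<le> \<eta> / 8 * 2 ^ k"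
    using Lq_sublinear[OF qd g \<open>\<eta> / 8 > 0\<close>, of "\<delta> / 2"] \<delta> by auto
  have "prob (N1 \<union> N2) \<le> \<delta>"
    using measure_Un_le[OF N1m N2m] N1 N2 by linarith
  moreover have "\<exists>k0. \<forall>k\<ge>k0. \<forall>\<phi>. (\<forall>x. \<forall>e\<in>unit_steps. \<phi> (x + e) - \<phi> x = F (T x \<omega>) e) \<longrightarrow>
    (\<forall>x\<in>ccube k. \<bar>\<phi> x - \<phi> 0\<bar> \<le> \<eta> * 2 ^ k)" if \<omega>: "\<omega> \<in> space M - (N1 \<union> N2)" for \<omega>
  proof -
    have sp: "\<omega> \<in> space M" using \<omega> by simp
    from \<omega> obtain k0 where k0: "\<And>k x. k \<ge> k0 \<Longrightarrow> x \<in> ccube k \<Longrightarrow> \<bar>g (T x \<omega>)\<bar> \<le> \<eta> / 8 * 2 ^ k"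
      using N2g[of \<omega>] by auto
    have "\<bar>\<phi> x - \<phi> 0\<bar> \<le> \<eta> * 2 ^ k"
      if k: "k \<ge> k0" and \<phi>: "\<forall>x. \<forall>e\<in>unit_steps. \<phi> (x + e) - \<phi> x = F (T x \<omega>) e" and x: "x \<in> ccube k"
      for k \<phi> x
    proof -
      define \<psi> where "\<psi> x = \<phi> x + g (T x \<omega>)" for x
      define D where "D y = (\<Sum>e\<in>unit_steps. R (T y \<omega>) e)" for y
      have R0: "0 \<le> R \<omega> e" for \<omega> e by (simp add: R_def)
      have "\<forall>x\<in>ccube k. \<forall>y\<in>ccube k. \<bar>\<psi> x - \<psi> y\<bar> \<le> \<eta> / 4 * 2 ^ Suc k"
        unfolding ccube_def
      proof (rule Morrey)
        show "0 \<le> D y" for y using R0 by (simp add: D_def sum_nonneg)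
        fix y :: "int ^ 'd" and i :: 'd
        have "\<psi> (y + axis i 1) - \<psi> y = F (T y \<omega>) (axis i 1) + cgrad g (T y \<omega>) (axis i 1)"
          using \<phi>[rule_format, of "axis i 1" y] T_add[OF sp, of "axis i 1" y]
          by (simp add: \<psi>_def cgrad_def add.commute)
        then have "\<bar>\<psi> (y + axis i 1) - \<psi> y\<bar> = R (T y \<omega>) (axis i 1)" by (simp add: R_def)
        also have "\<dots> \<le> D y" unfolding D_def using R0 by (intro member_le_sum) auto
        finally show "\<bar>\<psi> (y + axis i 1) - \<psi> y\<bar> \<le> D y" .
      next
        have "(\<Sum>y\<in>ccube k. D y powr q) \<le> (\<Sum>y\<in>ccube k. f (T y \<omega>))"
          unfolding D_def f_def u_def using q0 R0 by (intro sum_mono sum_powr_le) auto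
        also have "\<dots> \<le> s * (2 ^ k) ^ CARD('d)"
          using \<omega> by (auto simp: N1_def not_le intro: less_imp_le)
        also have "\<dots> = \<epsilon> * (2 ^ Suc k) ^ CARD('d)" by (simp add: s_def power_mult_distrib)
        finally show "(\<Sum>y\<in>icube (\<chi> i. - (2 ^ k)) (2 ^ Suc k). D y powr q) \<le> \<epsilon> * (2 ^ Suc k) ^ CARD('d)"
          by (simp add: ccube_def)
      qed
      then have "\<bar>\<psi> x - \<psi> 0\<bar> \<le> \<eta> / 4 * 2 ^ Suc k" using x zero_mem_ccube by blast
      moreover have "\<bar>g (T x \<omega>)\<bar> \<le> \<eta> / 8 * 2 ^ k" "\<bar>g (T 0 \<omega>)\<bar> \<le> \<eta> / 8 * 2 ^ k"
        using k0[OF k x] k0[OF k zero_mem_ccube] by auto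
      moreover have "0 \<le> \<eta> * 2 ^ k" using \<eta> by simp
      ultimately show ?thesis unfolding \<psi>_def power_Suc by linarith
    qed
    then show ?thesis by blast
  qed
  ultimately show "\<exists>N\<in>sets M. prob N \<le> \<delta> \<and> (\<forall>\<omega>\<in>space M - N. \<exists>k0. \<forall>k\<ge>k0. \<forall>\<phi>.
      (\<forall>x. \<forall>e\<in>unit_steps. \<phi> (x + e) - \<phi> x = F (T x \<omega>) e) \<longrightarrow> (\<forall>x\<in>ccube k. \<bar>\<phi> x - \<phi> 0\<bar> \<le> \<eta> * 2 ^ k))"
    using N1m N2m by (intro bexI[of _ "N1 \<union> N2"]) auto
qed

end

section \<open>The partition function and the upper bound\<close>

text \<open>Almost sure positivity accompanies the moment bound because \<open>ln 0 = 0\<close>: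
  integrability of the logarithm alone would allow vanishing transition probabilities.\<close>

locale random_environment = ergodic_lattice_action M T
  for M :: "'w measure" and T :: "int ^ 'd \<Rightarrow> 'w \<Rightarrow> 'w" +
  fixes p :: "'w \<Rightarrow> int ^ 'd \<Rightarrow> real" and lam :: "real ^ 'd"
  assumes p_meas: "e \<in> unit_steps \<Longrightarrow> (\<lambda>\<omega>. p \<omega> e) \<in> borel_measurable M"
    and p_nonneg: "\<omega> \<in> space M \<Longrightarrow> e \<in> unit_steps \<Longrightarrow> 0 \<le> p \<omega> e"
    and p_sum: "\<omega> \<in> space M \<Longrightarrow> (\<Sum>e\<in>unit_steps. p \<omega> e) = 1"
    and log_moment: "\<exists>\<alpha>>0. \<forall>e\<in>unit_steps. (AE \<omega> in M. p \<omega> e > 0) \<and>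
                       integrable M (\<lambda>\<omega>. \<bar>ln (p \<omega> e)\<bar> powr (real CARD('d) + \<alpha>))"
begin

section \<open>The tilted kernel and its partition function\<close>

definition K :: "'w \<Rightarrow> int ^ 'd \<Rightarrow> real" where
  "K \<omega> e = p \<omega> e * exp (lam \<bullet> to_real_vec e)"

definition Z :: "nat \<Rightarrow> 'w \<Rightarrow> real" where
  "Z n \<omega> = quenched_mgf T p \<omega> lam n"

lemma inner_unit_step_le:
  assumes "e \<in> unit_steps"
  shows "\<bar>lam \<bullet> to_real_vec e\<bar> \<le> norm lam"
proof -
  have "norm (to_real_vec e) \<le> (\<Sum>i\<in>UNIV. \<bar>to_real_vec e $ i\<bar>)" by (rule norm_le_l1_cart)
  also have "\<dots> = real_of_int (l1norm e)" by (simp add: to_real_vec_def l1norm_def)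
  also have "\<dots> = 1" using assms by (simp add: unit_steps_def)
  finally have "norm lam * norm (to_real_vec e) \<le> norm lam * 1" by (intro mult_left_mono) auto
  then show ?thesis using Cauchy_Schwarz_ineq2[of lam "to_real_vec e"] by linarith
qed

lemma K_measurable [measurable]: "e \<in> unit_steps \<Longrightarrow> (\<lambda>\<omega>. K \<omega> e) \<in> borel_measurable M"
  using p_meas unfolding K_def by measurable

lemma K_nonneg: "\<omega> \<in> space M \<Longrightarrow> e \<in> unit_steps \<Longrightarrow> 0 \<le> K \<omega> e"
  using p_nonneg by (simp add: K_def)

lemma sum_K_bounds:
  assumes "\<omega> \<in> space M"
  shows "exp (- norm lam) \<le> (\<Sum>e\<in>unit_steps. K \<omega> e)" "(\<Sum>e\<in>unit_steps. K \<omega> e) \<le> exp (norm lam)"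
proof -
  have "(\<Sum>e\<in>unit_steps. p \<omega> e * exp (- norm lam)) \<le> (\<Sum>e\<in>unit_steps. K \<omega> e)"
    unfolding K_def using inner_unit_step_le p_nonneg[OF assms]
    by (intro sum_mono mult_left_mono) (auto simp: abs_le_iff minus_le_iff)
  then show "exp (- norm lam) \<le> (\<Sum>e\<in>unit_steps. K \<omega> e)"
    using p_sum[OF assms] by (simp add: sum_distrib_right[symmetric])
  have "(\<Sum>e\<in>unit_steps. K \<omega> e) \<le> (\<Sum>e\<in>unit_steps. p \<omega> e * exp (norm lam))"
    unfolding K_def using inner_unit_step_le p_nonneg[OF assms]
    by (intro sum_mono mult_left_mono) (auto simp: abs_le_iff)
  then show "(\<Sum>e\<in>unit_steps. K \<omega> e) \<le> exp (norm lam)"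
    using p_sum[OF assms] by (simp add: sum_distrib_right[symmetric])
qed

lemma AE_K_pos: "AE \<omega> in M. \<forall>e\<in>unit_steps. 0 < K \<omega> e"
proof -
  have "AE \<omega> in M. \<forall>e\<in>unit_steps. 0 < p \<omega> e" using log_moment by (intro AE_finite_allI) auto
  then show ?thesis by eventually_elim (simp add: K_def)
qed

lemma Z_0: "Z 0 \<omega> = 1"
proof -
  have "{es :: (int ^ 'd) list. length es = 0 \<and> set es \<subseteq> unit_steps} = {[]}" by auto
  moreover have "to_real_vec (0 :: int ^ 'd) = 0" by (simp add: to_real_vec_def vec_eq_iff)
  ultimately show ?thesis
    by (simp add: Z_def quenched_mgf_def path_prob_def walk_pos_def)
qed

text \<open>Conditioning on the first step: the rest of the walk starts afresh in the environment
  shifted by that step.\<close>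

lemma Z_Suc:
  assumes \<omega>: "\<omega> \<in> space M"
  shows "Z (Suc n) \<omega> = (\<Sum>e\<in>unit_steps. K \<omega> e * Z n (T e \<omega>))"
proof -
  define P where "P n = {es :: (int ^ 'd) list. length es = n \<and> set es \<subseteq> unit_steps}" for n
  have P: "P (Suc n) = (\<lambda>(e, es). e # es) ` (unit_steps \<times> P n)"
    by (force simp: P_def image_iff length_Suc_conv)
  have inj: "inj_on (\<lambda>(e, es). e # es) (unit_steps \<times> P n)" by (auto simp: inj_on_def)
  have trv: "to_real_vec (x + y) = to_real_vec x + to_real_vec y" for x y :: "int ^ 'd"
    by (simp add: to_real_vec_def vec_eq_iff)
  have weight: "path_prob T p \<omega> (e # es) * exp (lam \<bullet> to_real_vec (walk_pos (e # es) (Suc n))) =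
      K \<omega> e * (path_prob T p (T e \<omega>) es * exp (lam \<bullet> to_real_vec (walk_pos es n)))" for e es
  proof -
    have "path_prob T p \<omega> (e # es) = p \<omega> e * path_prob T p (T e \<omega>) es"
      unfolding path_prob_def
      using \<omega> T_add[OF \<omega>, of _ e]
      by (simp add: prod.lessThan_Suc_shift walk_pos_def T_zero add.commute[of e] del: prod.lessThan_Suc)
    moreover have "walk_pos (e # es) (Suc n) = e + walk_pos es n" by (simp add: walk_pos_def)
    ultimately show ?thesis by (simp add: K_def trv inner_add_right exp_add)
  qed
  have "Z (Suc n) \<omega> = (\<Sum>(e, es)\<in>unit_steps \<times> P n.
      K \<omega> e * (path_prob T p (T e \<omega>) es * exp (lam \<bullet> to_real_vec (walk_pos es n))))"
    unfolding Z_def quenched_mgf_def P_def[symmetric] P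
    by (subst sum.reindex[OF inj]) (simp add: case_prod_unfold weight)
  also have "\<dots> = (\<Sum>e\<in>unit_steps. K \<omega> e * Z n (T e \<omega>))"
    by (simp add: Z_def quenched_mgf_def P_def sum.cartesian_product[symmetric] sum_distrib_left)
  finally show ?thesis .
qed

lemma Z_measurable [measurable]: "Z n \<in> borel_measurable M"
proof (induction n)
  case 0
  then show ?case using Z_0 by (simp add: measurable_cong[of M "Z 0" "\<lambda>_. 1"])
next
  case (Suc n)
  have [measurable]: "Z n \<in> borel_measurable M" by (rule Suc)
  have "(\<lambda>\<omega>. \<Sum>e\<in>unit_steps. K \<omega> e * Z n (T e \<omega>)) \<in> borel_measurable M" by measurable
  then show ?case by (subst measurable_cong[OF Z_Suc]) auto
qed

text \<open>The recursion has nonnegative weights, so the comparison of \<open>Z 1\<close> with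
  \<open>Z 0 = 1\<close> from \<open>sum_K_bounds\<close> propagates to every later pair.\<close>

lemma Z_step_bounds:
  assumes "\<omega> \<in> space M"
  shows "0 < Z n \<omega> \<and> exp (- norm lam) * Z n \<omega> \<le> Z (Suc n) \<omega> \<and> Z (Suc n) \<omega> \<le> exp (norm lam) * Z n \<omega>"
  using assms
proof (induction n arbitrary: \<omega>)
  case 0
  then show ?case using sum_K_bounds by (simp add: Z_Suc Z_0)
next
  case (Suc n)
  have IH: "0 < Z n (T e \<omega>)" "exp (- norm lam) * Z n (T e \<omega>) \<le> Z (Suc n) (T e \<omega>)"
    "Z (Suc n) (T e \<omega>) \<le> exp (norm lam) * Z n (T e \<omega>)" for e
    using Suc.IH[OF T_space[OF Suc.prems]] by auto
  have "0 < exp (- norm lam) * Z n \<omega>" using Suc by simp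
  also have "\<dots> \<le> Z (Suc n) \<omega>" using Suc by blast
  finally have pos: "0 < Z (Suc n) \<omega>" .
  have "exp (- norm lam) * Z (Suc n) \<omega> = (\<Sum>e\<in>unit_steps. K \<omega> e * (exp (- norm lam) * Z n (T e \<omega>)))"
    using Suc.prems by (simp add: Z_Suc sum_distrib_left mult_ac)
  also have "\<dots> \<le> (\<Sum>e\<in>unit_steps. K \<omega> e * Z (Suc n) (T e \<omega>))"
    using Suc.prems IH K_nonneg by (intro sum_mono mult_left_mono) auto
  also have "\<dots> = Z (Suc (Suc n)) \<omega>" by (rule Z_Suc[OF Suc.prems, symmetric])
  finally have 1: "exp (- norm lam) * Z (Suc n) \<omega> \<le> Z (Suc (Suc n)) \<omega>" .
  have "Z (Suc (Suc n)) \<omega> = (\<Sum>e\<in>unit_steps. K \<omega> e * Z (Suc n) (T e \<omega>))" by (rule Z_Suc[OF Suc.prems])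
  also have "\<dots> \<le> (\<Sum>e\<in>unit_steps. K \<omega> e * (exp (norm lam) * Z n (T e \<omega>)))"
    using Suc.prems IH K_nonneg by (intro sum_mono mult_left_mono) auto
  also have "\<dots> = exp (norm lam) * Z (Suc n) \<omega>"
    using Suc.prems by (simp add: Z_Suc sum_distrib_left mult_ac)
  finally show ?case using pos 1 by simp
qed

lemma Z_pos: "\<omega> \<in> space M \<Longrightarrow> 0 < Z n \<omega>"
  using Z_step_bounds by blast

lemma abs_ln_Z_le:
  assumes "\<omega> \<in> space M"
  shows "\<bar>ln (Z n \<omega>)\<bar> \<le> real n * norm lam"
proof (induction n)
  case (Suc n)
  have z: "0 < Z n \<omega>" "0 < Z (Suc n) \<omega>" using Z_pos[OF assms] by auto
  have "ln (exp (- norm lam) * Z n \<omega>) \<le> ln (Z (Suc n) \<omega>)" "ln (Z (Suc n) \<omega>) \<le> ln (exp (norm lam) * Z n \<omega>)"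
    using Z_step_bounds[OF assms, of n] z by (auto intro!: ln_mono)
  then show ?case using Suc z by (simp add: ln_mult algebra_simps abs_le_iff)
qed (simp add: Z_0)

lemma K_mult_Z_le:
  assumes "\<omega> \<in> space M" "e \<in> unit_steps"
  shows "K \<omega> e * Z n (T e \<omega>) \<le> Z (Suc n) \<omega>"
  unfolding Z_Suc[OF assms(1)] using assms K_nonneg Z_pos[OF T_space]
  by (intro member_le_sum) (auto intro!: mult_nonneg_nonneg intro: less_imp_le)

section \<open>Comparison with supersolutions\<close>

text \<open>Multiplied by \<open>exp A\<close>, the supersolution \<open>exp \<phi>\<close>
  dominates \<open>Z 0 = 1\<close> at all sites that matter, and each step of the recursion costs at
  most a factor \<open>exp S\<close>. The lower bound on \<open>\<phi>\<close> is asked only within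
  sup-distance \<open>n\<close> of the start, since a walk of \<open>n\<close> steps stays
  there.\<close>

lemma Z_le_supersolution:
  assumes \<omega>: "\<omega> \<in> space M"
    and super: "\<And>x. (\<Sum>e\<in>unit_steps. K (T x \<omega>) e * exp (\<phi> (x + e))) \<le> exp (S + \<phi> x)"
    and low: "\<And>y. (\<forall>i. \<bar>y $ i - x $ i\<bar> \<le> int n) \<Longrightarrow> - A \<le> \<phi> y"
  shows "Z n (T x \<omega>) \<le> exp (real n * S + \<phi> x + A)"
  using low
proof (induction n arbitrary: x)
  case 0
  then have "- A \<le> \<phi> x" by auto
  then show ?case by (simp add: Z_0)
next
  case (Suc n)
  have IH: "Z n (T e (T x \<omega>)) \<le> exp (real n * S + A) * exp (\<phi> (x + e))" if e: "e \<in> unit_steps" for e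
  proof -
    have "Z n (T (x + e) \<omega>) \<le> exp (real n * S + \<phi> (x + e) + A)"
    proof (rule Suc.IH)
      fix y assume y: "\<forall>i. \<bar>y $ i - (x + e) $ i\<bar> \<le> int n"
      show "- A \<le> \<phi> y"
      proof (rule Suc.prems, rule allI)
        fix i
        have "\<bar>e $ i\<bar> \<le> 1" using abs_nth_le_l1norm[of e i] e by (simp add: unit_steps_def)
        with y[rule_format, of i] show "\<bar>y $ i - x $ i\<bar> \<le> int (Suc n)" by simp
      qed
    qed
    then show ?thesis using T_add[OF \<omega>, of e x] by (simp add: exp_add mult_ac add.commute)
  qed
  have "Z (Suc n) (T x \<omega>) = (\<Sum>e\<in>unit_steps. K (T x \<omega>) e * Z n (T e (T x \<omega>)))"
    by (rule Z_Suc[OF T_space[OF \<omega>]])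
  also have "\<dots> \<le> (\<Sum>e\<in>unit_steps. K (T x \<omega>) e * (exp (real n * S + A) * exp (\<phi> (x + e))))"
    using K_nonneg[OF T_space[OF \<omega>]] IH by (intro sum_mono mult_left_mono) auto
  also have "\<dots> = exp (real n * S + A) * (\<Sum>e\<in>unit_steps. K (T x \<omega>) e * exp (\<phi> (x + e)))"
    by (simp add: sum_distrib_left mult_ac)
  also have "\<dots> \<le> exp (real n * S + A) * exp (S + \<phi> x)" by (intro mult_left_mono super) auto
  also have "\<dots> = exp (real (Suc n) * S + \<phi> x + A)" by (simp add: exp_add[symmetric] algebra_simps)
  finally show ?case .
qed

lemma growth_rate_le:
  assumes F: "F \<in> classK M T"
    and S: "AE \<omega> in M. (\<Sum>e\<in>unit_steps. K \<omega> e * exp (F \<omega> e)) \<le> exp S"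
    and \<eta>: "0 < \<eta>"
  shows "AE \<omega> in M. \<forall>\<^sub>F n in sequentially. ln (Z n \<omega>) / real n \<le> S + \<eta>"
proof -
  have e2: "0 < \<eta> / 2" using \<eta> by simp
  show ?thesis
    using AE_space AE_T_all[OF S] classK_potential[OF F] classK_sublinear_at_scale[OF F e2]
  proof eventually_elim
    case (elim \<omega>)
    then obtain \<phi> where \<phi>: "\<forall>x. \<forall>e\<in>unit_steps. \<phi> (x + e) - \<phi> x = F (T x \<omega>) e" by blast
    from elim(4) \<phi> obtain k0 where k0: "\<And>k x. k \<ge> k0 \<Longrightarrow> x \<in> ccube k \<Longrightarrow> \<bar>\<phi> x - \<phi> 0\<bar> \<le> \<eta> / 2 * 2 ^ k"
      by blast
    have super: "(\<Sum>e\<in>unit_steps. K (T x \<omega>) e * exp (\<phi> (x + e))) \<le> exp (S + \<phi> x)" for x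
    proof -
      have "(\<Sum>e\<in>unit_steps. K (T x \<omega>) e * exp (\<phi> (x + e))) =
          exp (\<phi> x) * (\<Sum>e\<in>unit_steps. K (T x \<omega>) e * exp (F (T x \<omega>) e))"
        unfolding sum_distrib_left
      proof (rule sum.cong)
        fix e :: "int ^ 'd" assume "e \<in> unit_steps"
        then have "\<phi> (x + e) = \<phi> x + F (T x \<omega>) e" using \<phi>[rule_format, of e x] by simp
        then show "K (T x \<omega>) e * exp (\<phi> (x + e)) = exp (\<phi> x) * (K (T x \<omega>) e * exp (F (T x \<omega>) e))"
          by (simp add: exp_add)
      qed simp
      also have "\<dots> \<le> exp (\<phi> x) * exp S" using elim(2) by (intro mult_left_mono) auto
      finally show ?thesis by (simp add: exp_add mult.commute)
    qed
    show ?case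
      using eventually_ge_at_top[of "2 ^ k0"]
    proof eventually_elim
      case (elim n)
      have n0: "0 < n" using elim by (meson less_le_trans zero_less_numeral zero_less_power)
      \<comment> \<open>The least power of two above \<open>n\<close>: its cube contains every site
        reachable in \<open>n\<close> steps, and as it is at most \<open>2 * n\<close> the
        oscillation bound becomes \<open>\<eta> * n\<close>.\<close>
      have "\<exists>k\<ge>k0. n < 2 ^ k \<and> 2 ^ k \<le> 2 * n"
      proof -
        have ex: "\<exists>k. n < 2 ^ k" using less_exp by blast
        define k where "k = (LEAST k. n < 2 ^ k)"
        have k: "n < 2 ^ k" unfolding k_def by (rule LeastI_ex[OF ex])
        have "k \<noteq> 0" using k n0 by (cases k) auto
        then obtain j where j: "k = Suc j" by (cases k) auto
        have "\<not> n < 2 ^ j" using not_less_Least[of j "\<lambda>k. n < 2 ^ k"] j by (simp add: k_def)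
        then have "2 ^ k \<le> 2 * n" using j by simp
        moreover have "k0 < k"
        proof -
          have "(2::nat) ^ k0 < 2 ^ k" using elim k by linarith
          then show ?thesis by simp
        qed
        ultimately show ?thesis using k by (intro exI[of _ k]) auto
      qed
      then obtain k where k: "k \<ge> k0" "n < 2 ^ k" "2 ^ k \<le> 2 * n" by blast
      \<comment> \<open>The term \<open>\<phi> 0\<close> enters \<open>A\<close> with a minus sign
        and cancels the value at the starting point, so the additive constant of the potential
        disappears.\<close>
      have low: "- (\<eta> / 2 * 2 ^ k - \<phi> 0) \<le> \<phi> y" if y: "\<forall>i. \<bar>y $ i - (0 :: int ^ 'd) $ i\<bar> \<le> int n" for y
      proof -
        have "int n < 2 ^ k" using k(2) by (metis of_nat_less_iff of_nat_numeral of_nat_power)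
        then have "- (2 ^ k) \<le> y $ i \<and> y $ i < 2 ^ k" for i
          using y[rule_format, of i] by (simp only: zero_index) linarith
        then have "y \<in> ccube k" by (simp add: mem_ccube)
        from k0[OF k(1) this] show ?thesis by linarith
      qed
      have "Z n (T 0 \<omega>) \<le> exp (real n * S + \<phi> 0 + (\<eta> / 2 * 2 ^ k - \<phi> 0))"
        by (rule Z_le_supersolution[OF \<open>\<omega> \<in> space M\<close> super low])
      then have "Z n \<omega> \<le> exp (real n * S + \<eta> / 2 * 2 ^ k)"
        using \<open>\<omega> \<in> space M\<close> by (simp add: T_zero)
      then have "ln (Z n \<omega>) \<le> real n * S + \<eta> / 2 * 2 ^ k"
        using Z_pos[OF \<open>\<omega> \<in> space M\<close>, of n] by (metis ln_exp ln_mono exp_gt_zero)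
      also have "\<eta> / 2 * 2 ^ k \<le> \<eta> / 2 * (2 * real n)"
      proof (rule mult_left_mono)
        show "2 ^ k \<le> 2 * real n" using k(3) by (metis of_nat_le_iff of_nat_mult of_nat_numeral of_nat_power)
      qed (use \<eta> in simp)
      finally show ?case using n0 by (simp add: field_simps)
    qed
  qed
qed

end

section \<open>The lower bound\<close>

definition loop_sums_vanish :: "(int ^ 'd \<Rightarrow> 'w \<Rightarrow> 'w) \<Rightarrow> ('w \<Rightarrow> int ^ 'd \<Rightarrow> real) \<Rightarrow> 'w \<Rightarrow> bool" where
  "loop_sums_vanish T F \<omega> \<longleftrightarrow> (\<forall>xs::(int ^ 'd) list. xs \<noteq> [] \<longrightarrow> hd xs = last xs \<longrightarrow>
     (\<forall>i. Suc i < length xs \<longrightarrow> xs ! Suc i - xs ! i \<in> unit_steps) \<longrightarrow>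
     (\<Sum>i<length xs - 1. F (T (xs ! i) \<omega>) (xs ! Suc i - xs ! i)) = 0)"

lemma loop_sums_vanish_midpoint:
  assumes "loop_sums_vanish T F \<omega>" "loop_sums_vanish T G \<omega>"
  shows "loop_sums_vanish T (\<lambda>\<omega> e. (F \<omega> e + G \<omega> e) / 2) \<omega>"
  using assms unfolding loop_sums_vanish_def
  by (simp add: sum_divide_distrib[symmetric] sum.distrib)

lemma loop_sums_vanish_limit:
  fixes T :: "int ^ 'd \<Rightarrow> 'w \<Rightarrow> 'w"
  assumes "\<And>k. loop_sums_vanish T (F k) \<omega>"
    and lim: "\<And>x e. e \<in> unit_steps \<Longrightarrow> (\<lambda>k. F k (T x \<omega>) e) \<longlonglongrightarrow> G (T x \<omega>) e"
  shows "loop_sums_vanish T G \<omega>"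
  unfolding loop_sums_vanish_def
proof (intro allI impI)
  fix xs :: "(int ^ 'd) list"
  assume xs: "xs \<noteq> []" "hd xs = last xs" "\<forall>i. Suc i < length xs \<longrightarrow> xs ! Suc i - xs ! i \<in> unit_steps"
  have "(\<lambda>k. \<Sum>i<length xs - 1. F k (T (xs ! i) \<omega>) (xs ! Suc i - xs ! i)) \<longlonglongrightarrow>
      (\<Sum>i<length xs - 1. G (T (xs ! i) \<omega>) (xs ! Suc i - xs ! i))"
    using xs(3) by (intro tendsto_sum lim) auto
  moreover have "(\<Sum>i<length xs - 1. F k (T (xs ! i) \<omega>) (xs ! Suc i - xs ! i)) = 0" for k
    using assms(1)[of k] xs unfolding loop_sums_vanish_def by blast
  ultimately show "(\<Sum>i<length xs - 1. G (T (xs ! i) \<omega>) (xs ! Suc i - xs ! i)) = 0"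
    by (simp add: LIMSEQ_const_iff)
qed

lemma (in ergodic_lattice_action) loop_sums_vanish_gradient:
  assumes \<omega>: "\<omega> \<in> space M"
  shows "loop_sums_vanish T (cgrad g) \<omega>"
  unfolding loop_sums_vanish_def
proof (intro allI impI)
  fix xs :: "(int ^ 'd) list"
  assume xs: "xs \<noteq> []" "hd xs = last xs"
  have "cgrad g (T (xs ! i) \<omega>) (xs ! Suc i - xs ! i) = g (T (xs ! Suc i) \<omega>) - g (T (xs ! i) \<omega>)" for i
    using T_add[OF \<omega>, of "xs ! Suc i - xs ! i" "xs ! i"] by (simp add: cgrad_def)
  then have "(\<Sum>i<length xs - 1. cgrad g (T (xs ! i) \<omega>) (xs ! Suc i - xs ! i)) =
      g (T (xs ! (length xs - 1)) \<omega>) - g (T (xs ! 0) \<omega>)"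
    using sum_lessThan_telescope[of "\<lambda>i. g (T (xs ! i) \<omega>)" "length xs - 1"] by simp
  then show "(\<Sum>i<length xs - 1. cgrad g (T (xs ! i) \<omega>) (xs ! Suc i - xs ! i)) = 0"
    using xs by (simp add: hd_conv_nth last_conv_nth)
qed

lemma classK_I:
  assumes "0 < \<alpha>" "\<And>e. e \<in> unit_steps \<Longrightarrow> Lq M (real CARD('d) + \<alpha>) (\<lambda>\<omega>. F \<omega> e)"
    and "\<And>e. e \<in> unit_steps \<Longrightarrow> (\<integral>\<omega>. F \<omega> e \<partial>M) = 0"
    and "AE \<omega> in M. loop_sums_vanish T F \<omega>"
  shows "F \<in> classK M (T :: int ^ 'd \<Rightarrow> 'w \<Rightarrow> 'w)"
  using assms unfolding classK_def Lq_def loop_sums_vanish_def by blast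

section \<open>The zero-one alternative for the decay of the normalized partition function\<close>

context random_environment
begin

text \<open>The event that the infimum over \<open>n\<close> of \<open>exp (- t n) Z_n\<close> is 0,
  written with countably many levels so that measurability is immediate.\<close>

definition steep :: "real \<Rightarrow> 'w set" where
  "steep t = {\<omega> \<in> space M. \<forall>j::nat. \<exists>n. exp (- t * real n) * Z n \<omega> < 1 / real (Suc j)}"

lemma steep_measurable [measurable]: "steep t \<in> sets M"
  unfolding steep_def by measurable

lemma steepD:
  assumes "\<omega> \<in> steep t" "0 < c"
  shows "\<exists>n. exp (- t * real n) * Z n \<omega> < c"
proof -
  obtain j where "1 / real (Suc j) < c" using assms(2) by (metis nat_approx_posE)
  moreover obtain n where "exp (- t * real n) * Z n \<omega> < 1 / real (Suc j)"
    using assms(1) by (auto simp: steep_def)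
  ultimately show ?thesis by (meson less_trans)
qed

text \<open>A walk may begin with the step \<open>e\<close>, so \<open>Z m\<close> in the shifted
  environment is at most \<open>Z (Suc m)\<close> in the original one divided by the weight of that
  step. A fixed factor does not affect an infimum equal to zero.\<close>

lemma steep_step:
  assumes \<omega>: "\<omega> \<in> steep t" and e: "e \<in> unit_steps" and K: "0 < K \<omega> e"
  shows "T e \<omega> \<in> steep t"
proof -
  have sp: "\<omega> \<in> space M" using \<omega> by (simp add: steep_def)
  have "\<exists>n. exp (- t * real n) * Z n (T e \<omega>) < 1 / real (Suc j)" for j
  proof -
    \<comment> \<open>The entry 1 excludes \<open>n = 0\<close>, where the value is exactly 1; the
      other entry absorbs the cost of the first step.\<close>
    define c where "c = min 1 (K \<omega> e * exp (- t) / real (Suc j))"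
    have "0 < c" using K by (simp add: c_def)
    from steepD[OF \<omega> this] obtain n where n: "exp (- t * real n) * Z n \<omega> < c" by blast
    then have "n \<noteq> 0" using Z_0 by (cases n) (auto simp: c_def)
    then obtain m where m: "n = Suc m" by (cases n) auto
    have "K \<omega> e * Z m (T e \<omega>) \<le> Z n \<omega>" using K_mult_Z_le[OF sp e] m by simp
    then have "exp (- t * real n) * (K \<omega> e * Z m (T e \<omega>)) < c"
      using n by (smt (verit) exp_gt_zero mult_left_mono)
    also have "c \<le> K \<omega> e * exp (- t) / real (Suc j)" by (simp add: c_def)
    also have "exp (- t * real n) = exp (- t) * exp (- t * real m)"
      by (simp add: m exp_add[symmetric] algebra_simps)
    finally have "K \<omega> e * exp (- t) * (exp (- t * real m) * Z m (T e \<omega>)) < K \<omega> e * exp (- t) * (1 / real (Suc j))"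
      by (simp add: mult_ac)
    then have "exp (- t * real m) * Z m (T e \<omega>) < 1 / real (Suc j)"
      using K by (simp only: mult_less_cancel_left_pos mult_pos_pos exp_gt_zero)
    then show ?thesis by blast
  qed
  then show ?thesis using sp by (simp add: steep_def T_space)
qed

lemma steep_zero_one: "(AE \<omega> in M. \<omega> \<in> steep t) \<or> (AE \<omega> in M. \<omega> \<notin> steep t)"
proof (rule prob_AE_invariant)
  fix e :: "int ^ 'd" assume e: "e \<in> unit_steps"
  show "AE \<omega> in M. T e \<omega> \<in> steep t \<longleftrightarrow> \<omega> \<in> steep t"
    using AE_K_pos AE_T[OF AE_K_pos, of e] AE_space
  proof eventually_elim
    case (elim \<omega>)
    have "T (- e) (T e \<omega>) = \<omega>" using elim T_add[of \<omega> "- e" e] by (simp add: T_zero)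
    then show ?case
      using steep_step[of \<omega> t e] steep_step[of "T e \<omega>" t "- e"] e uminus_unit_steps[OF e] elim by auto
  qed
qed simp

text \<open>Outside the event, \<open>exp (- t n) Z_n\<close> stays above a positive constant, which
  is negligible on the exponential scale.\<close>

lemma growth_rate_ge:
  assumes "AE \<omega> in M. \<omega> \<notin> steep t" and a: "a < t"
  shows "AE \<omega> in M. \<forall>\<^sub>F n in sequentially. a < ln (Z n \<omega>) / real n"
  using assms(1) AE_space
proof eventually_elim
  case (elim \<omega>)
  then obtain j where j: "\<And>n. 1 / real (Suc j) \<le> exp (- t * real n) * Z n \<omega>"
    by (auto simp: steep_def not_less)
  obtain n0 where n0: "ln (real (Suc j)) / (t - a) < real n0" using reals_Archimedean2 by blast
  show ?case using eventually_ge_at_top[of "Suc n0"]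
  proof eventually_elim
    case (elim n)
    have z: "0 < Z n \<omega>" using Z_pos \<open>\<omega> \<in> space M\<close> by simp
    have "ln (1 / real (Suc j)) \<le> ln (exp (- t * real n) * Z n \<omega>)"
      using j[of n] by (intro ln_mono) auto
    then have 1: "- ln (real (Suc j)) \<le> - t * real n + ln (Z n \<omega>)"
      using z by (simp add: ln_mult ln_div)
    have "ln (real (Suc j)) < (t - a) * real n0"
      using n0 a by (simp add: field_simps)
    also have "\<dots> \<le> (t - a) * real n" using a elim by (intro mult_left_mono) auto
    finally have "a * real n < ln (Z n \<omega>)" using 1 by (simp add: algebra_simps)
    then show ?case using elim by (simp add: field_simps)
  qed
qed

section \<open>Running minima and the common bound on their gradients\<close>

text \<open>Index 0 belongs to the range because the supersolution inequality at an index
  \<open>n >= 1\<close> uses the values of the neighbours at \<open>n - 1\<close>.\<close>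

definition runmin :: "real \<Rightarrow> nat \<Rightarrow> 'w \<Rightarrow> real" where
  "runmin t N \<omega> = Min ((\<lambda>n. exp (- t * real n) * Z n \<omega>) ` {..N})"

lemma runmin_measurable [measurable]: "runmin t N \<in> borel_measurable M"
  unfolding runmin_def by (intro borel_measurable_Min) auto

lemma runmin_le: "n \<le> N \<Longrightarrow> runmin t N \<omega> \<le> exp (- t * real n) * Z n \<omega>"
  unfolding runmin_def by (intro Min_le) auto

lemma runmin_attained: "\<exists>n\<le>N. runmin t N \<omega> = exp (- t * real n) * Z n \<omega>"
proof -
  have "runmin t N \<omega> \<in> (\<lambda>n. exp (- t * real n) * Z n \<omega>) ` {..N}"
    unfolding runmin_def by (intro Min_in) auto
  then show ?thesis by auto
qed

lemma runmin_pos: "\<omega> \<in> space M \<Longrightarrow> 0 < runmin t N \<omega>"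
  using runmin_attained[of N t \<omega>] Z_pos by auto

text \<open>Crude and growing with \<open>N\<close>; it makes \<open>ln (runmin t N)\<close>
  integrable, so that its gradient has mean zero.\<close>

lemma abs_ln_runmin_le:
  assumes "\<omega> \<in> space M"
  shows "\<bar>ln (runmin t N \<omega>)\<bar> \<le> real N * (\<bar>t\<bar> + norm lam)"
proof -
  obtain n where n: "n \<le> N" "runmin t N \<omega> = exp (- t * real n) * Z n \<omega>" using runmin_attained by blast
  have "ln (runmin t N \<omega>) = - t * real n + ln (Z n \<omega>)"
    using Z_pos[OF assms, of n] by (simp add: n(2) ln_mult)
  also have "\<bar>\<dots>\<bar> \<le> \<bar>t\<bar> * real n + real n * norm lam"
    using abs_ln_Z_le[OF assms, of n] abs_triangle_ineq[of "- t * real n" "ln (Z n \<omega>)"]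
    by (simp add: abs_mult)
  also have "\<dots> = real n * (\<bar>t\<bar> + norm lam)" by (simp add: algebra_simps)
  also have "\<dots> \<le> real N * (\<bar>t\<bar> + norm lam)" using n(1) by (intro mult_right_mono) auto
  finally show ?thesis .
qed

text \<open>At an index \<open>n\<close> attaining the minimum, one step to a neighbour leads from
  \<open>Z n\<close> to at most \<open>Z (Suc n)\<close>, which is at most
  \<open>exp (norm lam)\<close> times \<open>Z n\<close>. That this factor is independent of
  \<open>N\<close> is the source of the common dominating function.\<close>

lemma K_mult_runmin_le:
  assumes \<omega>: "\<omega> \<in> space M" and e: "e \<in> unit_steps"
  shows "K \<omega> e * runmin t N (T e \<omega>) \<le> exp (norm lam) * runmin t N \<omega>"
proof -
  obtain n where n: "n \<le> N" "runmin t N \<omega> = exp (- t * real n) * Z n \<omega>" using runmin_attained by blast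
  have "K \<omega> e * runmin t N (T e \<omega>) \<le> K \<omega> e * (exp (- t * real n) * Z n (T e \<omega>))"
    using n(1) K_nonneg[OF \<omega> e] by (intro mult_left_mono runmin_le)
  also have "\<dots> = exp (- t * real n) * (K \<omega> e * Z n (T e \<omega>))" by simp
  also have "\<dots> \<le> exp (- t * real n) * (exp (norm lam) * Z n \<omega>)"
    using order_trans[OF K_mult_Z_le[OF \<omega> e, of n]] Z_step_bounds[OF \<omega>, of n] by (intro mult_left_mono) auto
  finally show ?thesis by (simp add: n(2) mult_ac)
qed

text \<open>The index \<open>m\<close> ensures that the minimum is reached at some
  \<open>n >= 1\<close>: if it is reached at 0, its value is 1 and \<open>m\<close> is as good. The
  recursion at \<open>n - 1\<close> then gives the inequality.\<close>

lemma runmin_supersolution: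
  assumes \<omega>: "\<omega> \<in> space M" and m: "1 \<le> m" "m \<le> N" "exp (- t * real m) * Z m \<omega> \<le> 1"
  shows "(\<Sum>e\<in>unit_steps. K \<omega> e * runmin t N (T e \<omega>)) \<le> exp t * runmin t N \<omega>"
proof -
  have "\<exists>n. 1 \<le> n \<and> n \<le> N \<and> exp (- t * real n) * Z n \<omega> \<le> runmin t N \<omega>"
  proof -
    obtain n where n: "n \<le> N" "runmin t N \<omega> = exp (- t * real n) * Z n \<omega>" using runmin_attained by blast
    show ?thesis
    proof (cases "n = 0")
      case True
      then show ?thesis using m n by (intro exI[of _ m]) (simp add: Z_0)
    next
      case False
      then show ?thesis using n by (intro exI[of _ n]) auto
    qed
  qed
  then obtain n where n: "1 \<le> n" "n \<le> N" "exp (- t * real n) * Z n \<omega> \<le> runmin t N \<omega>" by blast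
  then obtain l where l: "n = Suc l" by (cases n) auto
  have "(\<Sum>e\<in>unit_steps. K \<omega> e * runmin t N (T e \<omega>)) \<le>
      (\<Sum>e\<in>unit_steps. K \<omega> e * (exp (- t * real l) * Z l (T e \<omega>)))"
    using n(2) l K_nonneg[OF \<omega>] by (intro sum_mono mult_left_mono runmin_le) auto
  also have "\<dots> = exp (- t * real l) * Z n \<omega>"
    by (simp add: l Z_Suc[OF \<omega>] sum_distrib_left mult_ac)
  also have "\<dots> = exp t * (exp (- t * real n) * Z n \<omega>)"
    by (simp add: l exp_add[symmetric] mult.assoc[symmetric] algebra_simps)
  also have "\<dots> \<le> exp t * runmin t N \<omega>" using n(3) by (intro mult_left_mono) auto
  finally show ?thesis .
qed

text \<open>The summand 1 allows division by \<open>step_bound\<close>.\<close>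

definition step_bound :: "'w \<Rightarrow> int ^ 'd \<Rightarrow> real" where
  "step_bound \<omega> e = 1 + norm lam + \<bar>ln (K \<omega> e)\<bar> + \<bar>ln (K (T e \<omega>) (- e))\<bar>"

lemma step_bound_ge_1: "1 \<le> step_bound \<omega> e"
  by (simp add: step_bound_def)

lemma step_bound_measurable [measurable]:
  assumes "e \<in> unit_steps"
  shows "(\<lambda>\<omega>. step_bound \<omega> e) \<in> borel_measurable M"
proof -
  have [measurable]: "(\<lambda>\<omega>. K \<omega> e) \<in> borel_measurable M" "(\<lambda>\<omega>. K \<omega> (- e)) \<in> borel_measurable M"
    using K_measurable[OF assms] K_measurable[OF uminus_unit_steps[OF assms]] by auto
  show ?thesis unfolding step_bound_def by measurable
qed

text \<open>\<open>K_mult_runmin_le\<close> bounds an increment from above only; applied to the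
  reverse step \<open>- e\<close> from \<open>T e \<omega>\<close> it bounds the same increment from
  below. Hence both weights appear in \<open>step_bound\<close>.\<close>

lemma cgrad_runmin_bound:
  "AE \<omega> in M. \<forall>e\<in>unit_steps. \<forall>N. \<bar>cgrad (\<lambda>\<omega>. ln (runmin t N \<omega>)) \<omega> e\<bar> \<le> step_bound \<omega> e"
  using AE_space AE_T_all[OF AE_K_pos]
proof eventually_elim
  case (elim \<omega>)
  have *: "ln (runmin t N (T e \<omega>)) - ln (runmin t N \<omega>) \<le> norm lam + \<bar>ln (K \<omega> e)\<bar>"
    if \<omega>: "\<omega> \<in> space M" and e: "e \<in> unit_steps" and K: "0 < K \<omega> e" for \<omega> e N
  proof -
    have "ln (K \<omega> e * runmin t N (T e \<omega>)) \<le> ln (exp (norm lam) * runmin t N \<omega>)"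
      using K_mult_runmin_le[OF \<omega> e] K runmin_pos[OF T_space[OF \<omega>]] by (intro ln_mono) auto
    then show ?thesis
      using K runmin_pos[OF \<omega>, of t N] runmin_pos[OF T_space[OF \<omega>, of e], of t N] by (simp add: ln_mult)
  qed
  show ?case
  proof (intro ballI allI)
    fix e :: "int ^ 'd" and N assume e: "e \<in> unit_steps"
    have inverse_T: "T (- e) (T e \<omega>) = \<omega>" using elim T_add[of \<omega> "- e" e] by (simp add: T_zero)
    have K: "0 < K \<omega> e" "0 < K (T e \<omega>) (- e)"
      using elim e uminus_unit_steps[OF e] T_zero[of \<omega>] by metis+
    have "ln (runmin t N (T e \<omega>)) - ln (runmin t N \<omega>) \<le> norm lam + \<bar>ln (K \<omega> e)\<bar>"
      using elim e K by (intro *) auto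
    moreover have "ln (runmin t N (T (- e) (T e \<omega>))) - ln (runmin t N (T e \<omega>)) \<le> norm lam + \<bar>ln (K (T e \<omega>) (- e))\<bar>"
      using elim e K by (intro *) (auto simp: T_space uminus_unit_steps)
    ultimately show "\<bar>cgrad (\<lambda>\<omega>. ln (runmin t N \<omega>)) \<omega> e\<bar> \<le> step_bound \<omega> e"
      unfolding inverse_T cgrad_def step_bound_def by linarith
  qed
qed

lemma step_bound_Lq:
  "\<exists>\<alpha>>0. \<forall>e\<in>unit_steps. Lq M (real CARD('d) + \<alpha>) (\<lambda>\<omega>. step_bound \<omega> e)"
proof -
  obtain \<alpha> where \<alpha>: "0 < \<alpha>" and pos: "\<And>e. e \<in> unit_steps \<Longrightarrow> AE \<omega> in M. 0 < p \<omega> e"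
    and int: "\<And>e. e \<in> unit_steps \<Longrightarrow> integrable M (\<lambda>\<omega>. \<bar>ln (p \<omega> e)\<bar> powr (real CARD('d) + \<alpha>))"
    using log_moment by blast
  define q where "q = real CARD('d) + \<alpha>"
  have q0: "0 \<le> q" using \<alpha> by (simp add: q_def)
  have const: "Lq M q (\<lambda>\<omega>. c)" for c by (simp add: Lq_def)
  have lnK: "Lq M q (\<lambda>\<omega>. \<bar>ln (K \<omega> e)\<bar>)" if e: "e \<in> unit_steps" for e
  proof (rule Lq_AE_bound)
    have m: "(\<lambda>\<omega>. p \<omega> e) \<in> borel_measurable M" by (rule p_meas[OF e])
    have "Lq M q (\<lambda>\<omega>. ln (p \<omega> e) + lam \<bullet> to_real_vec e)"
      using int[OF e] m by (intro Lq_add const q0) (auto simp: Lq_def q_def)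
    then show "integrable M (\<lambda>\<omega>. \<bar>ln (p \<omega> e) + lam \<bullet> to_real_vec e\<bar> powr q)" by (rule Lq_integrable_powr)
    show "(\<lambda>\<omega>. \<bar>ln (K \<omega> e)\<bar>) \<in> borel_measurable M" using e by measurable
    show "AE \<omega> in M. \<bar>\<bar>ln (K \<omega> e)\<bar>\<bar> powr q \<le> \<bar>ln (p \<omega> e) + lam \<bullet> to_real_vec e\<bar> powr q"
      using pos[OF e] by eventually_elim (simp add: K_def ln_mult)
  qed
  have "Lq M q (\<lambda>\<omega>. step_bound \<omega> e)" if e: "e \<in> unit_steps" for e
    unfolding step_bound_def using lnK[OF e] Lq_T[OF lnK[OF uminus_unit_steps[OF e]], of e]
    by (intro Lq_add const q0)
  then show ?thesis using \<alpha> by (auto simp: q_def)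
qed

end

section \<open>Convex families of normalized fields and their limits\<close>

lemma exp_midpoint_le: "exp ((a + b) / 2) \<le> (exp a + exp b) / (2 :: real)"
proof -
  have "0 \<le> (exp (a / 2) - exp (b / 2))\<^sup>2" by simp
  also have "\<dots> = exp a + exp b - 2 * exp ((a + b) / 2)"
  proof -
    have "exp a = exp (a / 2) * exp (a / 2)" "exp b = exp (b / 2) * exp (b / 2)"
      "exp ((a + b) / 2) = exp (a / 2) * exp (b / 2)"
      by (simp_all add: exp_add[symmetric] add_divide_distrib)
    then show ?thesis by (simp add: power2_eq_square algebra_simps)
  qed
  finally show ?thesis by simp
qed

context random_environment
begin

text \<open>\<open>Y\<close> is a field divided by \<open>step_bound\<close>. The families then
  consist of functions bounded by 1, and the \<open>L^2\<close> functional is finite although in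
  dimension one the field itself need not be square integrable.\<close>

definition rescale :: "('w \<Rightarrow> int ^ 'd \<Rightarrow> real) \<Rightarrow> 'w \<Rightarrow> int ^ 'd \<Rightarrow> real" where
  "rescale Y \<omega> e = Y \<omega> e * step_bound \<omega> e"

text \<open>By time \<open>k\<close> the quantity \<open>exp (- t n) Z_n\<close> has come back to
  its initial value 1 or below; index 0 is excluded because it satisfies this trivially.\<close>

definition descended :: "real \<Rightarrow> nat \<Rightarrow> 'w \<Rightarrow> bool" where
  "descended t k \<omega> \<longleftrightarrow> (\<exists>m. 1 \<le> m \<and> m \<le> k \<and> exp (- t * real m) * Z m \<omega> \<le> 1)"

text \<open>Every condition is stable under midpoints, and only the last depends on
  \<open>k\<close>: it becomes more restrictive as the event \<open>descended t k\<close>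
  grows.\<close>

definition correctors :: "real \<Rightarrow> nat \<Rightarrow> ('w \<Rightarrow> int ^ 'd \<Rightarrow> real) set" where
  "correctors t k = {Y. \<forall>e\<in>unit_steps. (\<lambda>\<omega>. Y \<omega> e) \<in> borel_measurable M \<and>
      (AE \<omega> in M. \<bar>Y \<omega> e\<bar> \<le> 1) \<and> (\<integral>\<omega>. rescale Y \<omega> e \<partial>M) = 0} \<inter>
    {Y. AE \<omega> in M. loop_sums_vanish T (rescale Y) \<omega>} \<inter>
    {Y. AE \<omega> in M. descended t k \<omega> \<longrightarrow> (\<Sum>e\<in>unit_steps. K \<omega> e * exp (rescale Y \<omega> e)) \<le> exp t}"

lemma correctorsD:
  assumes "Y \<in> correctors t k" "e \<in> unit_steps"
  shows "(\<lambda>\<omega>. Y \<omega> e) \<in> borel_measurable M" "AE \<omega> in M. \<bar>Y \<omega> e\<bar> \<le> 1" "(\<integral>\<omega>. rescale Y \<omega> e \<partial>M) = 0"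
    "(\<lambda>\<omega>. rescale Y \<omega> e) \<in> borel_measurable M" "AE \<omega> in M. \<bar>rescale Y \<omega> e\<bar> \<le> step_bound \<omega> e"
proof -
  show 1: "(\<lambda>\<omega>. Y \<omega> e) \<in> borel_measurable M" "AE \<omega> in M. \<bar>Y \<omega> e\<bar> \<le> 1" "(\<integral>\<omega>. rescale Y \<omega> e \<partial>M) = 0"
    using assms unfolding correctors_def by blast+
  show "(\<lambda>\<omega>. rescale Y \<omega> e) \<in> borel_measurable M"
    unfolding rescale_def using 1(1) step_bound_measurable[OF assms(2)] by measurable
  show "AE \<omega> in M. \<bar>rescale Y \<omega> e\<bar> \<le> step_bound \<omega> e"
    using 1(2)
  proof eventually_elim
    case (elim \<omega>)
    have "\<bar>Y \<omega> e\<bar> * step_bound \<omega> e \<le> 1 * step_bound \<omega> e"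
      using elim step_bound_ge_1[of \<omega> e] by (intro mult_right_mono) auto
    then show ?case using step_bound_ge_1[of \<omega> e] by (simp add: rescale_def abs_mult)
  qed
qed

lemma step_bound_integrable:
  assumes "e \<in> unit_steps"
  shows "integrable M (\<lambda>\<omega>. step_bound \<omega> e)"
proof -
  obtain \<alpha> where \<alpha>: "0 < \<alpha>" "Lq M (real CARD('d) + \<alpha>) (\<lambda>\<omega>. step_bound \<omega> e)"
    using step_bound_Lq assms by blast
  have "1 \<le> real CARD('d)" by (simp add: Suc_le_eq)
  with \<alpha> show ?thesis by (intro Lq_integrable[OF \<alpha>(2)]) linarith
qed

lemma correctors_integrable:
  assumes "Y \<in> correctors t k" "e \<in> unit_steps"
  shows "integrable M (\<lambda>\<omega>. rescale Y \<omega> e)"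
  using correctorsD(4,5)[OF assms] step_bound_ge_1
  by (intro Bochner_Integration.integrable_bound[OF step_bound_integrable[OF assms(2)]])
    (auto elim!: eventually_mono)

text \<open>The witness is the gradient of \<open>ln (runmin t k)\<close> divided by
  \<open>step_bound\<close>: loops telescope, the mean vanishes by invariance of the measure, and
  the inequality is the supersolution property of the running minimum.\<close>

lemma correctors_nonempty: "correctors t k \<noteq> {}"
proof -
  define g where "g \<omega> = ln (runmin t k \<omega>)" for \<omega>
  define Y where "Y \<omega> e = cgrad g \<omega> e / step_bound \<omega> e" for \<omega> e
  have resc: "rescale Y = cgrad g"
    using step_bound_ge_1 by (auto simp: fun_eq_iff rescale_def Y_def) (smt (verit))
  have g: "integrable M g"
    using abs_ln_runmin_le[of _ t k] unfolding g_def
    by (intro AE_bounded_integrable[of _ "real k * (\<bar>t\<bar> + norm lam)"] AE_I2) auto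
  have gm: "g \<in> borel_measurable M" using g by auto
  have "(\<lambda>\<omega>. Y \<omega> e) \<in> borel_measurable M" if "e \<in> unit_steps" for e
    unfolding Y_def cgrad_def using gm step_bound_measurable[OF that] by measurable
  moreover have "AE \<omega> in M. \<bar>Y \<omega> e\<bar> \<le> 1" if e: "e \<in> unit_steps" for e
    using cgrad_runmin_bound[of t]
  proof eventually_elim
    case (elim \<omega>)
    then have "\<bar>cgrad g \<omega> e\<bar> \<le> step_bound \<omega> e" using e unfolding g_def by blast
    then show ?case using step_bound_ge_1[of \<omega> e] by (simp add: Y_def)
  qed
  moreover have "(\<integral>\<omega>. rescale Y \<omega> e \<partial>M) = 0" for e
    unfolding resc cgrad_def using integrable_T[OF g] g integral_T[OF gm] by simp
  moreover have "AE \<omega> in M. loop_sums_vanish T (rescale Y) \<omega>"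
    unfolding resc using loop_sums_vanish_gradient by (intro AE_I2)
  moreover have "AE \<omega> in M. descended t k \<omega> \<longrightarrow> (\<Sum>e\<in>unit_steps. K \<omega> e * exp (rescale Y \<omega> e)) \<le> exp t"
    unfolding resc
  proof (intro AE_I2 impI)
    fix \<omega> assume \<omega>: "\<omega> \<in> space M" and d: "descended t k \<omega>"
    have v: "0 < runmin t k \<omega>" "0 < runmin t k (T e \<omega>)" for e
      using runmin_pos \<omega> T_space by auto
    have "(\<Sum>e\<in>unit_steps. K \<omega> e * exp (cgrad g \<omega> e)) = (\<Sum>e\<in>unit_steps. K \<omega> e * runmin t k (T e \<omega>)) / runmin t k \<omega>"
      unfolding sum_divide_distrib using v by (intro sum.cong) (auto simp: cgrad_def g_def exp_diff)
    also have "\<dots> \<le> exp t"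
      using d runmin_supersolution[OF \<omega>] v by (auto simp: descended_def pos_divide_le_eq)
    finally show "(\<Sum>e\<in>unit_steps. K \<omega> e * exp (cgrad g \<omega> e)) \<le> exp t" .
  qed
  ultimately have "Y \<in> correctors t k" unfolding correctors_def by blast
  then show ?thesis by blast
qed

lemma correctors_decseq: "decseq (correctors t)"
proof (rule decseq_SucI)
  fix k
  have "descended t k \<omega> \<Longrightarrow> descended t (Suc k) \<omega>" for \<omega>
    unfolding descended_def using le_SucI by blast
  then show "correctors t (Suc k) \<subseteq> correctors t k"
    unfolding correctors_def by (auto elim!: eventually_mono)
qed

lemma correctors_midpoint:
  assumes X: "X \<in> correctors t k" and Y: "Y \<in> correctors t k"
  shows "(\<lambda>\<omega> e. (X \<omega> e + Y \<omega> e) / 2) \<in> correctors t k"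
proof -
  define W where "W \<omega> e = (X \<omega> e + Y \<omega> e) / 2" for \<omega> e
  have resc: "rescale W = (\<lambda>\<omega> e. (rescale X \<omega> e + rescale Y \<omega> e) / 2)"
    by (simp add: fun_eq_iff rescale_def W_def field_simps)
  have "(\<lambda>\<omega>. W \<omega> e) \<in> borel_measurable M" if "e \<in> unit_steps" for e
    unfolding W_def using correctorsD(1)[OF X that] correctorsD(1)[OF Y that] by measurable
  moreover have "AE \<omega> in M. \<bar>W \<omega> e\<bar> \<le> 1" if "e \<in> unit_steps" for e
    using correctorsD(2)[OF X that] correctorsD(2)[OF Y that]
    by eventually_elim (auto simp: W_def)
  moreover have "(\<integral>\<omega>. rescale W \<omega> e \<partial>M) = 0" if "e \<in> unit_steps" for e
    unfolding resc using correctors_integrable[OF X that] correctors_integrable[OF Y that]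
      correctorsD(3)[OF X that] correctorsD(3)[OF Y that] by simp
  moreover have "AE \<omega> in M. loop_sums_vanish T (rescale W) \<omega>"
  proof -
    have "AE \<omega> in M. loop_sums_vanish T (rescale X) \<omega>" "AE \<omega> in M. loop_sums_vanish T (rescale Y) \<omega>"
      using X Y unfolding correctors_def by blast+
    then show ?thesis unfolding resc by eventually_elim (rule loop_sums_vanish_midpoint)
  qed
  moreover have "AE \<omega> in M. descended t k \<omega> \<longrightarrow> (\<Sum>e\<in>unit_steps. K \<omega> e * exp (rescale W \<omega> e)) \<le> exp t"
  proof -
    have "AE \<omega> in M. descended t k \<omega> \<longrightarrow> (\<Sum>e\<in>unit_steps. K \<omega> e * exp (rescale X \<omega> e)) \<le> exp t"
      "AE \<omega> in M. descended t k \<omega> \<longrightarrow> (\<Sum>e\<in>unit_steps. K \<omega> e * exp (rescale Y \<omega> e)) \<le> exp t"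
      using X Y unfolding correctors_def by blast+
    then show ?thesis using AE_space
    proof eventually_elim
      case (elim \<omega>)
      show ?case
      proof
        assume d: "descended t k \<omega>"
        have "(\<Sum>e\<in>unit_steps. K \<omega> e * exp (rescale W \<omega> e)) \<le>
          (\<Sum>e\<in>unit_steps. K \<omega> e * ((exp (rescale X \<omega> e) + exp (rescale Y \<omega> e)) / 2))"
          unfolding resc using K_nonneg elim exp_midpoint_le by (intro sum_mono mult_left_mono) auto
        also have "\<dots> = ((\<Sum>e\<in>unit_steps. K \<omega> e * exp (rescale X \<omega> e)) +
            (\<Sum>e\<in>unit_steps. K \<omega> e * exp (rescale Y \<omega> e))) / 2"
          by (simp add: sum.distrib[symmetric] sum_divide_distrib distrib_left)
        also have "\<dots> \<le> exp t" using elim d by auto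
        finally show "(\<Sum>e\<in>unit_steps. K \<omega> e * exp (rescale W \<omega> e)) \<le> exp t" .
      qed
    qed
  qed
  ultimately have "W \<in> correctors t k" unfolding correctors_def by blast
  then show ?thesis by (simp add: W_def[abs_def])
qed

text \<open>From index \<open>k\<close> on, all \<open>Y l\<close> lie in
  \<open>correctors t k\<close>, so the limit satisfies the inequality on
  \<open>descended t k\<close> for every \<open>k\<close>, and these events cover almost every
  environment. The common bound \<open>step_bound\<close> supplies the moment of the limit and
  carries the zero mean over.\<close>

lemma corrector_exists:
  assumes steep: "AE \<omega> in M. \<omega> \<in> steep t"
  shows "\<exists>F\<in>classK M T. AE \<omega> in M. (\<Sum>e\<in>unit_steps. K \<omega> e * exp (F \<omega> e)) \<le> exp t"
proof -
  have "\<exists>Y r. strict_mono (r :: nat \<Rightarrow> nat) \<and>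
    (\<forall>k. Y k \<in> correctors t (r k) \<and> (\<forall>X\<in>correctors t (r k).
      (\<integral>\<omega>. (\<Sum>e\<in>unit_steps. (Y k \<omega> e)\<^sup>2) \<partial>M) \<le> (\<integral>\<omega>. (\<Sum>e\<in>unit_steps. (X \<omega> e)\<^sup>2) \<partial>M) + 1 / 4 ^ k)) \<and>
    (\<forall>e\<in>unit_steps. AE \<omega> in M. convergent (\<lambda>k. Y k \<omega> e))"
    by (rule near_minimizers_converge[where b = 1])
      (rule finite_unit_steps correctors_nonempty correctors_decseq correctors_midpoint
        correctorsD(1,2) | assumption)+
  then obtain Y r where r: "strict_mono (r :: nat \<Rightarrow> nat)" and Yr: "\<And>k. Y k \<in> correctors t (r k)"
    and conv: "\<And>e. e \<in> unit_steps \<Longrightarrow> AE \<omega> in M. convergent (\<lambda>k. Y k \<omega> e)" by blast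
  have YC: "Y l \<in> correctors t k" if "k \<le> l" for k l
  proof -
    have "k \<le> r l" using that strict_mono_imp_increasing[OF r, of l] by linarith
    then show ?thesis using correctors_decseq[of t] Yr[of l] by (auto simp: decseq_def)
  qed
  define L where "L \<omega> e = lim (\<lambda>k. Y k \<omega> e)" for \<omega> e
  define F where "F = rescale L"
  have L: "AE \<omega> in M. \<forall>e\<in>unit_steps. (\<lambda>k. Y k \<omega> e) \<longlonglongrightarrow> L \<omega> e"
  proof (rule AE_finite_allI)
    fix e :: "int ^ 'd" assume "e \<in> unit_steps"
    from conv[OF this] show "AE \<omega> in M. (\<lambda>k. Y k \<omega> e) \<longlonglongrightarrow> L \<omega> e"
      by eventually_elim (simp add: L_def convergent_LIMSEQ_iff)
  qed simp
  have lim: "AE \<omega> in M. \<forall>e\<in>unit_steps. (\<lambda>k. rescale (Y k) \<omega> e) \<longlonglongrightarrow> F \<omega> e"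
    using L by eventually_elim (auto simp: F_def rescale_def intro!: tendsto_mult)
  have Fm: "(\<lambda>\<omega>. F \<omega> e) \<in> borel_measurable M" if e: "e \<in> unit_steps" for e
  proof -
    have "(\<lambda>\<omega>. L \<omega> e) \<in> borel_measurable M"
      unfolding L_def using correctorsD(1)[OF Yr e] by (intro borel_measurable_lim_metric)
    then show ?thesis unfolding F_def rescale_def using step_bound_measurable[OF e] by measurable
  qed
  have Yb: "AE \<omega> in M. \<forall>k. \<bar>rescale (Y k) \<omega> e\<bar> \<le> step_bound \<omega> e" if "e \<in> unit_steps" for e
    using correctorsD(5)[OF Yr that] by (simp add: AE_all_countable)
  have Fb: "AE \<omega> in M. \<bar>F \<omega> e\<bar> \<le> step_bound \<omega> e" if e: "e \<in> unit_steps" for e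
    using lim Yb[OF e]
  proof eventually_elim
    case (elim \<omega>)
    then have "(\<lambda>k. \<bar>rescale (Y k) \<omega> e\<bar>) \<longlonglongrightarrow> \<bar>F \<omega> e\<bar>" using e by (intro tendsto_rabs) auto
    then show ?case using elim by (intro LIMSEQ_le_const2) auto
  qed
  have Fint: "(\<integral>\<omega>. F \<omega> e \<partial>M) = 0" if e: "e \<in> unit_steps" for e
  proof -
    have "(\<lambda>k. \<integral>\<omega>. rescale (Y k) \<omega> e \<partial>M) \<longlonglongrightarrow> (\<integral>\<omega>. F \<omega> e \<partial>M)"
    proof (rule integral_dominated_convergence[where w = "\<lambda>\<omega>. step_bound \<omega> e"])
      show "AE \<omega> in M. (\<lambda>k. rescale (Y k) \<omega> e) \<longlonglongrightarrow> F \<omega> e"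
        using lim by eventually_elim (use e in auto)
      show "AE \<omega> in M. norm (rescale (Y k) \<omega> e) \<le> step_bound \<omega> e" for k
        using correctorsD(5)[OF Yr e] by simp
    qed (use Fm[OF e] correctorsD(4)[OF Yr e] step_bound_integrable[OF e] in auto)
    then show ?thesis by (simp add: correctorsD(3)[OF Yr e] LIMSEQ_const_iff)
  qed
  have loops: "AE \<omega> in M. loop_sums_vanish T F \<omega>"
  proof -
    have "AE \<omega> in M. \<forall>k. loop_sums_vanish T (rescale (Y k)) \<omega>"
      using Yr unfolding AE_all_countable correctors_def by blast
    with AE_T_all[OF lim] show ?thesis
      by eventually_elim (rule loop_sums_vanish_limit, auto)
  qed
  obtain \<alpha> where \<alpha>: "0 < \<alpha>" "\<And>e. e \<in> unit_steps \<Longrightarrow> Lq M (real CARD('d) + \<alpha>) (\<lambda>\<omega>. step_bound \<omega> e)"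
    using step_bound_Lq by blast
  have "F \<in> classK M T"
  proof (rule classK_I[OF \<alpha>(1) _ Fint loops])
    fix e :: "int ^ 'd" assume e: "e \<in> unit_steps"
    show "Lq M (real CARD('d) + \<alpha>) (\<lambda>\<omega>. F \<omega> e)"
    proof (rule Lq_AE_bound[OF Lq_integrable_powr[OF \<alpha>(2)[OF e]] Fm[OF e]])
      show "AE \<omega> in M. \<bar>F \<omega> e\<bar> powr (real CARD('d) + \<alpha>) \<le> \<bar>step_bound \<omega> e\<bar> powr (real CARD('d) + \<alpha>)"
        using Fb[OF e] by eventually_elim (use \<alpha>(1) in \<open>auto intro!: powr_mono2\<close>)
    qed
  qed
  moreover have "AE \<omega> in M. (\<Sum>e\<in>unit_steps. K \<omega> e * exp (F \<omega> e)) \<le> exp t"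
  proof -
    have "AE \<omega> in M. \<forall>k l. k \<le> l \<longrightarrow> descended t k \<omega> \<longrightarrow>
        (\<Sum>e\<in>unit_steps. K \<omega> e * exp (rescale (Y l) \<omega> e)) \<le> exp t"
      unfolding AE_all_countable
    proof (intro allI)
      fix k l
      show "AE \<omega> in M. k \<le> l \<longrightarrow> descended t k \<omega> \<longrightarrow>
        (\<Sum>e\<in>unit_steps. K \<omega> e * exp (rescale (Y l) \<omega> e)) \<le> exp t"
      proof (cases "k \<le> l")
        case True
        then show ?thesis using YC[OF True] by (simp add: correctors_def)
      qed simp
    qed
    with steep lim show ?thesis
    proof eventually_elim
      case (elim \<omega>)
      \<comment> \<open>At level 1 the index cannot be 0, since \<open>Z 0 = 1\<close> and the
        inequality is strict.\<close>
      obtain m where m: "exp (- t * real m) * Z m \<omega> < 1" using steepD[OF elim(1), of 1] by auto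
      then have "m \<noteq> 0" using Z_0 by (cases m) auto
      then have d: "descended t m \<omega>" using m by (auto simp: descended_def intro!: exI[of _ m])
      have "(\<lambda>l. \<Sum>e\<in>unit_steps. K \<omega> e * exp (rescale (Y l) \<omega> e)) \<longlonglongrightarrow>
          (\<Sum>e\<in>unit_steps. K \<omega> e * exp (F \<omega> e))"
        using elim(2) by (intro tendsto_sum tendsto_mult tendsto_const tendsto_exp) auto
      then show ?case
        by (rule LIMSEQ_le_const2) (use elim(3) d in blast)
    qed
  qed
  ultimately show ?thesis by blast
qed

end

section \<open>The variational formula\<close>

context random_environment
begin

lemma sum_K_exp_eq:
  "(\<Sum>e\<in>unit_steps. K \<omega> e * exp (F \<omega> e)) = (\<Sum>e\<in>unit_steps. p \<omega> e * exp (lam \<bullet> to_real_vec e + F \<omega> e))"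
  by (simp add: K_def exp_add mult.assoc)

lemma AE_sum_K_exp_pos: "AE \<omega> in M. 0 < (\<Sum>e\<in>unit_steps. K \<omega> e * exp (F \<omega> e))"
  using AE_K_pos by eventually_elim (intro sum_pos unit_steps_nonempty, auto)

lemma Lambda_lessD:
  assumes "Lambda M T p lam < ereal s"
  shows "\<exists>F\<in>classK M T. AE \<omega> in M. (\<Sum>e\<in>unit_steps. K \<omega> e * exp (F \<omega> e)) \<le> exp s"
proof -
  obtain F where F: "F \<in> classK M T"
    and lt: "esssup M (\<lambda>\<omega>. ereal (ln (\<Sum>e\<in>unit_steps. K \<omega> e * exp (F \<omega> e)))) < ereal s"
    using assms unfolding Lambda_def INF_less_iff sum_K_exp_eq by blast
  have "AE \<omega> in M. (\<Sum>e\<in>unit_steps. K \<omega> e * exp (F \<omega> e)) \<le> exp s"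
    using esssup_AE[of "\<lambda>\<omega>. ereal (ln (\<Sum>e\<in>unit_steps. K \<omega> e * exp (F \<omega> e)))"] AE_sum_K_exp_pos[of F]
  proof eventually_elim
    case (elim \<omega>)
    have "ln (\<Sum>e\<in>unit_steps. K \<omega> e * exp (F \<omega> e)) < s"
      using le_less_trans[OF elim(1) lt] by simp
    then have "exp (ln (\<Sum>e\<in>unit_steps. K \<omega> e * exp (F \<omega> e))) \<le> exp s" by simp
    then show ?case using elim(2) by (simp only: exp_ln)
  qed
  with F show ?thesis by blast
qed

lemma Lambda_leI:
  assumes F: "F \<in> classK M T" and t: "AE \<omega> in M. (\<Sum>e\<in>unit_steps. K \<omega> e * exp (F \<omega> e)) \<le> exp t"
  shows "Lambda M T p lam \<le> ereal t"
  unfolding Lambda_def sum_K_exp_eq[symmetric]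
proof (rule INF_lower2[OF F], rule esssup_I)
  have [measurable]: "(\<lambda>\<omega>. F \<omega> e) \<in> borel_measurable M" if "e \<in> unit_steps" for e
    using F that by (auto simp: classK_def)
  show "(\<lambda>\<omega>. ereal (ln (\<Sum>e\<in>unit_steps. K \<omega> e * exp (F \<omega> e)))) \<in> borel_measurable M" by measurable
  show "AE \<omega> in M. ereal (ln (\<Sum>e\<in>unit_steps. K \<omega> e * exp (F \<omega> e))) \<le> ereal t"
    using t AE_sum_K_exp_pos[of F]
  proof eventually_elim
    case (elim \<omega>)
    then have "ln (\<Sum>e\<in>unit_steps. K \<omega> e * exp (F \<omega> e)) \<le> ln (exp t)" by (intro ln_mono) auto
    then show ?case by simp
  qed
qed

text \<open>\<open>Lambda\<close> is an extended real that is not known to be finite beforehand.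
  Comparison with rational levels on both sides covers infinite values as well and involves only
  countably many null sets.\<close>

theorem quenched_free_energy:
  "AE \<omega> in M. (\<lambda>n. ereal (ln (Z n \<omega>) / real n)) \<longlonglongrightarrow> Lambda M T p lam"
proof -
  have upper: "AE \<omega> in M. Lambda M T p lam < ereal r \<longrightarrow> (\<forall>\<^sub>F n in sequentially. ln (Z n \<omega>) / real n \<le> r)" for r
  proof (cases "Lambda M T p lam < ereal r")
    case True
    \<comment> \<open>A level strictly between leaves the room \<open>r - s\<close> for the
      sublinear error of the potential.\<close>
    then obtain s where s: "Lambda M T p lam < ereal s" "ereal s < ereal r" using ereal_dense2 by blast
    obtain F where F: "F \<in> classK M T" "AE \<omega> in M. (\<Sum>e\<in>unit_steps. K \<omega> e * exp (F \<omega> e)) \<le> exp s"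
      using Lambda_lessD[OF s(1)] by blast
    from growth_rate_le[OF F, of "r - s"] s(2) show ?thesis by simp
  qed simp
  have lower: "AE \<omega> in M. ereal r < Lambda M T p lam \<longrightarrow> (\<forall>\<^sub>F n in sequentially. r < ln (Z n \<omega>) / real n)" for r
  proof (cases "ereal r < Lambda M T p lam")
    case True
    then obtain t where t: "ereal r < ereal t" "ereal t < Lambda M T p lam" using ereal_dense2 by blast
    \<comment> \<open>If \<open>steep t\<close> held almost surely, the field from
      \<open>corrector_exists\<close> would give \<open>Lambda M T p lam \<le> ereal t\<close>,
      against the choice of \<open>t\<close>.\<close>
    have "\<not> (AE \<omega> in M. \<omega> \<in> steep t)"
      using corrector_exists[of t] Lambda_leI[of _ t] t(2) by (meson not_less)
    then have "AE \<omega> in M. \<omega> \<notin> steep t" using steep_zero_one by blast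
    from growth_rate_ge[OF this, of r] t(1) show ?thesis by simp
  qed simp
  have "AE \<omega> in M. \<forall>r::rat. Lambda M T p lam < ereal (of_rat r) \<longrightarrow> (\<forall>\<^sub>F n in sequentially. ln (Z n \<omega>) / real n \<le> of_rat r)"
    "AE \<omega> in M. \<forall>r::rat. ereal (of_rat r) < Lambda M T p lam \<longrightarrow> (\<forall>\<^sub>F n in sequentially. of_rat r < ln (Z n \<omega>) / real n)"
    unfolding AE_all_countable using upper lower by blast+
  then show ?thesis
  proof eventually_elim
    case (elim \<omega>)
    show ?case
    proof (rule order_tendstoI)
      fix a :: ereal assume "a < Lambda M T p lam"
      then obtain r :: rat where r: "a < ereal (of_rat r)" "ereal (of_rat r) < Lambda M T p lam"
        using ereal_dense3 by blast
      with elim(2) have "\<forall>\<^sub>F n in sequentially. of_rat r < ln (Z n \<omega>) / real n" by blast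
      then show "\<forall>\<^sub>F n in sequentially. a < ereal (ln (Z n \<omega>) / real n)"
      proof eventually_elim
        case (elim n)
        then have "ereal (of_rat r) < ereal (ln (Z n \<omega>) / real n)" by simp
        with r(1) show ?case by (rule less_trans)
      qed
    next
      fix a :: ereal assume "Lambda M T p lam < a"
      then obtain r :: rat where r: "Lambda M T p lam < ereal (of_rat r)" "ereal (of_rat r) < a"
        using ereal_dense3 by blast
      with elim(1) have "\<forall>\<^sub>F n in sequentially. ln (Z n \<omega>) / real n \<le> of_rat r" by blast
      then show "\<forall>\<^sub>F n in sequentially. ereal (ln (Z n \<omega>) / real n) < a"
      proof eventually_elim
        case (elim n)
        then have "ereal (ln (Z n \<omega>) / real n) \<le> ereal (of_rat r)" by simp
        then show ?case using r(2) by (rule le_less_trans)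
      qed
    qed
  qed
qed

end

theorem theorem1p1:
  fixes M :: "'w measure"
    and T :: "int ^ 'd \<Rightarrow> 'w \<Rightarrow> 'w"
    and p :: "'w \<Rightarrow> int ^ 'd \<Rightarrow> real"
    and lam :: "real ^ 'd"
  assumes prob: "prob_space M"
    and cgen: "countably_generated_measure M"
    and T_mp: "\<And>e. e \<in> unit_steps \<Longrightarrow> measure_preserving M (T e)"
    and T_zero: "\<And>\<omega>. \<omega> \<in> space M \<Longrightarrow> T 0 \<omega> = \<omega>"
    and T_add: "\<And>x y \<omega>. \<omega> \<in> space M \<Longrightarrow> T (x + y) \<omega> = T x (T y \<omega>)"
    and ergodic: "\<And>A. A \<in> sets M \<Longrightarrow> (\<forall>e\<in>unit_steps. T e -` A \<inter> space M = A) \<Longrightarrow>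
                     prob_space.prob M A = 0 \<or> prob_space.prob M A = 1"
    and p_meas: "\<And>e. e \<in> unit_steps \<Longrightarrow> (\<lambda>\<omega>. p \<omega> e) \<in> borel_measurable M"
    and p_range: "\<And>\<omega> e. \<omega> \<in> space M \<Longrightarrow> e \<in> unit_steps \<Longrightarrow> 0 \<le> p \<omega> e \<and> p \<omega> e \<le> 1"
    and p_sum: "\<And>\<omega>. \<omega> \<in> space M \<Longrightarrow> (\<Sum>e\<in>unit_steps. p \<omega> e) = 1"
    and log_moment: "\<exists>\<alpha>>0. \<forall>e\<in>unit_steps. (AE \<omega> in M. p \<omega> e > 0) \<and>
                       integrable M (\<lambda>\<omega>. \<bar>ln (p \<omega> e)\<bar> powr (real CARD('d) + \<alpha>))"
  shows "AE \<omega> in M. (\<lambda>n. ereal (ln (quenched_mgf T p \<omega> lam n) / real n))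
                      \<longlonglongrightarrow> Lambda M T p lam"
proof -
  interpret random_environment M T p lam
  proof (intro random_environment.intro ergodic_lattice_action.intro prob
      ergodic_lattice_action_axioms.intro random_environment_axioms.intro)
    show "0 \<le> p \<omega> e" if "\<omega> \<in> space M" "e \<in> unit_steps" for \<omega> e
      using p_range[OF that] by simp
  qed (fact T_mp T_zero T_add ergodic p_meas p_sum log_moment)+
  show ?thesis using quenched_free_energy unfolding Z_def .
qed

end
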